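(* Let $D>7/2$. For each $N\ge 10$ there is a set $A\subset [N]$ of size \[ |A| \ge \frac{N}{(\log N)^\theta (\log\log N)^D}, \] for which $|AA| \sim |A|^2/2$ as $N\to\infty$.
   Context: $[N]=\{1,2,\ldots,N\}$. For $A,B\subset\mathbb N$, $AB=\{ab: a\in A, b\in B\}$ denotes the product set, so $AA=\{aa': a,a'\in A\}$. The set $A$ depends on $N$, and $|AA|\sim |A|^2/2$ as $N\to\infty$ means that the ratio of the two sides tends to $1$ as $N\to\infty$. The logarithm is natural, and \[ \theta=\frac12-\frac{1+\log\log 2}{\log 4} = 1-\frac{1+\log\log 4}{\log 4}=0.04303566\ldots. \]
   Formalization: The size bound is required only for N ≥ 16 instead of N ≥ 10: since log log N < 1 for 10 ≤ N ≤ 15, the stated bound exceeds N there (at N = 10 it is over 18 for every D > 7/2; at N = 15 only for large D), so no subset of [N] can attain it. *)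

theory Defs
  imports Complex_Main "HOL-Library.Set_Algebras" "HOL-Library.Landau_Symbols"
begin

text \<open>
  For sets of natural numbers, \<open>A * B\<close> is the product set
  \<open>{a * b | a b. a \<in> A \<and> b \<in> B}\<close>, see theory \<^theory>\<open>HOL-Library.Set_Algebras\<close>.
\<close>

text \<open>
  In the size bound \<open>N / (ln N powr theta * ln (ln N) powr D)\<close> one needs \<open>ln (ln N) \<ge> 1\<close>,
  that is \<open>N \<ge> 16\<close>: for \<open>10 \<le> N \<le> 15\<close> we have \<open>0 < ln (ln N) < 1\<close>, and the bound exceeds \<open>N\<close>,
  so that no subset of \<open>{1..N}\<close> attains it, once \<open>D\<close> is large.
\<close>

definition theta :: real where
  "theta = 1 / 2 - (1 + ln (ln 2)) / ln 4"

lemma theta_altdef: "theta = 1 - (1 + ln (ln 4)) / ln 4"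
proof -
  have ln4: "ln (4::real) = 2 * ln 2"
    using ln_realpow[of "2::real" 2] by simp
  have "ln (ln (4::real)) = ln 2 + ln (ln 2)"
    unfolding ln4 by (subst ln_mult_pos) simp_all
  then show ?thesis
    unfolding theta_def by (simp add: ln4 field_simps)
qed

end

theory Submission
  imports Defs "HOL-Computational_Algebra.Primes" "HOL-Analysis.Summation_Tests"
    "HOL-Analysis.Complex_Transcendental" "HOL-Real_Asymp.Real_Asymp"
begin

text \<open>
  Write \<open>L = ln (ln N)\<close>. The set \<open>A\<close> is a thin subset of a family \<open>B\<close> of integers \<open>m * p\<close>, where
  \<open>p\<close> is a large prime and \<open>m\<close> is a squarefree product of \<open>k\<close> smaller primes, \<open>k\<close> being close to
  \<open>L / ln 4\<close>. The smaller primes are grouped into \<open>k\<close> blocks whose reciprocals sum to nearly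
  \<open>ln 4\<close>, so that the primes of block \<open>j\<close> have logarithms of order \<open>4 ^ j\<close>, and \<open>m\<close> has on average
  one prime in each block. The integer \<open>m\<close> is required to be tame: for every \<open>i\<close>, at most \<open>i\<close> of its
  primes lie in the first \<open>i\<close> blocks.

  Size of \<open>B\<close>. The reciprocals of all products of \<open>k\<close> primes from the blocks sum to about
  \<open>(k * ln 4) ^ k / fact k\<close>, which is \<open>(exp 1 * ln 4) ^ k\<close> up to a power of \<open>k\<close>. As \<open>4 ^ k\<close> has the
  order of \<open>ln N\<close> and \<open>4 powr (1 - theta) = exp 1 * ln 4\<close>, this is \<open>(ln N) powr (1 - theta)\<close>, and the
  choice of \<open>p\<close> contributes \<open>N / ln N\<close>. Tameness is the condition of the ballot problem: it replaces
  \<open>k ^ k\<close> by the number \<open>(k + 1) ^ (k - 1)\<close> of parking functions and costs only a factor \<open>k\<close>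
  (\<open>tame_weight_le\<close> and \<open>tame_weight_ge\<close>).

  Energy of \<open>B\<close>. In a coincidence \<open>b1 * b2 = b3 * b4\<close> the large primes match in pairs, and the four
  remaining sets of primes have the form \<open>g \<union> s\<close>, \<open>h \<union> t\<close>, \<open>g \<union> t\<close>, \<open>h \<union> s\<close>, where the products of \<open>s\<close>
  and \<open>t\<close> differ by a bounded factor. Let \<open>J\<close> be the last block that meets \<open>s \<union> t\<close>. Once all other
  primes of \<open>s\<close> and \<open>t\<close> are known, a prime of block \<open>J\<close> is confined to a short interval, which saves a
  factor \<open>4 ^ J\<close>. On the other hand there are \<open>2 ^ n\<close> ways of distributing \<open>n\<close> primes from the first \<open>J\<close>
  blocks over \<open>g\<close> and \<open>s\<close>, and as many for \<open>h\<close> and \<open>t\<close>. Tameness gives \<open>n \<le> J\<close>, so that the loss is at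
  most \<open>4 ^ J\<close> and is cancelled by the saving. Each of the \<open>k\<close> values of \<open>J\<close> therefore contributes no
  more than a constant times the square of the total mass (\<open>energy_bound\<close>).

  Thinning. A set of \<open>a\<close> elements can be chosen in \<open>B\<close> such that the number of nontrivial coincidences
  drops by the factor \<open>(a / card B) ^ 4\<close> (\<open>thin_subset\<close>). Divided by \<open>a\<^sup>2\<close>, what is left is at most a
  constant times \<open>k ^ 7 * L powr (- 2 * D)\<close>, hence \<open>L powr (7 - 2 * D)\<close>: one factor \<open>k\<close> stems from the
  energy, four from the factor \<open>1 / k\<close> in the size of \<open>B\<close>, and two from the estimate
  \<open>fact k \<le> exp 1 * k * (k / exp 1) ^ k\<close> (\<open>good_subsets\<close>). This tends to 0 precisely for \<open>D > 7 / 2\<close>.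
  Almost all products of two elements of \<open>A\<close> are then distinct, up to the order of the factors.

  The number theory behind this consists of the Chebyshev bounds and of the lower bound in the second
  theorem of Mertens, with error \<open>O(1 / ln x)\<close>. They are derived from the bound for the primorial and
  from Legendre's formula for the factorial.
\<close>


section \<open>Elementary prime number estimates\<close>

definition primes_in :: "nat \<Rightarrow> nat \<Rightarrow> nat set" where
  "primes_in x y = {p. prime p \<and> x < p \<and> p \<le> y}"

lemma finite_primes_in [simp]: "finite (primes_in x y)"
  unfolding primes_in_def by (rule finite_subset[of _ "{..y}"]) auto

lemma primes_in_subset: "primes_in x y \<subseteq> {x<..y}"
  by (auto simp: primes_in_def)

text \<open>
  This coefficient occurs twice in row \<open>2 * m + 1\<close> of the triangle of Pascal, whose sum is \<open>2 * 4 ^ m\<close>.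
\<close>

lemma binomial_odd_middle_le: "((2 * m + 1) choose m) \<le> 4 ^ m"
proof -
  have "((2 * m + 1) choose m) + ((2 * m + 1) choose (m + 1)) = (\<Sum>i\<in>{m, m + 1}. (2 * m + 1) choose i)"
    by simp
  also have "\<dots> \<le> (\<Sum>i\<le>2 * m + 1. (2 * m + 1) choose i)"
    by (rule sum_mono2) auto
  also have "\<dots> = 2 ^ (2 * m + 1)" by (rule choose_row_sum)
  also have "(2 * m + 1) choose (m + 1) = (2 * m + 1) choose m"
    by (subst binomial_symmetric) auto
  finally show ?thesis by (simp add: power_mult)
qed

lemma prod_primes_dvd:
  fixes c :: nat
  assumes "finite S" "\<And>p. p \<in> S \<Longrightarrow> prime p" "\<And>p. p \<in> S \<Longrightarrow> p dvd c"
  shows "\<Prod>S dvd c"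
  using assms
proof (induction S rule: finite_induct)
  case (insert p S)
  have "coprime p (\<Prod>S)"
    using insert by (intro prod_coprime_right) (metis insertCI primes_coprime)
  thus ?case using insert by (simp add: divides_mult)
qed auto

text \<open>
  For \<open>n = 2 * m + 1\<close>, every prime in the interval from \<open>m + 2\<close> to \<open>n\<close> divides \<open>n choose m\<close>, which is at
  most \<open>4 ^ m\<close>; the primes up to \<open>m + 1\<close> are left to the induction hypothesis.
\<close>

lemma primorial_le: "\<Prod>(primes_in 0 n) \<le> 4 ^ n"
proof (induction n rule: less_induct)
  case (less n)
  consider "n \<le> 1" | "n = 2" | "n > 2" "even n" | "n > 2" "odd n" by linarith
  thus ?case
  proof cases
    case 1
    hence "primes_in 0 n = {}" by (auto simp: primes_in_def dest: prime_gt_1_nat)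
    thus ?thesis by simp
  next
    case 2
    have "primes_in 0 2 = {2}"
      by (auto simp: primes_in_def) (metis One_nat_def le_antisym prime_ge_2_nat)
    thus ?thesis using 2 by simp
  next
    case 3
    hence "\<not> prime n" using primes_dvd_imp_eq two_is_prime_nat by blast
    have "p \<le> n \<longleftrightarrow> p \<le> n - 1" if "prime p" for p
    proof -
      have "p \<noteq> n" using that \<open>\<not> prime n\<close> by metis
      thus ?thesis using 3 by linarith
    qed
    hence "primes_in 0 n = primes_in 0 (n - 1)" unfolding primes_in_def by (intro Collect_cong) metis
    hence "\<Prod>(primes_in 0 n) \<le> 4 ^ (n - 1)" using less[of "n - 1"] 3 by simp
    also have "\<dots> \<le> 4 ^ n" by (rule power_increasing) auto
    finally show ?thesis .
  next
    case 4
    then obtain m where m: "n = 2 * m + 1" by (elim oddE)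
    have split: "primes_in 0 n = primes_in 0 (m + 1) \<union> primes_in (m + 1) n"
      using m by (auto simp: primes_in_def)
    have "\<Prod>(primes_in 0 n) = \<Prod>(primes_in 0 (m + 1)) * \<Prod>(primes_in (m + 1) n)"
      unfolding split by (rule prod.union_disjoint) (auto simp: primes_in_def)
    also have "\<dots> \<le> 4 ^ (m + 1) * 4 ^ m"
    proof (rule mult_mono)
      show "\<Prod>(primes_in 0 (m + 1)) \<le> 4 ^ (m + 1)" using less[of "m + 1"] m 4 by simp
      have "p dvd (n choose m)" if "p \<in> primes_in (m + 1) n" for p
      proof -
        have p: "prime p" "m + 1 < p" "p \<le> n" using that by (auto simp: primes_in_def)
        have "fact m * fact (n - m) * (n choose m) = (fact n :: nat)"
          using m by (intro binomial_fact_lemma) auto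
        moreover have "p dvd (fact n :: nat)" using p prime_dvd_fact_iff by blast
        moreover have "\<not> p dvd fact m" "\<not> p dvd fact (n - m)"
          using p m unfolding prime_dvd_fact_iff[OF p(1)] by linarith+
        ultimately show ?thesis using p(1) by (metis prime_dvd_mult_iff)
      qed
      hence "\<Prod>(primes_in (m + 1) n) dvd (n choose m)"
        by (intro prod_primes_dvd) (auto simp: primes_in_def)
      hence "\<Prod>(primes_in (m + 1) n) \<le> (n choose m)"
        by (rule dvd_imp_le) (use m in auto)
      also have "\<dots> \<le> 4 ^ m" using m binomial_odd_middle_le by simp
      finally show "\<Prod>(primes_in (m + 1) n) \<le> 4 ^ m" .
    qed auto
    also have "\<dots> = 4 ^ n" using m by (simp flip: power_add)
    finally show ?thesis .
  qed
qed

lemma sum_ln_primes_le: "(\<Sum>p\<in>primes_in 0 n. ln (real p)) \<le> real n * ln 4"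
proof -
  have "(\<Sum>p\<in>primes_in 0 n. ln (real p)) = ln (\<Prod>p\<in>primes_in 0 n. real p)"
    by (rule ln_prod[symmetric]) (auto simp: primes_in_def prime_gt_0_nat)
  also have "\<dots> = ln (real (\<Prod>(primes_in 0 n)))" by simp
  also have "\<dots> \<le> ln (real (4 ^ n))"
  proof (subst ln_le_cancel_iff)
    show "real (\<Prod>(primes_in 0 n)) > 0" unfolding of_nat_prod
      by (rule prod_pos) (auto simp: primes_in_def prime_gt_0_nat)
    show "real (\<Prod>(primes_in 0 n)) \<le> real (4 ^ n)" using primorial_le[of n] by (simp only: of_nat_le_iff)
  qed auto
  also have "\<dots> = real n * ln 4" by (simp add: ln_realpow)
  finally show ?thesis .
qed

lemma fact_ge_power_div_exp: "(real n / exp 1) ^ n \<le> fact n"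
proof -
  have "(\<Sum>i\<in>{n}. real n ^ i /\<^sub>R fact i) \<le> (\<Sum>i. real n ^ i /\<^sub>R fact i)"
    using exp_converges[of "real n"] by (intro sum_le_suminf) (auto simp: sums_iff)
  also have "\<dots> = exp (real n)" by (simp add: exp_def)
  also have "\<dots> = exp 1 ^ n" by (simp flip: exp_of_nat_mult)
  finally show ?thesis by (simp add: field_simps power_divide)
qed

lemma ln_fact_ge: "real n * ln (real n) - real n \<le> ln (fact n)"
proof (cases "n = 0")
  case False
  have "real n * ln (real n) - real n = ln ((real n / exp 1) ^ n)"
    using False by (simp add: ln_realpow ln_div algebra_simps)
  also have "\<dots> \<le> ln (fact n)"
    using False fact_ge_power_div_exp[of n] by (subst ln_le_cancel_iff) auto
  finally show ?thesis .
qed auto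

lemma ln_fact_le: "ln (fact n) \<le> real n * ln (real n)"
proof (cases "n = 0")
  case False
  have "ln (fact n :: real) \<le> ln (real (n ^ n))"
    using False fact_le_power[of n, where 'a = real] by (subst ln_le_cancel_iff) auto
  thus ?thesis using False by (simp add: ln_realpow)
qed auto

text \<open>
  Only the multiples of \<open>p\<close> matter. Each supplies one factor \<open>p\<close>, and their cofactors multiply to
  \<open>fact (n div p)\<close>.
\<close>

lemma multiplicity_fact:
  fixes p :: nat
  assumes "prime p"
  shows "multiplicity p (fact n :: nat) = n div p + multiplicity p (fact (n div p) :: nat)"
proof (induction n)
  case (Suc n)
  have p1: "p > 1" using assms prime_gt_1_nat by blast
  have mult: "multiplicity p (Suc n * fact n :: nat) = multiplicity p (Suc n) + multiplicity p (fact n :: nat)"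
    using assms by (intro prime_elem_multiplicity_mult_distrib) auto
  show ?case
  proof (cases "p dvd Suc n")
    case True
    then obtain q where q: "Suc n = p * q" by blast
    have q0: "q > 0" using q by (cases q) auto
    have "Suc n div p = q" using q p1 by simp
    have nd: "n div p = q - 1"
    proof -
      have "n = p * (q - 1) + (p - 1)" using q q0 p1
        by (cases q) (auto simp: algebra_simps)
      moreover have "(p - 1) div p = 0" using p1 by simp
      ultimately show ?thesis using p1
        by (metis add.right_neutral div_mult_self4 not_one_less_zero)
    qed
    have "multiplicity p (Suc n) = Suc (multiplicity p q)"
      unfolding q using assms q0 p1 by (intro multiplicity_times_same) auto
    moreover have "multiplicity p (fact q :: nat) = multiplicity p q + multiplicity p (fact (q - 1) :: nat)"
      using assms q0 by (subst fact_reduce) (auto intro!: prime_elem_multiplicity_mult_distrib)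
    ultimately show ?thesis using Suc mult nd \<open>Suc n div p = q\<close> q0 by simp
  next
    case False
    hence "Suc n div p = n div p" by (simp add: div_Suc dvd_eq_mod_eq_0)
    moreover have "multiplicity p (Suc n) = 0" using False by (rule not_dvd_imp_multiplicity_0)
    ultimately show ?thesis using Suc mult by simp
  qed
qed auto

lemma multiplicity_fact_le:
  fixes p :: nat
  assumes "prime p"
  shows "real (multiplicity p (fact n :: nat)) \<le> real n / (real p - 1)"
proof (induction n rule: less_induct)
  case (less n)
  have p1: "p > 1" using assms prime_gt_1_nat by blast
  show ?case
  proof (cases "n = 0")
    case False
    have q: "real (n div p) \<le> real n / real p" by (simp add: of_nat_div_le_of_nat)
    have "real (multiplicity p (fact n :: nat)) = real (n div p) + real (multiplicity p (fact (n div p) :: nat))"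
      by (subst multiplicity_fact[OF assms]) simp
    also have "\<dots> \<le> real (n div p) + real (n div p) / (real p - 1)"
      using less[of "n div p"] False p1 by simp
    also have "\<dots> = real (n div p) * (real p / (real p - 1))" using p1 by (simp add: field_simps)
    also have "\<dots> \<le> real n / real p * (real p / (real p - 1))"
      using q p1 by (intro mult_right_mono) auto
    also have "\<dots> = real n / (real p - 1)" using p1 by simp
    finally show ?thesis .
  qed auto
qed

lemma ln_fact_eq_sum_primes:
  "ln (fact n) = (\<Sum>p\<in>primes_in 0 n. real (multiplicity p (fact n :: nat)) * ln (real p))"
proof -
  have pf: "prime_factors (fact n :: nat) = primes_in 0 n"
    unfolding prime_factors_fact by (auto simp: primes_in_def prime_gt_0_nat prime_ge_2_nat)
  have "(fact n :: nat) = (\<Prod>p\<in>primes_in 0 n. p ^ multiplicity p (fact n :: nat))"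
    using prime_factorization_nat[of "fact n"] pf by simp
  hence "ln (fact n :: real) = ln (\<Prod>p\<in>primes_in 0 n. real p ^ multiplicity p (fact n :: nat))"
    by (metis (mono_tags, lifting) of_nat_fact of_nat_power of_nat_prod prod.cong)
  also have "\<dots> = (\<Sum>p\<in>primes_in 0 n. ln (real p ^ multiplicity p (fact n :: nat)))"
    by (rule ln_prod) (auto simp: primes_in_def prime_gt_0_nat)
  also have "\<dots> = (\<Sum>p\<in>primes_in 0 n. real (multiplicity p (fact n :: nat)) * ln (real p))"
    by (simp add: ln_realpow)
  finally show ?thesis .
qed

definition mertens_sum :: "nat \<Rightarrow> real" where
  "mertens_sum n = (\<Sum>p\<in>primes_in 0 n. ln (real p) / real p)"

text \<open>
  Up to rounding, \<open>ln (fact n)\<close> contains \<open>n / p\<close> copies of \<open>ln p\<close>; the rounding errors add up to at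
  most the logarithm of the primorial, which is linear in \<open>n\<close>.
\<close>

lemma mertens_sum_le:
  assumes "n > 0"
  shows "mertens_sum n \<le> ln (real n) + ln 4"
proof -
  have "real n * mertens_sum n - real n * ln 4
      \<le> real n * mertens_sum n - (\<Sum>p\<in>primes_in 0 n. ln (real p))"
    using sum_ln_primes_le[of n] by simp
  also have "\<dots> = (\<Sum>p\<in>primes_in 0 n. (real n / real p - 1) * ln (real p))"
    unfolding mertens_sum_def by (simp add: sum_distrib_left algebra_simps sum_subtractf)
  also have "\<dots> \<le> (\<Sum>p\<in>primes_in 0 n. real (multiplicity p (fact n :: nat)) * ln (real p))"
  proof (intro sum_mono mult_right_mono)
    fix p assume "p \<in> primes_in 0 n"
    hence p: "prime p" "p > 0" by (auto simp: primes_in_def prime_gt_0_nat)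
    have "real n / real p - 1 \<le> real (n div p)"
    proof -
      have "n < p * (n div p) + p" using p(2) by (metis add.commute mult.commute dividend_less_div_times)
      hence "real n < real p * (real (n div p) + 1)"
        by (metis (mono_tags, lifting) of_nat_less_iff of_nat_add of_nat_mult of_nat_1 distrib_left mult.right_neutral)
      thus ?thesis using p(2) by (simp add: field_simps)
    qed
    also have "\<dots> \<le> real (multiplicity p (fact n :: nat))"
      by (subst multiplicity_fact[OF p(1)]) simp
    finally show "real n / real p - 1 \<le> real (multiplicity p (fact n :: nat))" .
    show "ln (real p) \<ge> 0" using p by simp
  qed
  also have "\<dots> = ln (fact n)" by (rule ln_fact_eq_sum_primes[symmetric])
  also have "\<dots> \<le> real n * ln (real n)" by (rule ln_fact_le)
  finally have "real n * mertens_sum n \<le> real n * (ln (real n) + ln 4)"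
    by (simp add: algebra_simps)
  thus ?thesis using assms by simp
qed

text \<open>
  The exponent of \<open>p\<close> in \<open>fact n\<close> is at most \<open>n / (p - 1)\<close>, and replacing \<open>1 / (p - 1)\<close> by \<open>1 / p\<close>
  changes the sum by a convergent series.
\<close>

lemma mertens_sum_ge:
  obtains C where "C \<ge> 0" "\<And>n. n > 0 \<Longrightarrow> mertens_sum n \<ge> ln (real n) - C"
proof -
  define f where "f = (\<lambda>m::nat. ln (real m) / (real m * (real m - 1)))"
  have "summable f"
  proof (rule summable_comparison_test_bigo)
    show "summable (\<lambda>m. norm (real m powr (-3/2)))"
      by (simp add: summable_real_powr_iff)
    show "f \<in> O(\<lambda>m. real m powr (-3/2))" unfolding f_def by real_asymp
  qed
  have f0: "f m \<ge> 0" for m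
    unfolding f_def by (cases "m = 0") auto
  have fsum: "sum f A \<le> suminf f" if "finite A" for A
    using \<open>summable f\<close> that f0 by (intro sum_le_suminf) auto
  show ?thesis
  proof (rule that)
    show "1 + suminf f \<ge> 0" using suminf_nonneg[OF \<open>summable f\<close>] f0 by simp
    fix n :: nat assume n: "n > 0"
    have "real n * ln (real n) - real n \<le> ln (fact n)" by (rule ln_fact_ge)
    also have "\<dots> = (\<Sum>p\<in>primes_in 0 n. real (multiplicity p (fact n :: nat)) * ln (real p))"
      by (rule ln_fact_eq_sum_primes)
    also have "\<dots> \<le> (\<Sum>p\<in>primes_in 0 n. real n / (real p - 1) * ln (real p))"
      by (intro sum_mono mult_right_mono multiplicity_fact_le)
         (auto simp: primes_in_def prime_gt_0_nat)
    also have "\<dots> = (\<Sum>p\<in>primes_in 0 n. real n * (ln (real p) / real p + f p))"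
    proof (intro sum.cong refl)
      fix p assume "p \<in> primes_in 0 n"
      hence "real p > 1" using prime_gt_1_nat by (auto simp: primes_in_def)
      thus "real n / (real p - 1) * ln (real p) = real n * (ln (real p) / real p + f p)"
        unfolding f_def by (simp add: divide_simps) (simp add: algebra_simps)
    qed
    also have "\<dots> = real n * (mertens_sum n + sum f (primes_in 0 n))"
      by (simp add: mertens_sum_def sum_distrib_left[symmetric] sum.distrib)
    also have "\<dots> \<le> real n * (mertens_sum n + suminf f)"
      using fsum[of "primes_in 0 n"] by (intro mult_left_mono) auto
    finally have "real n * ln (real n) \<le> real n * (mertens_sum n + 1 + suminf f)"
      by (simp add: algebra_simps)
    thus "mertens_sum n \<ge> ln (real n) - (1 + suminf f)" using n by simp
  qed
qed

lemma mertens_first: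
  obtains C where "C \<ge> 0" "\<And>n. n > 0 \<Longrightarrow> \<bar>mertens_sum n - ln (real n)\<bar> \<le> C"
proof -
  obtain C where C: "C \<ge> 0" "\<And>n. n > 0 \<Longrightarrow> mertens_sum n \<ge> ln (real n) - C"
    using mertens_sum_ge by blast
  show ?thesis
  proof (rule that[of "max C (ln 4)"])
    show "\<bar>mertens_sum n - ln (real n)\<bar> \<le> max C (ln 4)" if "n > 0" for n
      using C(2)[OF that] mertens_sum_le[OF that] by linarith
  qed (use C in auto)
qed

lemma mertens_sum_diff:
  assumes "x \<le> y"
  shows "mertens_sum y - mertens_sum x = (\<Sum>p\<in>primes_in x y. ln (real p) / real p)"
proof -
  have "primes_in 0 y = primes_in 0 x \<union> primes_in x y" using assms by (auto simp: primes_in_def)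
  moreover have "primes_in 0 x \<inter> primes_in x y = {}" by (auto simp: primes_in_def)
  ultimately show ?thesis unfolding mertens_sum_def by (simp add: sum.union_disjoint)
qed

text \<open>
  Summation by parts. For the induction the last weight \<open>f (Suc n)\<close> has to remain visible, multiplied
  by the last partial sum; it is estimated only at the end.
\<close>

lemma abel_lower_bound:
  fixes c f :: "nat \<Rightarrow> real"
  assumes "x \<le> y"
    and partial: "\<And>n. x \<le> n \<Longrightarrow> n \<le> y \<Longrightarrow> (\<Sum>i\<in>{x<..n}. c i) \<ge> - K"
    and decreasing: "\<And>n. x < n \<Longrightarrow> f (Suc n) \<le> f n" and nonneg: "\<And>n. x < n \<Longrightarrow> f n \<ge> 0"
  shows "(\<Sum>i\<in>{x<..y}. c i * f i) \<ge> - K * f (Suc x)"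
proof -
  define s where "s n = (\<Sum>i\<in>{x<..n}. c i)" for n
  have step: "{x<..Suc n} = insert (Suc n) {x<..n}" if "x \<le> n" for n using that by auto
  have "(\<Sum>i\<in>{x<..n}. c i * f i) \<ge> s n * f (Suc n) + - K * (f (Suc x) - f (Suc n))"
    if "x \<le> n" "n \<le> y" for n
    using that
  proof (induction n rule: dec_induct)
    case base
    show ?case by (simp add: s_def)
  next
    case (step n)
    have s: "s (Suc n) = s n + c (Suc n)" using step(1) by (simp add: s_def \<open>x \<le> n \<Longrightarrow> _\<close>)
    have "(\<Sum>i\<in>{x<..Suc n}. c i * f i) = c (Suc n) * f (Suc n) + (\<Sum>i\<in>{x<..n}. c i * f i)"
      using step(1) by (simp add: \<open>x \<le> n \<Longrightarrow> _\<close>)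
    also have "\<dots> \<ge> c (Suc n) * f (Suc n) + (s n * f (Suc n) + - K * (f (Suc x) - f (Suc n)))"
      using step by simp
    also have "c (Suc n) * f (Suc n) + (s n * f (Suc n) + - K * (f (Suc x) - f (Suc n)))
      = s (Suc n) * f (Suc n) + - K * (f (Suc x) - f (Suc n))" by (simp add: s algebra_simps)
    also have "\<dots> = s (Suc n) * f (Suc (Suc n)) + s (Suc n) * (f (Suc n) - f (Suc (Suc n)))
        + - K * (f (Suc x) - f (Suc n))" by (simp add: algebra_simps)
    also have "\<dots> \<ge> s (Suc n) * f (Suc (Suc n)) + - K * (f (Suc n) - f (Suc (Suc n)))
        + - K * (f (Suc x) - f (Suc n))"
      using mult_right_mono[OF partial[of "Suc n"], of "f (Suc n) - f (Suc (Suc n))"]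
        step decreasing[of "Suc n"] by (simp add: s_def)
    finally show ?case by (simp add: algebra_simps)
  qed
  from this[of y] have "(\<Sum>i\<in>{x<..y}. c i * f i) \<ge> s y * f (Suc y) + - K * (f (Suc x) - f (Suc y))"
    using assms(1) by simp
  moreover have "s y * f (Suc y) \<ge> - K * f (Suc y)"
    using partial[of y] assms(1) nonneg[of "Suc y"] unfolding s_def by (intro mult_right_mono) auto
  ultimately show ?thesis by (simp add: algebra_simps)
qed

text \<open>
  The weights \<open>ln p / p\<close> of the primes and the increments of \<open>ln\<close> have partial sums that differ by a
  bounded amount, by the first theorem of Mertens. Summation by parts against \<open>1 / ln\<close> transfers this to
  \<open>1 / p\<close> and the increments of \<open>ln (ln x)\<close>. The error \<open>C / ln x\<close>, rather than a constant, is what makes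
  the errors of the blocks summable later on.
\<close>

lemma mertens_second_lower:
  obtains C where "C \<ge> 0"
    "\<And>x y. 2 \<le> x \<Longrightarrow> x \<le> y \<Longrightarrow>
       (\<Sum>p\<in>primes_in x y. 1 / real p) \<ge> ln (ln (real y) / ln (real x)) - C / ln (real x)"
proof -
  obtain C where C: "C \<ge> 0" "\<And>n. n > 0 \<Longrightarrow> \<bar>mertens_sum n - ln (real n)\<bar> \<le> C"
    using mertens_first by blast
  show ?thesis
  proof (rule that[of "2 * C + 1"])
    show "2 * C + 1 \<ge> 0" using C by simp
    fix x y :: nat assume xy: "2 \<le> x" "x \<le> y"
    \<comment> \<open>The increments of \<open>ln\<close> serve as a model of the weights \<open>ln p / p\<close> of the primes.\<close>
    define d where "d = (\<lambda>n. ln (real n) - ln (real (n - 1)))"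
    define c where "c = (\<lambda>n. (if prime n then ln (real n) / real n else 0) - d n)"
    define f where "f = (\<lambda>n::nat. 1 / ln (real n))"
    have sum_d: "(\<Sum>i\<in>{x<..n}. d i) = ln (real n) - ln (real x)" if "x \<le> n" for n
      using that
    proof (induction n rule: dec_induct)
      case (step n)
      have "{x<..Suc n} = insert (Suc n) {x<..n}" using step by auto
      thus ?case using step by (simp add: d_def)
    qed auto
    have sum_c: "(\<Sum>i\<in>{x<..n}. c i) = (mertens_sum n - ln (real n)) - (mertens_sum x - ln (real x))"
      if "x \<le> n" for n
    proof -
      have "(\<Sum>i\<in>{x<..n}. if prime i then ln (real i) / real i else 0) = mertens_sum n - mertens_sum x"
        unfolding mertens_sum_diff[OF that]
        by (rule sum.mono_neutral_cong_right) (auto simp: primes_in_def)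
      thus ?thesis using sum_d[OF that] by (simp add: c_def sum_subtractf)
    qed
    have "(\<Sum>i\<in>{x<..y}. c i * f i) \<ge> - (2 * C) * f (Suc x)"
    proof (rule abel_lower_bound[OF xy(2)])
      fix n assume "x \<le> n"
      thus "- (2 * C) \<le> sum c {x<..n}" using sum_c[of n] C(2)[of n] C(2)[of x] xy by auto
    next
      fix n assume "x < n"
      thus "f (Suc n) \<le> f n" "f n \<ge> 0" using xy unfolding f_def
        by (auto intro!: divide_left_mono)
    qed
    moreover have "f (Suc x) \<le> 1 / ln (real x)" using xy unfolding f_def
      by (auto intro!: divide_left_mono)
    hence "- (2 * C) * f (Suc x) \<ge> - (2 * C) * (1 / ln (real x))"
      using C by (intro mult_left_mono_neg) auto
    moreover have "(\<Sum>i\<in>{x<..y}. c i * f i) = (\<Sum>p\<in>primes_in x y. 1 / real p) - (\<Sum>i\<in>{x<..y}. d i * f i)"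
    proof -
      have "(\<Sum>i\<in>{x<..y}. (if prime i then ln (real i) / real i else 0) * f i) = (\<Sum>p\<in>primes_in x y. 1 / real p)"
        using xy by (intro sum.mono_neutral_cong_right) (auto simp: primes_in_def f_def)
      thus ?thesis by (simp add: c_def left_diff_distrib sum_subtractf)
    qed
    moreover have "(\<Sum>i\<in>{x<..n}. d i * f i) \<ge> ln (ln (real n)) - ln (ln (real x)) - (1 / ln (real x) - 1 / ln (real n))"
      if "x \<le> n" for n
      using that
    proof (induction n rule: dec_induct)
      case (step n)
      have eq: "{x<..Suc n} = insert (Suc n) {x<..n}" using step by auto
      define a b where "a = ln (real n)" and "b = ln (real (Suc n))"
      have a0: "a > 0" using step xy by (simp add: a_def)
      have ab: "a \<le> b" using step xy by (simp add: a_def b_def)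
      have n0: "real n > 0" using step xy by simp
      have "b - a = ln (real (Suc n) / real n)" unfolding a_def b_def
        using n0 by (subst ln_div) auto
      also have "real (Suc n) / real n = 1 + 1 / real n" using n0 by (simp add: field_simps)
      also have "ln (1 + 1 / real n) \<le> 1 / real n" by (rule ln_add_one_self_le_self) simp
      also have "1 / real n \<le> 1" using step xy by simp
      finally have ba: "b - a \<le> 1" .
      have "ln b - ln a = ln (b / a)" using a0 ab by (simp add: ln_div)
      also have "\<dots> \<le> b / a - 1" using a0 ab by (intro ln_le_minus_one) simp
      also have "\<dots> = (b - a) / b + (b - a) * (1 / a - 1 / b)" using a0 ab by (simp add: field_simps)
      also have "(b - a) * (1 / a - 1 / b) \<le> 1 * (1 / a - 1 / b)"
        using a0 ab ba by (intro mult_right_mono) (auto simp: frac_le)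
      finally have "ln b - ln a \<le> (b - a) / b + (1 / a - 1 / b)" by simp
      moreover have "d (Suc n) * f (Suc n) = (b - a) / b" by (simp add: d_def f_def a_def b_def)
      ultimately show ?case using step unfolding eq a_def b_def by simp
    qed auto
    note this[OF xy(2)]
    moreover have "1 / ln (real y) \<ge> 0" using xy by simp
    moreover have "ln (ln (real y) / ln (real x)) = ln (ln (real y)) - ln (ln (real x))"
    proof -
      have "ln (real x) > 0" "ln (real y) > 0" using xy by auto
      thus ?thesis by (simp add: ln_div)
    qed
    moreover have "(2 * C + 1) / ln (real x) = 2 * C * (1 / ln (real x)) + 1 / ln (real x)"
      by (simp add: add_divide_distrib)
    ultimately show "(\<Sum>p\<in>primes_in x y. 1 / real p) \<ge> ln (ln (real y) / ln (real x)) - (2 * C + 1) / ln (real x)"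
      by linarith
  qed
qed

text \<open>
  At most \<open>sqrt n\<close> primes lie below \<open>sqrt n\<close>, and each of the others contributes at least \<open>ln n / 2\<close> to
  the logarithm of the primorial.
\<close>

lemma chebyshev_upper:
  obtains C where "C \<ge> 1" "\<And>n. n \<ge> 2 \<Longrightarrow> real (card (primes_in 0 n)) \<le> C * real n / ln (real n)"
proof -
  have sq: "sqrt x * ln x \<le> 2 * x" if "x \<ge> 1" for x :: real
  proof -
    have "ln x = 2 * ln (sqrt x)" using that by (simp add: ln_sqrt)
    also have "ln (sqrt x) \<le> sqrt x - 1" using that by (intro ln_le_minus_one) auto
    finally have "ln x \<le> 2 * sqrt x" by simp
    hence "sqrt x * ln x \<le> sqrt x * (2 * sqrt x)" using that by (intro mult_left_mono) auto
    also have "\<dots> = 2 * x" using that by simp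
    finally show ?thesis .
  qed
  show ?thesis
  proof (rule that[of "2 + 2 * ln 4"])
    fix n :: nat assume n: "n \<ge> 2"
    define s where "s = nat \<lfloor>sqrt (real n)\<rfloor>"
    have s: "real s \<le> sqrt (real n)" "sqrt (real n) < real s + 1"
      unfolding s_def by auto
    have sqn: "sqrt (real n) \<le> real n" using n by (intro real_le_lsqrt) (auto simp: power2_eq_square)
    have sn: "s \<le> n" using s sqn by linarith
    have "primes_in 0 n = primes_in 0 s \<union> primes_in s n" using sn by (auto simp: primes_in_def)
    hence "card (primes_in 0 n) \<le> card (primes_in 0 s) + card (primes_in s n)"
      by (simp add: card_Un_le)
    also have "card (primes_in 0 s) \<le> s"
      using card_mono[OF _ primes_in_subset[of 0 s]] by simp
    finally have 1: "real (card (primes_in 0 n)) \<le> sqrt (real n) + real (card (primes_in s n))"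
      using s by linarith
    have lnn: "ln (real n) > 0" using n by simp
    have "real (card (primes_in s n)) * (ln (real n) / 2) = (\<Sum>p\<in>primes_in s n. ln (real n) / 2)" by simp
    also have "\<dots> \<le> (\<Sum>p\<in>primes_in s n. ln (real p))"
    proof (rule sum_mono)
      fix p assume "p \<in> primes_in s n"
      hence "real p \<ge> sqrt (real n)" "p > 0" using s by (auto simp: primes_in_def)
      hence "ln (sqrt (real n)) \<le> ln (real p)" using n by (subst ln_le_cancel_iff) auto
      thus "ln (real n) / 2 \<le> ln (real p)" using n by (simp add: ln_sqrt)
    qed
    also have "\<dots> \<le> (\<Sum>p\<in>primes_in 0 n. ln (real p))"
      by (rule sum_mono2) (auto simp: primes_in_def prime_gt_0_nat)
    also have "\<dots> \<le> real n * ln 4" by (rule sum_ln_primes_le)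
    finally have 2: "real (card (primes_in s n)) * ln (real n) \<le> 2 * ln 4 * real n"
      by (simp add: mult_ac)
    have "real (card (primes_in 0 n)) * ln (real n) \<le> (sqrt (real n) + real (card (primes_in s n))) * ln (real n)"
      using 1 lnn by (intro mult_right_mono) auto
    also have "\<dots> \<le> (2 + 2 * ln 4) * real n" using 2 sq[of "real n"] n by (simp add: algebra_simps)
    finally show "real (card (primes_in 0 n)) \<le> (2 + 2 * ln 4) * real n / ln (real n)"
      using lnn by (simp add: field_simps)
  qed auto
qed

text \<open>
  The sum of \<open>ln p / p\<close> over the primes in question equals \<open>ln H\<close> up to a bounded error, hence is at
  least 1 for a suitable \<open>H\<close>, while no term exceeds \<open>ln (H * z) / z\<close>.
\<close>

lemma chebyshev_lower:
  obtains H :: real where "H \<ge> 2"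
    "\<And>z. z \<ge> 1 \<Longrightarrow> real (card {p. prime p \<and> z < real p \<and> real p \<le> H * z}) \<ge> z / ln (H * z)"
proof -
  obtain C where C: "C \<ge> 0" "\<And>n. n > 0 \<Longrightarrow> \<bar>mertens_sum n - ln (real n)\<bar> \<le> C"
    using mertens_first by blast
  \<comment> \<open>The exponent beats the two error terms \<open>C\<close>; the factor 2 absorbs the rounding of \<open>z\<close> and \<open>H * z\<close>.\<close>
  define H where "H = 2 * exp (2 * C + 1)"
  have H2: "H \<ge> 2" using C unfolding H_def by simp
  show ?thesis
  proof (rule that[of H])
    fix z :: real assume z: "z \<ge> 1"
    define x y where "x = nat \<lfloor>z\<rfloor>" and "y = nat \<lfloor>H * z\<rfloor>"
    have Hz: "H * z \<ge> 2 * z" using H2 z by (intro mult_right_mono) auto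
    hence Hz2: "H * z \<ge> 2" using z by linarith
    have x: "real x \<le> z" "z < real x + 1" "x \<ge> 1"
      using z unfolding x_def by (auto simp: le_nat_iff le_floor_iff)
    have y: "real y \<le> H * z" "H * z < real y + 1" "y \<ge> 1"
      using z Hz Hz2 unfolding y_def by (auto simp: le_nat_iff le_floor_iff)
    have xy: "x \<le> y" unfolding x_def y_def using Hz z by (intro nat_mono floor_mono) linarith
    have eq: "{p. prime p \<and> z < real p \<and> real p \<le> H * z} = primes_in x y"
      unfolding primes_in_def using x y
      by (auto simp: x_def y_def le_nat_iff le_floor_iff nat_less_iff floor_less_iff)
    have "ln (real y) \<ge> ln (H * z / 2)" using y Hz by (subst ln_le_cancel_iff) auto
    hence "ln (real y) \<ge> ln (exp (2 * C + 1) * z)" by (simp add: H_def)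
    hence "ln (real y) \<ge> 2 * C + 1 + ln z" using z by (simp add: ln_mult)
    moreover have "ln (real x) \<le> ln z" using x z by (subst ln_le_cancel_iff) auto
    ultimately have "mertens_sum y - mertens_sum x \<ge> 1" using C(2)[of x] C(2)[of y] x(3) y(3) by linarith
    hence "1 \<le> (\<Sum>p\<in>primes_in x y. ln (real p) / real p)" using mertens_sum_diff[OF xy] by simp
    also have "\<dots> \<le> (\<Sum>p\<in>primes_in x y. ln (H * z) / z)"
    proof (rule sum_mono)
      fix p assume "p \<in> primes_in x y"
      hence "z < real p" "real p \<le> H * z" unfolding eq[symmetric] by auto
      thus "ln (real p) / real p \<le> ln (H * z) / z" using z by (intro frac_le) auto
    qed
    also have "\<dots> = real (card (primes_in x y)) * (ln (H * z) / z)" by simp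
    finally have main: "1 \<le> real (card (primes_in x y)) * (ln (H * z) / z)" .
    show "real (card {p. prime p \<and> z < real p \<and> real p \<le> H * z}) \<ge> z / ln (H * z)"
    proof -
      have "ln (H * z) > 0" using Hz2 by simp
      thus ?thesis unfolding eq using z main by (simp add: field_simps)
    qed
  qed (rule H2)
qed

section \<open>Weights of finite sets of primes\<close>

definition weight :: "nat set \<Rightarrow> real" where
  "weight S = (\<Prod>p\<in>S. 1 / real p)"

text \<open>
  The elementary symmetric polynomial of degree \<open>i\<close>, evaluated at the reciprocals of the elements of \<open>A\<close>.
\<close>

definition esum :: "nat \<Rightarrow> nat set \<Rightarrow> real" where
  "esum i A = (\<Sum>S | S \<subseteq> A \<and> card S = i. weight S)"

lemma weight_empty [simp]: "weight {} = 1"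
  by (simp add: weight_def)

lemma weight_nonneg [simp]: "weight S \<ge> 0"
  by (auto simp: weight_def intro!: prod_nonneg)

lemma weight_insert: "finite S \<Longrightarrow> p \<notin> S \<Longrightarrow> weight (insert p S) = weight S / real p"
  by (simp add: weight_def)

lemma weight_Un: "finite S \<Longrightarrow> finite T \<Longrightarrow> S \<inter> T = {} \<Longrightarrow> weight (S \<union> T) = weight S * weight T"
  by (simp add: weight_def prod.union_disjoint)

lemma weight_conv_prod: "weight S = 1 / real (\<Prod>S)"
  by (simp add: weight_def prod_dividef)

lemma finite_subsets_card [simp]: "finite A \<Longrightarrow> finite {S. S \<subseteq> A \<and> card S = i}"
  by (rule finite_subset[of _ "Pow A"]) auto

lemma esum_nonneg [simp]: "esum i A \<ge> 0"
  by (auto simp: esum_def intro!: sum_nonneg)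

lemma esum_0 [simp]: "finite A \<Longrightarrow> esum 0 A = 1"
proof -
  assume "finite A"
  hence "{S. S \<subseteq> A \<and> card S = 0} = {{}}" by (auto dest: finite_subset)
  thus ?thesis by (simp add: esum_def)
qed

text \<open>
  Double counting of the pairs consisting of a set with \<open>Suc i\<close> elements and one of its elements.
\<close>

lemma esum_Suc:
  assumes "finite A"
  shows "real (Suc i) * esum (Suc i) A =
         (\<Sum>S | S \<subseteq> A \<and> card S = i. weight S * (\<Sum>p\<in>A - S. 1 / real p))"
proof -
  have fin: "finite S" if "S \<subseteq> A" for S using that assms finite_subset by blast
  have "real (Suc i) * esum (Suc i) A = (\<Sum>T | T \<subseteq> A \<and> card T = Suc i. \<Sum>p\<in>T. weight T)"
    by (simp add: esum_def sum_distrib_left)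
  also have "\<dots> = (\<Sum>(T, p)\<in>Sigma {T. T \<subseteq> A \<and> card T = Suc i} (\<lambda>T. T). weight T)"
    using assms fin by (subst sum.Sigma) auto
  also have "\<dots> = (\<Sum>(S, p)\<in>Sigma {S. S \<subseteq> A \<and> card S = i} (\<lambda>S. A - S). weight S * (1 / real p))"
  proof (rule sum.reindex_bij_witness[of _ "\<lambda>(S, p). (insert p S, p)" "\<lambda>(T, p). (T - {p}, p)"], goal_cases)
    case (5 a)
    then obtain T p where a: "a = (T, p)" "T \<subseteq> A" "card T = Suc i" "p \<in> T" by auto
    have "weight (insert p (T - {p})) = weight (T - {p}) / real p"
      using fin[OF a(2)] by (intro weight_insert) auto
    moreover have "insert p (T - {p}) = T" using a by auto
    ultimately show ?case using a by simp
  qed (auto simp: fin card_insert_if insert_absorb)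
  also have "\<dots> = (\<Sum>S | S \<subseteq> A \<and> card S = i. \<Sum>p\<in>A - S. weight S * (1 / real p))"
    using assms by (subst sum.Sigma) auto
  finally show ?thesis by (simp add: sum_distrib_left)
qed

lemma esum_le:
  assumes "finite A" "(\<Sum>p\<in>A. 1 / real p) \<le> m"
  shows "esum i A \<le> m ^ i / fact i"
proof (induction i)
  case 0
  show ?case using assms by simp
next
  case (Suc i)
  have m0: "m \<ge> 0" using assms(2) by (rule order.trans[rotated]) (auto intro!: sum_nonneg)
  have "real (Suc i) * esum (Suc i) A \<le> (\<Sum>S | S \<subseteq> A \<and> card S = i. weight S * m)"
    unfolding esum_Suc[OF assms(1)]
  proof (intro sum_mono mult_left_mono)
    fix S assume "S \<in> {S. S \<subseteq> A \<and> card S = i}"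
    have "(\<Sum>p\<in>A - S. 1 / real p) \<le> (\<Sum>p\<in>A. 1 / real p)"
      using assms(1) by (intro sum_mono2) auto
    thus "(\<Sum>p\<in>A - S. 1 / real p) \<le> m" using assms(2) by simp
  qed auto
  also have "\<dots> = esum i A * m" by (simp add: esum_def sum_distrib_right)
  also have "\<dots> \<le> m ^ i / fact i * m" using Suc m0 by (intro mult_right_mono) auto
  finally have "esum (Suc i) A \<le> m ^ i / fact i * m / real (Suc i)"
    by (simp add: le_divide_eq mult_ac del: of_nat_Suc)
  thus ?case by (simp add: mult_ac del: of_nat_Suc)
qed

text \<open>
  When elements are chosen one after the other, at most \<open>n\<close> of them have been used up at any time, and
  these account for a mass of at most \<open>n * e\<close>.
\<close>

lemma esum_ge:
  assumes "finite A" "(\<Sum>p\<in>A. 1 / real p) \<ge> M" "\<And>p. p \<in> A \<Longrightarrow> 1 / real p \<le> e" "e \<ge> 0"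
    and "i \<le> n" "M \<ge> real n * e"
  shows "esum i A \<ge> (M - real n * e) ^ i / fact i"
  using assms(5)
proof (induction i)
  case 0
  show ?case using assms by simp
next
  case (Suc i)
  define m where "m = M - real n * e"
  have m0: "m \<ge> 0" using assms(6) by (simp add: m_def)
  have "m ^ i / fact i * m \<le> esum i A * m" using Suc m0 by (intro mult_right_mono) (auto simp: m_def)
  also have "\<dots> = (\<Sum>S | S \<subseteq> A \<and> card S = i. weight S * m)" by (simp add: esum_def sum_distrib_right)
  also have "\<dots> \<le> real (Suc i) * esum (Suc i) A"
    unfolding esum_Suc[OF assms(1)]
  proof (intro sum_mono mult_left_mono)
    fix S assume S: "S \<in> {S. S \<subseteq> A \<and> card S = i}"
    hence "finite S" using assms(1) finite_subset by blast
    have "(\<Sum>p\<in>S. 1 / real p) \<le> (\<Sum>p\<in>S. e)" using S assms(3) by (intro sum_mono) auto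
    also have "\<dots> = real i * e" using S by simp
    also have "\<dots> \<le> real n * e" using Suc.prems assms(4) by (intro mult_right_mono) auto
    finally have "m \<le> (\<Sum>p\<in>A. 1 / real p) - (\<Sum>p\<in>S. 1 / real p)" using assms(2) by (simp add: m_def)
    also have "\<dots> = (\<Sum>p\<in>A - S. 1 / real p)" using S assms(1) by (subst sum_diff) auto
    finally show "m \<le> (\<Sum>p\<in>A - S. 1 / real p)" .
  qed auto
  finally have "m ^ i / fact i * m / real (Suc i) \<le> esum (Suc i) A"
    by (simp add: divide_le_eq mult_ac del: of_nat_Suc)
  thus ?case by (simp add: mult_ac m_def del: of_nat_Suc)
qed

text \<open>
  The weight is multiplicative on disjoint unions. The predicate \<open>Q\<close> carries conditions, such as
  tameness, that depend on the two parts separately.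
\<close>

lemma sum_weight_split:
  assumes "finite A" "finite B" "A \<inter> B = {}"
  shows "(\<Sum>S | S \<subseteq> A \<union> B \<and> Q (S \<inter> A) (S \<inter> B). weight S) =
         (\<Sum>(X, Y) | X \<subseteq> A \<and> Y \<subseteq> B \<and> Q X Y. weight X * weight Y)"
proof (rule sum.reindex_bij_witness[of _ "\<lambda>(X, Y). X \<union> Y" "\<lambda>S. (S \<inter> A, S \<inter> B)"], goal_cases)
  case (4 b)
  then obtain X Y where b: "b = (X, Y)" "X \<subseteq> A" "Y \<subseteq> B" "Q X Y" by auto
  have "(X \<union> Y) \<inter> A = X" "(X \<union> Y) \<inter> B = Y" using b assms by auto
  thus ?case using b by auto
next
  case (3 b)
  then obtain X Y where b: "b = (X, Y)" "X \<subseteq> A" "Y \<subseteq> B" "Q X Y" by auto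
  thus ?case using assms by auto
next
  case (5 S)
  have "weight (S \<inter> A) * weight (S \<inter> B) = weight ((S \<inter> A) \<union> (S \<inter> B))"
    using assms by (intro weight_Un[symmetric]) auto
  also have "(S \<inter> A) \<union> (S \<inter> B) = S" using 5 by auto
  finally show ?case by simp
qed auto

section \<open>Ballot numbers\<close>

text \<open>
  An upper bound for the weight of all sets of \<open>k\<close> primes taken from \<open>k\<close> blocks of mass \<open>mu\<close>. The weight
  of the tame sets and the energy are both measured against it.
\<close>

definition full_mass :: "real \<Rightarrow> nat \<Rightarrow> real" where
  "full_mass mu k = mu ^ k * real k ^ k / fact k"

text \<open>
  For \<open>n > 0\<close> this equals \<open>(x - n) * x ^ (n - 1) / fact n\<close>. For integral \<open>x = J + 1\<close> and \<open>n \<le> J\<close>,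
  multiplication by \<open>fact n\<close> gives the number of sequences of length \<open>n\<close> over \<open>{1..J}\<close> in which, for
  every \<open>i\<close>, at most \<open>i\<close> entries are \<open>\<le> i\<close>; for \<open>n = J\<close> these are, after reflection, the parking
  functions. The definition as a difference of two exponential coefficients makes the recursion in \<open>J\<close> an instance of the binomial theorem.
\<close>

definition ballot :: "real \<Rightarrow> nat \<Rightarrow> real" where
  "ballot x n = x ^ n / fact n - (if n = 0 then 0 else x ^ (n - 1) / fact (n - 1))"

lemma exp_convolution:
  "(\<Sum>i\<le>n. x ^ (n - i) / fact (n - i) * (1 / fact i)) = (x + 1 :: real) ^ n / fact n"
proof -
  have "(1 + x) ^ n / fact n = (\<Sum>i\<le>n. of_nat (n choose i) * x ^ (n - i)) / fact n"
    by (simp add: binomial_ring)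
  also have "\<dots> = (\<Sum>i\<le>n. x ^ (n - i) / fact (n - i) * (1 / fact i))"
    by (auto simp: sum_divide_distrib binomial_fact intro!: sum.cong)
  finally show ?thesis by (simp add: add.commute)
qed

lemma ballot_Suc: "(\<Sum>i\<le>n. ballot x (n - i) * (1 / fact i)) = ballot (x + 1) n"
proof (cases n)
  case (Suc m)
  define g where "g = (\<lambda>j. if j = 0 then 0 else x ^ (j - 1) / fact (j - 1))"
  have "(\<Sum>i\<le>n. g (n - i) * (1 / fact i)) = (\<Sum>i\<le>m. g (n - i) * (1 / fact i))"
    by (simp add: Suc g_def)
  also have "\<dots> = (\<Sum>i\<le>m. x ^ (m - i) / fact (m - i) * (1 / fact i))"
    unfolding Suc by (intro sum.cong refl) (simp add: Suc_diff_le g_def)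
  also have "\<dots> = (x + 1) ^ m / fact m" by (rule exp_convolution)
  finally have g: "(\<Sum>i\<le>n. g (n - i) * (1 / fact i)) = (x + 1) ^ m / fact m" .
  have "ballot x j = x ^ j / fact j - g j" for j by (simp add: ballot_def g_def)
  hence "(\<Sum>i\<le>n. ballot x (n - i) * (1 / fact i))
      = (\<Sum>i\<le>n. x ^ (n - i) / fact (n - i) * (1 / fact i) - g (n - i) * (1 / fact i))"
    by (simp only: left_diff_distrib)
  also have "\<dots> = (x + 1) ^ n / fact n - (x + 1) ^ m / fact m"
    by (simp only: sum_subtractf g exp_convolution)
  finally show ?thesis by (simp add: ballot_def Suc)
qed (simp add: ballot_def)

lemma ballot_eq: "ballot x n = (x - real n) * x ^ (n - 1) / fact n" if n: "n > 0"
proof -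
  obtain m where m: "n = Suc m" using n by (cases n) auto
  have "x ^ m / fact m = real n * x ^ m / fact n" unfolding m by (simp del: of_nat_Suc)
  thus ?thesis using m
    by (simp add: ballot_def diff_divide_distrib[symmetric] left_diff_distrib del: of_nat_Suc fact_Suc)
qed

lemma ballot_nonneg: "real n \<le> x \<Longrightarrow> ballot x n \<ge> 0"
  by (cases "n = 0") (auto simp: ballot_eq, simp add: ballot_def)

section \<open>Tame sets of primes\<close>

text \<open>
  In the application, \<open>mu = ln 4\<close>, and the primes of block \<open>j\<close> have logarithms of order \<open>4 ^ j\<close>. Since
  the blocks have mass at most \<open>mu\<close>, upper bounds hold without error terms. Lower bounds
  for the mass enter as hypotheses on \<open>esum i (P j)\<close>.
\<close>

locale block_family =
  fixes P :: "nat \<Rightarrow> nat set" and mu :: real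
  assumes finite_P [simp]: "finite (P j)"
    and disjoint_P: "i \<noteq> j \<Longrightarrow> P i \<inter> P j = {}"
    and prime_P: "p \<in> P j \<Longrightarrow> prime p"
    and mass_P: "(\<Sum>p\<in>P j. 1 / real p) \<le> mu"
    and mu_pos: "mu > 0"
begin

definition U :: "nat \<Rightarrow> nat set" where "U J = (\<Union>j\<in>{1..J}. P j)"

text \<open>
  A set of \<open>k\<close> primes from \<open>k\<close> blocks has one prime per block on average. Tameness forbids it ever to be
  ahead of this average. It limits the number of ways to split the primes of the first blocks in a
  multiplicative coincidence, yet a proportion of about \<open>1 / k\<close> of all sets is tame.
\<close>

definition tame :: "nat \<Rightarrow> nat \<Rightarrow> nat set set" where
  "tame J n = {S. S \<subseteq> U J \<and> card S = n \<and> (\<forall>i\<in>{1..J}. card (S \<inter> U i) \<le> i)}"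

definition tame_weight :: "nat \<Rightarrow> nat \<Rightarrow> real" where
  "tame_weight J n = (\<Sum>S\<in>tame J n. weight S)"

lemma finite_U [simp]: "finite (U J)" by (simp add: U_def)

lemma U_mono: "i \<le> j \<Longrightarrow> U i \<subseteq> U j"
  unfolding U_def by (intro UN_mono) auto

lemma U_0 [simp]: "U 0 = {}" by (simp add: U_def)

lemma U_Suc: "U (Suc J) = U J \<union> P (Suc J)"
  by (simp add: U_def atLeastAtMostSuc_conv Un_commute)

lemma U_disjoint: "J < j \<Longrightarrow> U J \<inter> P j = {}"
proof -
  assume "J < j"
  hence "P i \<inter> P j = {}" if "i \<in> {1..J}" for i using that by (intro disjoint_P) auto
  thus ?thesis unfolding U_def by blast
qed

lemma prime_U: "p \<in> U J \<Longrightarrow> prime p" by (auto simp: U_def prime_P)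

lemma finite_tame [simp]: "finite (tame J n)"
  by (rule finite_subset[of _ "Pow (U J)"]) (auto simp: tame_def)

lemma tame_finite: "S \<in> tame J n \<Longrightarrow> finite S"
  unfolding tame_def using finite_U finite_subset by blast

lemma tame_weight_nonneg: "tame_weight J n \<ge> 0" by (auto simp: tame_weight_def intro!: sum_nonneg)

lemma mass_U: "(\<Sum>p\<in>U J. 1 / real p) \<le> mu * real J"
proof (induction J)
  case (Suc J)
  have "(\<Sum>p\<in>U (Suc J). 1 / real p) = (\<Sum>p\<in>U J. 1 / real p) + (\<Sum>p\<in>P (Suc J). 1 / real p)"
    unfolding U_Suc by (rule sum.union_disjoint) (auto simp: U_disjoint)
  thus ?case using Suc mass_P[of "Suc J"] by (simp add: algebra_simps)
qed auto

lemma mass_U_diff: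
  assumes "J \<le> k"
  shows "(\<Sum>p\<in>U k - U J. 1 / real p) \<le> mu * (real k - real J)"
  using assms
proof (induction k rule: dec_induct)
  case (step k)
  have "U (Suc k) - U J = (U k - U J) \<union> P (Suc k)"
    using U_disjoint[of J "Suc k"] step unfolding U_Suc by auto
  moreover have "(U k - U J) \<inter> P (Suc k) = {}" using U_disjoint[of k "Suc k"] by auto
  ultimately have "(\<Sum>p\<in>U (Suc k) - U J. 1 / real p)
      = (\<Sum>p\<in>U k - U J. 1 / real p) + (\<Sum>p\<in>P (Suc k). 1 / real p)"
    by (simp add: sum.union_disjoint)
  thus ?case using step mass_P[of "Suc k"] by (simp add: algebra_simps)
qed auto

lemma tame_empty: "tame J (Suc J) = {}"
proof (cases "J = 0")
  case False
  have "False" if "S \<in> tame J (Suc J)" for S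
  proof -
    have "S \<inter> U J = S" "card S = Suc J" using that by (auto simp: tame_def)
    thus False using that False by (auto simp: tame_def dest!: bspec[of _ _ J])
  qed
  thus ?thesis by blast
qed (auto simp: tame_def)

lemma tame_0: "tame 0 0 = {{}}" by (auto simp: tame_def)

text \<open>
  A tame set in \<open>Suc J\<close> blocks is a tame set in \<open>J\<close> blocks together with some elements of the last block;
  the condition at the last index holds automatically because of \<open>n \<le> Suc J\<close>.
\<close>

lemma tame_weight_rec:
  assumes "n \<le> Suc J"
  shows "tame_weight (Suc J) n = (\<Sum>i\<le>n. tame_weight J (n - i) * esum i (P (Suc J)))"
proof -
  define A B where "A = U J" and "B = P (Suc J)"
  have AB: "finite A" "finite B" "A \<inter> B = {}" by (auto simp: A_def B_def U_disjoint)
  define Q where "Q = (\<lambda>(X :: nat set) (Y :: nat set). card X + card Y = n \<and> (\<forall>i\<in>{1..J}. card (X \<inter> U i) \<le> i))"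
  have eq: "tame (Suc J) n = {S. S \<subseteq> A \<union> B \<and> Q (S \<inter> A) (S \<inter> B)}"
  proof -
    have "S \<in> tame (Suc J) n \<longleftrightarrow> Q (S \<inter> A) (S \<inter> B)" if S: "S \<subseteq> A \<union> B" for S
    proof -
      have fS: "finite S" using S AB finite_subset by blast
      have "card S = card ((S \<inter> A) \<union> (S \<inter> B))" using S by (intro arg_cong[of _ _ card]) auto
      also have "\<dots> = card (S \<inter> A) + card (S \<inter> B)" using AB fS by (intro card_Un_disjoint) auto
      finally have c: "card S = card (S \<inter> A) + card (S \<inter> B)" .
      have "S \<inter> A \<inter> U i = S \<inter> U i" if "i \<in> {1..J}" for i using U_mono[of i J] that by (auto simp: A_def)
      moreover have "card (S \<inter> U (Suc J)) \<le> Suc J" if "card S = n"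
        using that assms by (metis card_mono fS inf_le1 le_trans)
      ultimately show ?thesis using S c unfolding tame_def Q_def
        by (auto simp: A_def B_def U_Suc atLeastAtMostSuc_conv)
    qed
    moreover have "S \<subseteq> A \<union> B" if "S \<in> tame (Suc J) n" for S
      using that by (auto simp: tame_def A_def B_def U_Suc)
    ultimately show ?thesis by blast
  qed
  have "tame_weight (Suc J) n = (\<Sum>(X, Y) | X \<subseteq> A \<and> Y \<subseteq> B \<and> Q X Y. weight X * weight Y)"
    unfolding tame_weight_def eq by (rule sum_weight_split[OF AB])
  also have "{(X, Y). X \<subseteq> A \<and> Y \<subseteq> B \<and> Q X Y}
      = (\<Union>i\<in>{..n}. tame J (n - i) \<times> {Y. Y \<subseteq> B \<and> card Y = i})"
    by (auto simp: Q_def tame_def A_def)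
  also have "(\<Sum>(X, Y)\<in>\<dots>. weight X * weight Y)
      = (\<Sum>i\<le>n. \<Sum>(X, Y)\<in>tame J (n - i) \<times> {Y. Y \<subseteq> B \<and> card Y = i}. weight X * weight Y)"
    by (rule sum.UNION_disjoint) (auto simp: AB)
  also have "\<dots> = (\<Sum>i\<le>n. tame_weight J (n - i) * esum i (P (Suc J)))"
    by (simp add: tame_weight_def esum_def sum_product sum.cartesian_product B_def)
  finally show ?thesis .
qed

text \<open>
  The recursion is the one of the ballot numbers. The value \<open>n = Suc J\<close>, for which both sides vanish, is
  included because the recursion refers to it.
\<close>

lemma tame_weight_le: "n \<le> Suc J \<Longrightarrow> tame_weight J n \<le> mu ^ n * ballot (real J + 1) n"
proof (induction J arbitrary: n)
  case 0
  hence "n = 0 \<or> n = 1" by auto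
  thus ?case using tame_empty[of 0] by (auto simp: tame_weight_def tame_0 ballot_def)
next
  case (Suc J)
  show ?case
  proof (cases "n = Suc (Suc J)")
    case True
    thus ?thesis using tame_empty[of "Suc J"] by (simp add: tame_weight_def ballot_eq)
  next
    case False
    hence n: "n \<le> Suc J" using Suc.prems by simp
    have "tame_weight (Suc J) n \<le> (\<Sum>i\<le>n. (mu ^ (n - i) * ballot (real J + 1) (n - i)) * (mu ^ i / fact i))"
      unfolding tame_weight_rec[OF n]
      using n esum_le[OF finite_P mass_P] mu_pos
      by (intro sum_mono mult_mono Suc.IH) (auto intro!: ballot_nonneg mult_nonneg_nonneg)
    also have "\<dots> = (\<Sum>i\<le>n. mu ^ n * (ballot (real J + 1) (n - i) * (1 / fact i)))"
      by (intro sum.cong refl) (simp add: power_add[symmetric] field_simps)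
    also have "\<dots> = mu ^ n * ballot (real (Suc J) + 1) n"
      by (simp only: sum_distrib_left[symmetric] ballot_Suc) (simp add: add_ac)
    finally show ?thesis .
  qed
qed

text \<open>
  The factor \<open>c j\<close> is the loss in block \<open>j\<close>, caused by a mass slightly below \<open>mu\<close> and by the restriction
  to squarefree products. Only \<open>i \<le> j\<close> elements of block \<open>j\<close> can occur in a tame set.
\<close>

lemma tame_weight_ge:
  assumes c: "\<And>j i. 1 \<le> j \<Longrightarrow> i \<le> j \<Longrightarrow> esum i (P j) \<ge> c j * (mu ^ i / fact i)"
    and c0: "\<And>j. c j \<ge> 0"
  shows "n \<le> Suc J \<Longrightarrow> tame_weight J n \<ge> (\<Prod>j=1..J. c j) * (mu ^ n * ballot (real J + 1) n)"
proof (induction J arbitrary: n)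
  case 0
  hence "n = 0 \<or> n = 1" by auto
  thus ?case using tame_empty[of 0] by (auto simp: tame_weight_def tame_0 ballot_def)
next
  case (Suc J)
  define C where "C = (\<Prod>j=1..J. c j)"
  have C0: "C \<ge> 0" unfolding C_def by (intro prod_nonneg) (use c0 in auto)
  show ?case
  proof (cases "n = Suc (Suc J)")
    case True
    thus ?thesis using tame_empty[of "Suc J"] by (simp add: tame_weight_def ballot_eq)
  next
    case False
    hence n: "n \<le> Suc J" using Suc.prems by simp
    have "(\<Prod>j=1..Suc J. c j) * (mu ^ n * ballot (real (Suc J) + 1) n)
        = C * c (Suc J) * (\<Sum>i\<le>n. mu ^ n * (ballot (real J + 1) (n - i) * (1 / fact i)))"
      by (simp only: sum_distrib_left[symmetric] ballot_Suc prod.nat_ivl_Suc' C_def) (simp add: add_ac mult_ac)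
    also have "\<dots> = (\<Sum>i\<le>n. (C * (mu ^ (n - i) * ballot (real J + 1) (n - i))) * (c (Suc J) * (mu ^ i / fact i)))"
      unfolding sum_distrib_left
      by (intro sum.cong refl) (simp add: power_add[symmetric] field_simps)
    also have "\<dots> \<le> tame_weight (Suc J) n"
      unfolding tame_weight_rec[OF n]
    proof (intro sum_mono mult_mono)
      fix i assume i: "i \<in> {..n}"
      show "C * (mu ^ (n - i) * ballot (real J + 1) (n - i)) \<le> tame_weight J (n - i)"
        unfolding C_def using n by (intro Suc.IH) auto
      show "c (Suc J) * (mu ^ i / fact i) \<le> esum i (P (Suc J))" using i n by (intro c) auto
    qed (use c0 mu_pos in \<open>auto intro!: tame_weight_nonneg\<close>)
    finally show ?thesis .
  qed
qed

text \<open>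
  Removing a prime from a tame set leaves a tame set. Hence the average number of primes in a given
  block is controlled by a ratio of two neighbouring ballot numbers, which is bounded on the diagonal.
\<close>

lemma sum_weight_card_inter:
  assumes "J \<in> {1..k}"
  shows "(\<Sum>S\<in>tame k (Suc n). weight S * real (card (S \<inter> P J))) \<le> mu * tame_weight k n"
proof -
  have "(\<Sum>S\<in>tame k (Suc n). weight S * real (card (S \<inter> P J)))
      = (\<Sum>S\<in>tame k (Suc n). \<Sum>p\<in>P J. if p \<in> S then weight S else 0)"
    by (intro sum.cong refl) (simp add: sum.If_cases Int_commute)
  also have "\<dots> = (\<Sum>p\<in>P J. \<Sum>S\<in>tame k (Suc n). if p \<in> S then weight S else 0)"
    by (rule sum.swap)
  also have "\<dots> \<le> (\<Sum>p\<in>P J. (1 / real p) * tame_weight k n)"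
  proof (rule sum_mono)
    fix p assume p: "p \<in> P J"
    define T where "T = {S \<in> tame k (Suc n). p \<in> S}"
    have "(\<Sum>S\<in>tame k (Suc n). if p \<in> S then weight S else 0) = (\<Sum>S\<in>T. weight S)"
      by (simp add: T_def sum.If_cases Int_def)
    also have "\<dots> = (\<Sum>S\<in>T. (1 / real p) * weight (S - {p}))"
    proof (rule sum.cong[OF refl])
      fix S assume S: "S \<in> T"
      hence "insert p (S - {p}) = S" "finite S" using tame_finite by (auto simp: T_def)
      thus "weight S = (1 / real p) * weight (S - {p})" using weight_insert[of "S - {p}" p] by simp
    qed
    also have "\<dots> = (1 / real p) * (\<Sum>S\<in>T. weight (S - {p}))" by (simp add: sum_distrib_left)
    also have "(\<Sum>S\<in>T. weight (S - {p})) = (\<Sum>S\<in>(\<lambda>S. S - {p}) ` T. weight S)"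
      by (subst sum.reindex) (auto simp: inj_on_def T_def)
    also have "\<dots> \<le> tame_weight k n" unfolding tame_weight_def
    proof (rule sum_mono2)
      show "(\<lambda>S. S - {p}) ` T \<subseteq> tame k n"
      proof safe
        fix S assume "S \<in> T"
        hence S: "S \<in> tame k (Suc n)" "p \<in> S" by (auto simp: T_def)
        have "card (S - {p}) = n" using S tame_finite[OF S(1)] by (simp add: tame_def)
        moreover have "card ((S - {p}) \<inter> U i) \<le> i" if "i \<in> {1..k}" for i
        proof -
          have "card ((S - {p}) \<inter> U i) \<le> card (S \<inter> U i)" by (rule card_mono) auto
          thus ?thesis using S that unfolding tame_def by fastforce
        qed
        ultimately show "S - {p} \<in> tame k n" using S by (auto simp: tame_def)
      qed
    qed auto
    finally show "(\<Sum>S\<in>tame k (Suc n). if p \<in> S then weight S else 0) \<le> (1 / real p) * tame_weight k n"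
      by (simp add: divide_right_mono)
  qed
  also have "\<dots> = (\<Sum>p\<in>P J. 1 / real p) * tame_weight k n" by (rule sum_distrib_right[symmetric])
  also have "\<dots> \<le> mu * tame_weight k n" using mass_P by (intro mult_right_mono tame_weight_nonneg) auto
  finally show ?thesis .
qed

text \<open>
  A first moment, to be used with the inequality of Markov: the logarithm of the product
  of a tame set is on average of the same order as that of a single prime of the last block.
\<close>

lemma sum_weight_ln_prod:
  assumes "\<And>j p. j \<in> {1..k} \<Longrightarrow> p \<in> P j \<Longrightarrow> ln (real p) \<le> X j"
    and X0: "\<And>j. X j \<ge> 0"
  shows "(\<Sum>S\<in>tame k (Suc n). weight S * ln (real (\<Prod>S))) \<le> (\<Sum>j=1..k. X j) * (mu * tame_weight k n)"
proof -
  have "ln (real (\<Prod>S)) \<le> (\<Sum>j=1..k. X j * real (card (S \<inter> P j)))" if S: "S \<in> tame k (Suc n)" for S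
  proof -
    have S': "S \<subseteq> U k" "finite S" using S tame_finite[OF S] by (auto simp: tame_def)
    have pos: "p > 0" if "p \<in> S" for p using prime_U S' that prime_gt_0_nat by blast
    have "ln (real (\<Prod>S)) = (\<Sum>p\<in>S. ln (real p))"
      unfolding of_nat_prod using S' pos by (intro ln_prod) auto
    also have "\<dots> = (\<Sum>p\<in>(\<Union>j\<in>{1..k}. S \<inter> P j). ln (real p))"
      using S' by (intro sum.cong) (auto simp: U_def)
    also have "\<dots> = (\<Sum>j=1..k. \<Sum>p\<in>S \<inter> P j. ln (real p))"
    proof (rule sum.UNION_disjoint)
      show "\<forall>i\<in>{1..k}. \<forall>j\<in>{1..k}. i \<noteq> j \<longrightarrow> S \<inter> P i \<inter> (S \<inter> P j) = {}"
      proof (intro ballI impI)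
        fix i j :: nat assume "i \<noteq> j"
        thus "S \<inter> P i \<inter> (S \<inter> P j) = {}" using disjoint_P[of i j] by auto
      qed
    qed auto
    also have "\<dots> \<le> (\<Sum>j=1..k. \<Sum>p\<in>S \<inter> P j. X j)"
      by (intro sum_mono assms(1)) auto
    also have "\<dots> = (\<Sum>j=1..k. X j * real (card (S \<inter> P j)))" by (simp add: mult.commute)
    finally show ?thesis .
  qed
  hence "(\<Sum>S\<in>tame k (Suc n). weight S * ln (real (\<Prod>S)))
      \<le> (\<Sum>S\<in>tame k (Suc n). weight S * (\<Sum>j=1..k. X j * real (card (S \<inter> P j))))"
    by (intro sum_mono mult_left_mono) auto
  also have "\<dots> = (\<Sum>S\<in>tame k (Suc n). \<Sum>j=1..k. X j * (weight S * real (card (S \<inter> P j))))"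
    by (simp add: sum_distrib_left mult_ac)
  also have "\<dots> = (\<Sum>j=1..k. X j * (\<Sum>S\<in>tame k (Suc n). weight S * real (card (S \<inter> P j))))"
    by (subst sum.swap) (simp add: sum_distrib_left)
  also have "\<dots> \<le> (\<Sum>j=1..k. X j * (mu * tame_weight k n))"
    using X0 by (intro sum_mono mult_left_mono sum_weight_card_inter) auto
  finally show ?thesis by (simp add: sum_distrib_right)
qed

end

section \<open>The energy of tame sets of primes\<close>

lemma sum_squares_le_square_sum:
  fixes a :: "'a \<Rightarrow> real"
  assumes "finite A" "\<And>x. x \<in> A \<Longrightarrow> a x \<ge> 0"
  shows "(\<Sum>x\<in>A. (a x)\<^sup>2) \<le> (\<Sum>x\<in>A. a x)\<^sup>2"
  using assms
proof (induction A rule: finite_induct)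
  case (insert x A)
  have "(\<Sum>y\<in>A. a y) \<ge> 0" using insert by (intro sum_nonneg) auto
  moreover have "a x \<ge> 0" using insert by auto
  ultimately have "2 * a x * (\<Sum>y\<in>A. a y) \<ge> 0" by simp
  thus ?case using insert by (simp add: power2_sum)
qed auto

lemma sum_UNION_le:
  fixes f :: "'a \<Rightarrow> real"
  assumes "finite I" "\<And>i. i \<in> I \<Longrightarrow> finite (A i)" "\<And>x. f x \<ge> 0"
  shows "sum f (\<Union>i\<in>I. A i) \<le> (\<Sum>i\<in>I. sum f (A i))"
  using assms(1,2)
proof (induction I rule: finite_induct)
  case (insert i I)
  have "sum f (A i \<union> (\<Union>i\<in>I. A i)) \<le> sum f (A i) + sum f (\<Union>i\<in>I. A i)"
    using insert assms(3) by (subst sum_Un) (auto intro!: sum_nonneg)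
  thus ?case using insert by fastforce
qed auto

context block_family
begin

text \<open>
  The coincidences that remain after cancelling the large primes. For sets of primes, equality of the
  products of \<open>S1\<close>, \<open>S2\<close> and of \<open>S3\<close>, \<open>S4\<close> means equality of unions and of intersections. The products
  of \<open>S1\<close> and \<open>S3\<close> are within a factor \<open>H\<close>, as these sets are attached to the same large prime.
\<close>

definition energy_config :: "real \<Rightarrow> nat \<Rightarrow> (nat set \<times> nat set \<times> nat set \<times> nat set) set" where
  "energy_config H k = {(S1, S2, S3, S4). S1 \<in> tame k k \<and> S2 \<in> tame k k \<and> S3 \<in> tame k k \<and> S4 \<in> tame k k \<and>
     S1 \<union> S2 = S3 \<union> S4 \<and> S1 \<inter> S2 = S3 \<inter> S4 \<and> S1 \<noteq> S3 \<and>
     real (\<Prod>S1) < H * real (\<Prod>S3) \<and> real (\<Prod>S3) < H * real (\<Prod>S1)}"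

text \<open>
  The sets that complete both \<open>s\<close> and \<open>t\<close> to tame sets.
\<close>

definition common :: "nat \<Rightarrow> nat set \<Rightarrow> nat set \<Rightarrow> nat set set" where
  "common k s t = {g. g \<inter> (s \<union> t) = {} \<and> g \<union> s \<in> tame k k \<and> g \<union> t \<in> tame k k}"

definition ratio_pairs :: "real \<Rightarrow> nat \<Rightarrow> (nat set \<times> nat set) set" where
  "ratio_pairs H k = {(s, t). s \<subseteq> U k \<and> t \<subseteq> U k \<and> card s = card t \<and> s \<noteq> {} \<and>
     real (\<Prod>s) < H * real (\<Prod>t) \<and> real (\<Prod>t) < H * real (\<Prod>s)}"

lemma common_subset: "common k s t \<subseteq> Pow (U k)"
  unfolding common_def tame_def by auto

lemma finite_common [simp]: "finite (common k s t)"
  using common_subset by (rule finite_subset) simp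

lemma finite_ratio_pairs [simp]: "finite (ratio_pairs H k)"
  by (rule finite_subset[of _ "Pow (U k) \<times> Pow (U k)"]) (auto simp: ratio_pairs_def)

lemma prod_pos_U: "S \<subseteq> U k \<Longrightarrow> \<Prod>S > 0"
  by (intro prod_pos) (use prime_U prime_gt_0_nat in blast)

text \<open>
  With \<open>s = S1 - S3\<close>, \<open>t = S3 - S1\<close>, \<open>g = S1 \<inter> S3\<close> and \<open>h = S2 \<inter> S4\<close>, equality of unions and
  intersections gives \<open>S2 = h \<union> t\<close> and \<open>S4 = h \<union> s\<close>. So \<open>g\<close> and \<open>h\<close> range independently over the common
  completions of \<open>s\<close> and \<open>t\<close>.
\<close>

lemma energy_le_ratio_pairs:
  "(\<Sum>(S1, S2, S3, S4)\<in>energy_config H k. weight S1 * weight S2)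
     \<le> (\<Sum>(s, t)\<in>ratio_pairs H k. weight s * weight t * (\<Sum>g\<in>common k s t. weight g)\<^sup>2)"
proof -
  define E where "E = energy_config H k"
  define R where "R = ratio_pairs H k"
  define enc where "enc = (\<lambda>(S1 :: nat set, S2 :: nat set, S3 :: nat set, S4 :: nat set). ((S1 - S3, S3 - S1), (S1 \<inter> S3, S2 \<inter> S4)))"
  define D where "D = Sigma R (\<lambda>(s, t). common k s t \<times> common k s t)"
  have facts: "S2 = (S2 \<inter> S4) \<union> (S3 - S1) \<and> S4 = (S2 \<inter> S4) \<union> (S1 - S3) \<and>
      (S2 \<inter> S4) \<inter> ((S1 - S3) \<union> (S3 - S1)) = {}"
    if "(S1, S2, S3, S4) \<in> E" for S1 S2 S3 S4
    using that unfolding E_def energy_config_def by blast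
  have fin: "finite S1" "finite S2" "finite S3" "finite S4" if "(S1, S2, S3, S4) \<in> E" for S1 S2 S3 S4
    using that unfolding E_def energy_config_def by (auto intro: tame_finite)
  have inj: "inj_on enc E"
  proof (rule inj_onI)
    fix x y assume xy: "x \<in> E" "y \<in> E" "enc x = enc y"
    obtain S1 S2 S3 S4 where x: "x = (S1, S2, S3, S4)" by (cases x) auto
    obtain T1 T2 T3 T4 where y: "y = (T1, T2, T3, T4)" by (cases y) auto
    have eq: "S1 - S3 = T1 - T3" "S3 - S1 = T3 - T1" "S1 \<inter> S3 = T1 \<inter> T3" "S2 \<inter> S4 = T2 \<inter> T4"
      using xy(3) by (auto simp: x y enc_def)
    have "S1 = T1" "S3 = T3" using eq by blast+
    moreover have "S2 = T2" "S4 = T4"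
      using facts[of S1 S2 S3 S4] facts[of T1 T2 T3 T4] eq xy(1,2) unfolding x y by metis+
    ultimately show "x = y" using x y by simp
  qed
  have into: "enc ` E \<subseteq> D"
  proof (rule image_subsetI)
    fix x assume "x \<in> E"
    then obtain S1 S2 S3 S4 where x: "x = (S1, S2, S3, S4)" and e: "(S1, S2, S3, S4) \<in> E"
      by (cases x) auto
    have tame: "S1 \<in> tame k k" "S2 \<in> tame k k" "S3 \<in> tame k k" "S4 \<in> tame k k" "S1 \<noteq> S3"
      and rat: "real (\<Prod>S1) < H * real (\<Prod>S3)" "real (\<Prod>S3) < H * real (\<Prod>S1)"
      using e unfolding E_def energy_config_def by auto
    have sub: "S1 \<subseteq> U k" "S3 \<subseteq> U k" "card S1 = k" "card S3 = k" using tame by (auto simp: tame_def)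
    have c: "card (S1 - S3) = card (S3 - S1)"
      using sub fin[OF e] card_Diff_subset_Int[of S1 S3] card_Diff_subset_Int[of S3 S1]
      by (simp add: Int_commute)
    have ne: "S1 - S3 \<noteq> {}"
    proof
      assume "S1 - S3 = {}"
      hence "S1 \<subseteq> S3" by auto
      hence "S1 = S3" using sub fin[OF e] by (intro card_subset_eq) auto
      thus False using tame by simp
    qed
    have g: "\<Prod>(S1 \<inter> S3) > 0" using sub by (intro prod_pos_U) auto
    have u: "S1 = (S1 \<inter> S3) \<union> (S1 - S3)" "S3 = (S1 \<inter> S3) \<union> (S3 - S1)" by auto
    have p1: "\<Prod>S1 = \<Prod>(S1 \<inter> S3) * \<Prod>(S1 - S3)"
      using fin[OF e] by (subst u(1), subst prod.union_disjoint) auto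
    have p3: "\<Prod>S3 = \<Prod>(S1 \<inter> S3) * \<Prod>(S3 - S1)"
      using fin[OF e] by (subst u(2), subst prod.union_disjoint) auto
    have r1: "real (\<Prod>(S1 - S3)) < H * real (\<Prod>(S3 - S1))"
    proof -
      have "real (\<Prod>(S1 \<inter> S3)) * real (\<Prod>(S1 - S3)) < real (\<Prod>(S1 \<inter> S3)) * (H * real (\<Prod>(S3 - S1)))"
        using rat(1) unfolding p1 p3 of_nat_mult by (simp add: mult_ac del: of_nat_prod)
      thus ?thesis using g by (simp del: of_nat_prod)
    qed
    have r2: "real (\<Prod>(S3 - S1)) < H * real (\<Prod>(S1 - S3))"
    proof -
      have "real (\<Prod>(S1 \<inter> S3)) * real (\<Prod>(S3 - S1)) < real (\<Prod>(S1 \<inter> S3)) * (H * real (\<Prod>(S1 - S3)))"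
        using rat(2) unfolding p1 p3 of_nat_mult by (simp add: mult_ac del: of_nat_prod)
      thus ?thesis using g by (simp del: of_nat_prod)
    qed
    have "(S1 - S3, S3 - S1) \<in> R"
      unfolding R_def ratio_pairs_def using sub c ne r1 r2 by auto
    moreover have "S1 \<inter> S3 \<in> common k (S1 - S3) (S3 - S1)"
    proof -
      have "S1 \<inter> S3 \<union> (S1 - S3) = S1" "S1 \<inter> S3 \<union> (S3 - S1) = S3" by auto
      thus ?thesis unfolding common_def using tame by auto
    qed
    moreover have "S2 \<inter> S4 \<in> common k (S1 - S3) (S3 - S1)"
      unfolding common_def using facts[OF e] tame by auto
    ultimately show "enc x \<in> D" by (auto simp: x enc_def D_def)
  qed
  have "(\<Sum>(S1, S2, S3, S4)\<in>E. weight S1 * weight S2)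
      = (\<Sum>x\<in>E. case enc x of ((s, t), (g, h)) \<Rightarrow> weight s * weight t * (weight g * weight h))"
  proof (rule sum.cong[OF refl], clarify)
    fix S1 S2 S3 S4 assume x: "(S1, S2, S3, S4) \<in> E"
    note f = facts[OF x] fin[OF x]
    have "weight S1 = weight ((S1 \<inter> S3) \<union> (S1 - S3))" by (simp add: Int_Diff_Un)
    also have "\<dots> = weight (S1 \<inter> S3) * weight (S1 - S3)" using f by (intro weight_Un) auto
    finally have 1: "weight S1 = weight (S1 \<inter> S3) * weight (S1 - S3)" .
    have "weight S2 = weight ((S2 \<inter> S4) \<union> (S3 - S1))" using f by metis
    also have "\<dots> = weight (S2 \<inter> S4) * weight (S3 - S1)" using f by (intro weight_Un) auto
    finally show "weight S1 * weight S2
        = (case enc (S1, S2, S3, S4) of ((s, t), (g, h)) \<Rightarrow> weight s * weight t * (weight g * weight h))"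
      using 1 by (simp add: enc_def)
  qed
  also have "\<dots> = (\<Sum>((s, t), (g, h))\<in>enc ` E. weight s * weight t * (weight g * weight h))"
    using inj by (simp add: sum.reindex o_def case_prod_unfold)
  also have "\<dots> \<le> (\<Sum>((s, t), (g, h))\<in>D. weight s * weight t * (weight g * weight h))"
  proof (rule sum_mono2)
    show "finite D" unfolding D_def R_def by (intro finite_SigmaI) auto
  qed (use into in auto)
  also have "\<dots> = (\<Sum>x\<in>R. \<Sum>y\<in>common k (fst x) (snd x) \<times> common k (fst x) (snd x).
      weight (fst x) * weight (snd x) * (weight (fst y) * weight (snd y)))"
    unfolding D_def R_def by (subst sum.Sigma) (auto simp: case_prod_unfold)
  also have "\<dots> = (\<Sum>(s, t)\<in>R. weight s * weight t * (\<Sum>g\<in>common k s t. weight g)\<^sup>2)"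
  proof -
    have "(\<Sum>g\<in>c. weight g)\<^sup>2 = (\<Sum>y\<in>c \<times> c. weight (fst y) * weight (snd y))" for c
      by (simp add: power2_eq_square sum_product sum.cartesian_product case_prod_unfold)
    thus ?thesis by (simp only: sum_distrib_left case_prod_unfold)
  qed
  finally show ?thesis unfolding E_def R_def .
qed

text \<open>
  If a completion of a set of \<open>j\<close> primes from the first \<open>J\<close> blocks contains \<open>i\<close> further primes of these
  blocks, then tameness at \<open>J\<close> requires \<open>i + j \<le> J\<close>.
\<close>

definition common_bound :: "nat \<Rightarrow> nat \<Rightarrow> nat \<Rightarrow> real" where
  "common_bound k J j = (\<Sum>i | i + j \<le> J. esum i (U J) * esum (k - i - j) (U k - U J))"

lemma common_bound_nonneg: "common_bound k J j \<ge> 0"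
  by (auto simp: common_bound_def intro!: sum_nonneg)

lemma sum_common_le:
  assumes "J \<in> {1..k}" "s \<subseteq> U J" "card s = j"
  shows "(\<Sum>g\<in>common k s t. weight g) \<le> common_bound k J j"
proof -
  define A B where "A = U J" and "B = U k - U J"
  have AB: "finite A" "finite B" "A \<inter> B = {}" "A \<union> B = U k"
    using U_mono[of J k] assms by (auto simp: A_def B_def)
  define Q where "Q = (\<lambda>(X :: nat set) (Y :: nat set). card X + j \<le> J \<and> card X + card Y + j = k)"
  have fs: "finite s" using assms(2) finite_U finite_subset by blast
  have I: "finite {i. i + j \<le> J}" by (rule finite_subset[of _ "{..J}"]) auto
  have "common k s t \<subseteq> {S. S \<subseteq> A \<union> B \<and> Q (S \<inter> A) (S \<inter> B)}"
  proof
    fix g assume g: "g \<in> common k s t"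
    hence gU: "g \<subseteq> U k" and dis: "g \<inter> s = {}" and gs: "g \<union> s \<in> tame k k"
      using common_subset[of k s t] by (auto simp: common_def)
    have fg: "finite g" using gU finite_U finite_subset by blast
    have "card ((g \<union> s) \<inter> U J) \<le> J" using gs assms(1) by (auto simp: tame_def)
    also have "(g \<union> s) \<inter> U J = (g \<inter> A) \<union> s" using assms(2) by (auto simp: A_def)
    also have "card \<dots> = card (g \<inter> A) + card s"
      using fg fs dis by (intro card_Un_disjoint) auto
    finally have 1: "card (g \<inter> A) + j \<le> J" using assms(3) by simp
    have "card g = card ((g \<inter> A) \<union> (g \<inter> B))" using gU AB by (intro arg_cong[of _ _ card]) auto
    also have "\<dots> = card (g \<inter> A) + card (g \<inter> B)" using fg AB by (intro card_Un_disjoint) auto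
    finally have "card g = card (g \<inter> A) + card (g \<inter> B)" .
    moreover have "card g + j = k"
      using gs fg fs dis assms(3) card_Un_disjoint[of g s] by (auto simp: tame_def)
    ultimately show "g \<in> {S. S \<subseteq> A \<union> B \<and> Q (S \<inter> A) (S \<inter> B)}" using 1 gU AB by (auto simp: Q_def)
  qed
  hence "(\<Sum>g\<in>common k s t. weight g) \<le> (\<Sum>S | S \<subseteq> A \<union> B \<and> Q (S \<inter> A) (S \<inter> B). weight S)"
    using AB by (intro sum_mono2) (auto intro: finite_subset[of _ "Pow (A \<union> B)"])
  also have "\<dots> = (\<Sum>(X, Y) | X \<subseteq> A \<and> Y \<subseteq> B \<and> Q X Y. weight X * weight Y)"
    by (rule sum_weight_split[OF AB(1-3)])
  also have "\<dots> \<le> (\<Sum>(X, Y)\<in>(\<Union>i\<in>{i. i + j \<le> J}. {X. X \<subseteq> A \<and> card X = i} \<times> {Y. Y \<subseteq> B \<and> card Y = k - i - j}).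
      weight X * weight Y)"
    using AB I by (intro sum_mono2) (auto simp: Q_def)
  also have "\<dots> = (\<Sum>i | i + j \<le> J. \<Sum>(X, Y)\<in>{X. X \<subseteq> A \<and> card X = i} \<times> {Y. Y \<subseteq> B \<and> card Y = k - i - j}.
      weight X * weight Y)"
    using AB I by (intro sum.UNION_disjoint) auto
  also have "\<dots> = common_bound k J j"
    by (simp add: common_bound_def esum_def sum_product sum.cartesian_product A_def B_def)
  finally show ?thesis .
qed

lemma common_empty:
  assumes "J \<in> {1..k}" "s \<subseteq> U J" "card s > J"
  shows "common k s t = {}"
proof -
  have False if g: "g \<in> common k s t" for g
  proof -
    have gs: "g \<union> s \<in> tame k k" using g by (auto simp: common_def)
    have "card s \<le> card ((g \<union> s) \<inter> U J)"
      using assms(2) tame_finite[OF gs] by (intro card_mono) auto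
    also have "\<dots> \<le> J" using gs assms(1) by (auto simp: tame_def)
    finally show False using assms(3) by simp
  qed
  thus ?thesis by blast
qed

text \<open>
  Pairs in which the second component reaches up to block \<open>J\<close>, the last block that is met at all.
\<close>

definition top_pairs :: "real \<Rightarrow> nat \<Rightarrow> nat \<Rightarrow> (nat set \<times> nat set) set" where
  "top_pairs H J j = {(s, t). s \<subseteq> U J \<and> t \<subseteq> U J \<and> card s = j \<and> card t = j \<and> t \<inter> P J \<noteq> {} \<and>
     real (\<Prod>s) < H * real (\<Prod>t) \<and> real (\<Prod>t) < H * real (\<Prod>s)}"

text \<open>
  Given \<open>s\<close> and all of \<open>t\<close> except for one prime \<open>q\<close> of block \<open>J\<close>, the ratio condition confines \<open>q\<close> to an
  interval \<open>(z, H\<^sup>2 * z)\<close>. This is the only use of the ratio condition, and the source of the saving.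
\<close>

lemma sum_top_pairs_le:
  assumes J: "J > 0" and H: "H > 0"
    and short: "\<And>z. z > 0 \<Longrightarrow> (\<Sum>q\<in>{q \<in> P J. z < real q \<and> real q < H\<^sup>2 * z}. 1 / real q) \<le> kap"
  shows "(\<Sum>(s, t)\<in>top_pairs H J (Suc j). weight s * weight t) \<le> kap * (esum (Suc j) (U J) * esum j (U J))"
proof -
  \<comment> \<open>Any prime of \<open>t\<close> in block \<open>J\<close> will do.\<close>
  define pick where "pick t = (SOME q. q \<in> t \<inter> P J)" for t
  have pick: "pick t \<in> t" "pick t \<in> P J" if "t \<inter> P J \<noteq> {}" for t
    using someI_ex[of "\<lambda>q. q \<in> t \<inter> P J"] that by (auto simp: pick_def)
  define rng where "rng = (\<lambda>(s :: nat set, t' :: nat set).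
     {q \<in> P J. real (\<Prod>s) / (H * real (\<Prod>t')) < real q \<and> real q < H\<^sup>2 * (real (\<Prod>s) / (H * real (\<Prod>t')))})"
  define X where "X = {s. s \<subseteq> U J \<and> card s = Suc j} \<times> {t. t \<subseteq> U J \<and> card t = j}"
  define enc where "enc = (\<lambda>(s :: nat set, t). ((s, t - {pick t}), pick t))"
  have fX: "finite X" by (simp add: X_def)
  have inj: "inj_on enc (top_pairs H J (Suc j))"
  proof (rule inj_onI, clarify)
    fix s t s' t'
    assume "(s, t) \<in> top_pairs H J (Suc j)" "(s', t') \<in> top_pairs H J (Suc j)" and eq: "enc (s, t) = enc (s', t')"
    hence "pick t \<in> t" "pick t' \<in> t'" using pick(1) by (auto simp: top_pairs_def)
    hence "t = insert (pick t) (t - {pick t})" "t' = insert (pick t') (t' - {pick t'})" by auto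
    moreover have "s = s'" "t - {pick t} = t' - {pick t'}" "pick t = pick t'" using eq by (auto simp: enc_def)
    ultimately show "s = s' \<and> t = t'" by metis
  qed
  have into: "enc ` top_pairs H J (Suc j) \<subseteq> Sigma X rng"
  proof (rule image_subsetI)
    fix x assume "x \<in> top_pairs H J (Suc j)"
    then obtain s t where x: "x = (s, t)" and st: "(s, t) \<in> top_pairs H J (Suc j)"
      by (cases x) auto
    hence sub: "s \<subseteq> U J" "t \<subseteq> U J" "card s = Suc j" "card t = Suc j" "t \<inter> P J \<noteq> {}"
      and r: "real (\<Prod>s) < H * real (\<Prod>t)" "real (\<Prod>t) < H * real (\<Prod>s)"
      by (auto simp: top_pairs_def)
    define q t' where "q = pick t" and "t' = t - {q}"
    have q: "q \<in> t" "q \<in> P J" using pick[OF sub(5)] by (auto simp: q_def)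
    have ft: "finite t" using sub finite_U finite_subset by blast
    have pt: "\<Prod>t = q * \<Prod>t'" unfolding t'_def using q ft by (subst prod.remove[of t q]) auto
    have t0: "\<Prod>t' > 0" using sub by (intro prod_pos_U[of _ J]) (auto simp: t'_def)
    have "real (\<Prod>s) / (H * real (\<Prod>t')) < real q"
      using r(1) t0 H by (simp add: pt field_simps del: of_nat_prod)
    moreover have "real q < H\<^sup>2 * (real (\<Prod>s) / (H * real (\<Prod>t')))"
    proof -
      have "H\<^sup>2 * (real (\<Prod>s) / (H * real (\<Prod>t'))) = H * real (\<Prod>s) / real (\<Prod>t')"
        using H by (simp add: power2_eq_square del: of_nat_prod)
      moreover have "real q < H * real (\<Prod>s) / real (\<Prod>t')"
        using r(2) t0 by (simp add: pt field_simps del: of_nat_prod)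
      ultimately show ?thesis by (simp only:)
    qed
    ultimately show "enc x \<in> Sigma X rng"
      using sub q ft by (auto simp: x enc_def X_def rng_def t'_def q_def simp del: of_nat_prod)
  qed
  have "(\<Sum>(s, t)\<in>top_pairs H J (Suc j). weight s * weight t)
      = (\<Sum>x\<in>top_pairs H J (Suc j). case enc x of ((s, t'), q) \<Rightarrow> weight s * weight t' * (1 / real q))"
  proof (rule sum.cong[OF refl], clarify)
    fix s t assume st: "(s, t) \<in> top_pairs H J (Suc j)"
    hence sub: "t \<subseteq> U J" "t \<inter> P J \<noteq> {}" by (auto simp: top_pairs_def)
    have ft: "finite t" using sub finite_U finite_subset by blast
    have "weight (insert (pick t) (t - {pick t})) = weight (t - {pick t}) / real (pick t)"
      using ft by (intro weight_insert) auto
    moreover have "insert (pick t) (t - {pick t}) = t" using pick[OF sub(2)] by auto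
    ultimately show "weight s * weight t = (case enc (s, t) of ((s, t'), q) \<Rightarrow> weight s * weight t' * (1 / real q))"
      by (simp add: enc_def)
  qed
  also have "\<dots> = (\<Sum>((s, t'), q)\<in>enc ` top_pairs H J (Suc j). weight s * weight t' * (1 / real q))"
    using inj by (simp add: sum.reindex o_def case_prod_unfold)
  also have "\<dots> \<le> (\<Sum>((s, t'), q)\<in>Sigma X rng. weight s * weight t' * (1 / real q))"
    using into fX by (intro sum_mono2) (auto simp: rng_def)
  also have "\<dots> = (\<Sum>(s, t')\<in>X. weight s * weight t' * (\<Sum>q\<in>rng (s, t'). 1 / real q))"
    using fX by (subst sum.Sigma[symmetric]) (auto simp: rng_def case_prod_unfold sum_distrib_left)
  also have "\<dots> \<le> (\<Sum>(s, t')\<in>X. weight s * weight t' * kap)"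
  proof (rule sum_mono, clarify)
    fix s t' assume "(s, t') \<in> X"
    hence "\<Prod>s > 0" "\<Prod>t' > 0" by (auto simp: X_def intro: prod_pos_U)
    hence "real (\<Prod>s) / (H * real (\<Prod>t')) > 0" using H by (simp del: of_nat_prod)
    from short[OF this] show "weight s * weight t' * (\<Sum>q\<in>rng (s, t'). 1 / real q) \<le> weight s * weight t' * kap"
      by (intro mult_left_mono) (auto simp: rng_def)
  qed
  also have "\<dots> = (\<Sum>(s, t')\<in>X. weight s * weight t') * kap"
    by (simp add: sum_distrib_right case_prod_unfold)
  also have "(\<Sum>(s, t')\<in>X. weight s * weight t') = esum (Suc j) (U J) * esum j (U J)"
    by (simp add: X_def esum_def sum_product sum.cartesian_product)
  finally show ?thesis by (simp add: mult_ac)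
qed

text \<open>
  Pairs are sorted by the last block \<open>J\<close> that meets \<open>s \<union> t\<close>. The summand is symmetric in \<open>s\<close> and \<open>t\<close>, so
  at the price of a factor 2 this block may be assumed to meet \<open>t\<close>. A pair with a common completion has
  at most \<open>J\<close> primes in \<open>s\<close>, by tameness.
\<close>

lemma ratio_pairs_le_top_pairs:
  "(\<Sum>(s, t)\<in>ratio_pairs H k. weight s * weight t * (\<Sum>g\<in>common k s t. weight g)\<^sup>2)
     \<le> 2 * (\<Sum>J=1..k. \<Sum>j<J. (\<Sum>(s, t)\<in>top_pairs H J (Suc j). weight s * weight t) * (common_bound k J (Suc j))\<^sup>2)"
proof -
  define f where "f = (\<lambda>(s, t). weight s * weight t * (\<Sum>g\<in>common k s t. weight g)\<^sup>2)"
  define T where "T = (\<Union>(J, j)\<in>Sigma {1..k} (\<lambda>J. {..<J}). top_pairs H J (Suc j))"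
  have ftop: "finite (top_pairs H J j)" for J j
    by (rule finite_subset[of _ "Pow (U J) \<times> Pow (U J)"]) (auto simp: top_pairs_def)
  have fT: "finite T" unfolding T_def by (auto intro: ftop)
  have f0: "f x \<ge> 0" for x by (auto simp: f_def split: prod.split)
  have swap: "f (prod.swap x) = f x" for x
    by (cases x) (simp add: f_def common_def Un_commute conj_commute mult.commute)
  have T: "(s, t) \<in> T" if "card s = card t" "s \<noteq> {}" "J \<in> {1..k}" "s \<subseteq> U J" "t \<subseteq> U J"
      "t \<inter> P J \<noteq> {}" "real (\<Prod>s) < H * real (\<Prod>t)" "real (\<Prod>t) < H * real (\<Prod>s)" "card s \<le> J" for s t J
  proof -
    have "finite s" using that finite_U finite_subset by blast
    hence "card s \<noteq> 0" using \<open>s \<noteq> {}\<close> by (metis card_0_eq)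
    then obtain j where j: "card s = Suc j" using not0_implies_Suc by blast
    have "(s, t) \<in> top_pairs H J (Suc j)" using that j by (auto simp: top_pairs_def)
    moreover have "j < J" using j that by simp
    ultimately show ?thesis using that(3) unfolding T_def by (intro UN_I[of "(J, j)"]) auto
  qed
  have sub: "x \<in> T \<union> prod.swap ` T" if x: "x \<in> ratio_pairs H k" "f x \<noteq> 0" for x
  proof -
    obtain s t where st: "x = (s, t)" by (cases x)
    have h: "s \<subseteq> U k" "t \<subseteq> U k" "card s = card t" "s \<noteq> {}"
       "real (\<Prod>s) < H * real (\<Prod>t)" "real (\<Prod>t) < H * real (\<Prod>s)"
      using x st by (auto simp: ratio_pairs_def)
    define J where "J = (LEAST J. s \<union> t \<subseteq> U J)"
    have J: "s \<union> t \<subseteq> U J" unfolding J_def by (rule LeastI[of _ k]) (use h in auto)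
    have Jk: "J \<le> k" unfolding J_def by (rule Least_le) (use h in auto)
    have J0: "J \<noteq> 0" using J h by (intro notI) auto
    have Jr: "J \<in> {1..k}" using Jk J0 by auto
    have "\<not> s \<union> t \<subseteq> U (J - 1)" unfolding J_def by (rule not_less_Least) (use J0 J_def in auto)
    moreover have "U J = U (J - 1) \<union> P J" using U_Suc[of "J - 1"] J0 by simp
    ultimately have ne: "t \<inter> P J \<noteq> {} \<or> s \<inter> P J \<noteq> {}" using J by blast
    have "common k s t \<noteq> {}" using x st by (auto simp: f_def)
    hence cs: "card s \<le> J" using common_empty[of J k s t] Jr J by fastforce
    show ?thesis
    proof (cases "t \<inter> P J \<noteq> {}")
      case True
      thus ?thesis using T[of s t J] h J Jr cs st by auto
    next
      case False
      have "t \<noteq> {}" using h by (metis card_0_eq card.empty finite_U finite_subset)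
      hence "(t, s) \<in> T" using False T[of t s J] h J Jr cs ne by auto
      hence "prod.swap (t, s) \<in> prod.swap ` T" by (rule imageI)
      thus ?thesis using st by simp
    qed
  qed
  have "sum f (ratio_pairs H k) = sum f {x \<in> ratio_pairs H k. f x \<noteq> 0}"
    by (intro sum.mono_neutral_right) auto
  also have "\<dots> \<le> sum f (T \<union> prod.swap ` T)"
    using sub fT f0 by (intro sum_mono2) auto
  also have "\<dots> \<le> sum f T + sum f (prod.swap ` T)"
    using fT f0 by (simp add: sum_Un sum_nonneg)
  also have "sum f (prod.swap ` T) = sum f T"
    by (subst sum.reindex) (auto simp: swap inj_on_def)
  finally have 1: "sum f (ratio_pairs H k) \<le> 2 * sum f T" by simp
  have "sum f T \<le> (\<Sum>(J, j)\<in>Sigma {1..k} (\<lambda>J. {..<J}). sum f (top_pairs H J (Suc j)))"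
  proof -
    define I where "I = Sigma {1..k} (\<lambda>J. {..<J})"
    have "finite I" unfolding I_def by (intro finite_SigmaI) auto
    from sum_UNION_le[OF this, of "\<lambda>x. top_pairs H (fst x) (Suc (snd x))" f]
    show ?thesis unfolding T_def I_def[symmetric] case_prod_unfold using f0 ftop by simp
  qed
  also have "\<dots> = (\<Sum>J=1..k. \<Sum>j<J. sum f (top_pairs H J (Suc j)))"
    by (subst sum.Sigma) auto
  also have "\<dots> \<le> (\<Sum>J=1..k. \<Sum>j<J. (\<Sum>(s, t)\<in>top_pairs H J (Suc j). weight s * weight t) * (common_bound k J (Suc j))\<^sup>2)"
  proof (intro sum_mono)
    fix J j assume J: "J \<in> {1..k}"
    have "sum f (top_pairs H J (Suc j))
        \<le> (\<Sum>(s, t)\<in>top_pairs H J (Suc j). weight s * weight t * (common_bound k J (Suc j))\<^sup>2)"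
    proof (rule sum_mono, clarify)
      fix s t assume "(s, t) \<in> top_pairs H J (Suc j)"
      hence "s \<subseteq> U J" "card s = Suc j" by (auto simp: top_pairs_def)
      hence "(\<Sum>g\<in>common k s t. weight g)\<^sup>2 \<le> (common_bound k J (Suc j))\<^sup>2"
        using J by (intro power_mono sum_common_le sum_nonneg) auto
      thus "f (s, t) \<le> weight s * weight t * (common_bound k J (Suc j))\<^sup>2"
        unfolding f_def by (auto intro!: mult_left_mono)
    qed
    thus "sum f (top_pairs H J (Suc j))
        \<le> (\<Sum>(s, t)\<in>top_pairs H J (Suc j). weight s * weight t) * (common_bound k J (Suc j))\<^sup>2"
      by (simp add: sum_distrib_right case_prod_unfold)
  qed
  finally show ?thesis using 1 by (simp add: f_def)
qed

text \<open>
  Sort by the number \<open>n = i + j\<close> of primes in the first \<open>J\<close> blocks. The \<open>n\<close> primes can be distributed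
  over \<open>s\<close> and \<open>g\<close> in \<open>2 ^ n\<close> ways, and the remaining factor is a single term of the binomial expansion
  of \<open>(J + (k - J)) ^ k\<close>, so at most \<open>k ^ k\<close>. Since \<open>n \<le> J\<close>, summation over \<open>n\<close> costs only a factor 2.
\<close>

lemma esum_common_bound_sum_le:
  assumes J: "J \<in> {1..k}"
  shows "(\<Sum>j\<le>J. (mu * real J) ^ j / fact j * common_bound k J j) \<le> 2 * 2 ^ J * full_mass mu k"
proof -
  have I: "finite {i. i + j \<le> J}" for j by (rule finite_subset[of _ "{..J}"]) auto
  have Jk: "J \<le> k" using J by simp
  define B where "B = real k - real J"
  have M0: "full_mass mu k \<ge> 0" using mu_pos by (simp add: full_mass_def)
  have B0: "B \<ge> 0" using Jk by (simp add: B_def)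
  have "(\<Sum>j\<le>J. (mu * real J) ^ j / fact j * common_bound k J j)
      \<le> (\<Sum>j\<le>J. (mu * real J) ^ j / fact j * (\<Sum>i | i + j \<le> J. (mu * real J) ^ i / fact i * ((mu * B) ^ (k - i - j) / fact (k - i - j))))"
    unfolding common_bound_def B_def
    by (intro sum_mono mult_left_mono mult_mono esum_le mass_U mass_U_diff Jk)
       (use mu_pos B0 in \<open>auto simp: B_def intro!: mult_nonneg_nonneg\<close>)
  also have "\<dots> = (\<Sum>j\<le>J. \<Sum>i | i + j \<le> J. mu ^ k * (real J ^ (i + j) / (fact i * fact j) * (B ^ (k - (i + j)) / fact (k - (i + j)))))"
    unfolding sum_distrib_left
  proof (intro sum.cong refl)
    fix j i assume "i \<in> {i. i + j \<le> J}"
    hence "mu ^ k = mu ^ j * mu ^ i * mu ^ (k - i - j)" using Jk by (simp add: power_add[symmetric])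
    thus "(mu * real J) ^ j / fact j * ((mu * real J) ^ i / fact i * ((mu * B) ^ (k - i - j) / fact (k - i - j)))
      = mu ^ k * (real J ^ (i + j) / (fact i * fact j) * (B ^ (k - (i + j)) / fact (k - (i + j))))"
      by (simp add: power_mult_distrib power_add mult_ac diff_diff_left)
  qed
  also have "\<dots> = (\<Sum>n\<le>J. \<Sum>j\<le>n. mu ^ k * (real J ^ n / (fact (n - j) * fact j) * (B ^ (k - n) / fact (k - n))))"
  proof -
    have "(\<Sum>j\<le>J. \<Sum>i | i + j \<le> J. mu ^ k * (real J ^ (i + j) / (fact i * fact j) * (B ^ (k - (i + j)) / fact (k - (i + j)))))
      = (\<Sum>(j, i)\<in>Sigma {..J} (\<lambda>j. {i. i + j \<le> J}). mu ^ k * (real J ^ (i + j) / (fact i * fact j) * (B ^ (k - (i + j)) / fact (k - (i + j)))))"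
      using I by (subst sum.Sigma) auto
    also have "\<dots> = (\<Sum>(n, j)\<in>Sigma {..J} (\<lambda>n. {..n}). mu ^ k * (real J ^ n / (fact (n - j) * fact j) * (B ^ (k - n) / fact (k - n))))"
      by (rule sum.reindex_bij_witness[of _ "\<lambda>(n, j). (j, n - j)" "\<lambda>(j, i). (i + j, j)"]) auto
    also have "\<dots> = (\<Sum>n\<le>J. \<Sum>j\<le>n. mu ^ k * (real J ^ n / (fact (n - j) * fact j) * (B ^ (k - n) / fact (k - n))))"
      by (subst sum.Sigma) auto
    finally show ?thesis .
  qed
  also have "\<dots> = (\<Sum>n\<le>J. mu ^ k / fact k * (2 ^ n * (real (k choose n) * real J ^ n * B ^ (k - n))))"
  proof (rule sum.cong[OF refl])
    fix n assume "n \<in> {..J}"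
    hence nk: "n \<le> k" using Jk by simp
    have "(\<Sum>j\<le>n. mu ^ k * (real J ^ n / (fact (n - j) * fact j) * (B ^ (k - n) / fact (k - n))))
        = (\<Sum>j\<le>n. real (n choose j)) * (mu ^ k * (real J ^ n / fact n * (B ^ (k - n) / fact (k - n))))"
      unfolding sum_distrib_right by (intro sum.cong refl) (simp add: binomial_fact)
    also have "(\<Sum>j\<le>n. real (n choose j)) = 2 ^ n"
      using choose_row_sum[of n] by (simp flip: of_nat_sum)
    finally show "(\<Sum>j\<le>n. mu ^ k * (real J ^ n / (fact (n - j) * fact j) * (B ^ (k - n) / fact (k - n))))
        = mu ^ k / fact k * (2 ^ n * (real (k choose n) * real J ^ n * B ^ (k - n)))"
      using nk by (simp add: binomial_fact)
  qed
  also have "\<dots> \<le> (\<Sum>n\<le>J. mu ^ k / fact k * (2 ^ n * real k ^ k))"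
  proof (intro sum_mono mult_left_mono)
    fix n assume n: "n \<in> {..J}"
    have "real (k choose n) * real J ^ n * B ^ (k - n) \<le> (\<Sum>n\<le>k. real (k choose n) * real J ^ n * B ^ (k - n))"
      using n Jk B0 by (intro member_le_sum[of n "{..k}"]) auto
    also have "\<dots> = (real J + B) ^ k" by (simp add: binomial_ring)
    also have "real J + B = real k" by (simp add: B_def)
    finally show "real (k choose n) * real J ^ n * B ^ (k - n) \<le> real k ^ k" .
  qed (use mu_pos in auto)
  also have "\<dots> = (\<Sum>n\<le>J. 2 ^ n) * full_mass mu k"
    unfolding sum_distrib_right by (intro sum.cong refl) (simp add: full_mass_def)
  also have "(\<Sum>n\<le>J. 2 ^ n) \<le> (2 * 2 ^ J :: real)"
    by (induction J) auto
  finally show ?thesis using M0 by (simp add: mult_right_mono)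
qed

text \<open>
  The two splittings, of \<open>s\<close> and \<open>g\<close> and of \<open>t\<close> and \<open>h\<close>, lose \<open>(2 ^ J)\<^sup>2 = 4 ^ J\<close>, which is exactly what
  the short interval for the top prime gains. All \<open>k\<close> values of \<open>J\<close> contribute equally.
\<close>

lemma energy_bound:
  assumes H: "H > 0" and K: "K \<ge> 0"
    and short: "\<And>J z. J \<in> {1..k} \<Longrightarrow> z > 0 \<Longrightarrow>
        (\<Sum>q\<in>{q \<in> P J. z < real q \<and> real q < H\<^sup>2 * z}. 1 / real q) \<le> K / 4 ^ J"
  shows "(\<Sum>(S1, S2, S3, S4)\<in>energy_config H k. weight S1 * weight S2) \<le> 8 * K / mu * real k * (full_mass mu k)\<^sup>2"
proof -
  define a where "a = (\<lambda>J j. (mu * real J) ^ j / fact j * common_bound k J j)"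
  have a0: "a J j \<ge> 0" for J j unfolding a_def using mu_pos common_bound_nonneg by auto
  have summand: "(\<Sum>(s, t)\<in>top_pairs H J (Suc j). weight s * weight t) * (common_bound k J (Suc j))\<^sup>2
      \<le> K / 4 ^ J / mu * (a J (Suc j))\<^sup>2" if J: "J \<in> {1..k}" and j: "j < J" for J j
  proof -
    define M where "M = mu * real J"
    have M: "M > 0" using J mu_pos by (simp add: M_def)
    have K4: "K / 4 ^ J \<ge> 0" using K by simp
    have "(\<Sum>(s, t)\<in>top_pairs H J (Suc j). weight s * weight t) \<le> K / 4 ^ J * (esum (Suc j) (U J) * esum j (U J))"
      using J H short[OF J] by (intro sum_top_pairs_le) auto
    also have "\<dots> \<le> K / 4 ^ J * ((M ^ Suc j / fact (Suc j)) * (M ^ j / fact j))"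
      unfolding M_def using K4 mu_pos by (intro mult_left_mono mult_mono esum_le mass_U) auto
    \<comment> \<open>Equalising the exponents makes a square; the correction \<open>(j + 1) / M\<close> is at most \<open>1 / mu\<close> as \<open>j < J\<close>.\<close>
    also have "M ^ j / fact j = (M ^ Suc j / fact (Suc j)) * (real (Suc j) / M)"
      using M by (simp add: field_simps del: of_nat_Suc)
    also have "K / 4 ^ J * ((M ^ Suc j / fact (Suc j)) * ((M ^ Suc j / fact (Suc j)) * (real (Suc j) / M)))
        = K / 4 ^ J * (M ^ Suc j / fact (Suc j))\<^sup>2 * (real (Suc j) / M)"
      by (simp only: power2_eq_square mult.assoc)
    also have "\<dots> \<le> K / 4 ^ J * (M ^ Suc j / fact (Suc j))\<^sup>2 * (1 / mu)"
    proof (intro mult_left_mono)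
      have "real (Suc j) \<le> real J" using j by simp
      thus "real (Suc j) / M \<le> 1 / mu" using M mu_pos unfolding M_def by (simp add: field_simps del: of_nat_Suc)
    qed (use K4 in \<open>auto simp del: fact_Suc power_Suc times_divide_eq_left intro!: mult_nonneg_nonneg\<close>)
    finally have "(\<Sum>(s, t)\<in>top_pairs H J (Suc j). weight s * weight t) * (common_bound k J (Suc j))\<^sup>2
      \<le> K / 4 ^ J * (M ^ Suc j / fact (Suc j))\<^sup>2 * (1 / mu) * (common_bound k J (Suc j))\<^sup>2"
      by (rule mult_right_mono) simp
    also have "\<dots> = K / 4 ^ J / mu * (a J (Suc j))\<^sup>2"
      by (simp only: a_def M_def power_mult_distrib[of _ _ 2]) simp
    finally show ?thesis .
  qed
  have "(\<Sum>(S1, S2, S3, S4)\<in>energy_config H k. weight S1 * weight S2)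
      \<le> 2 * (\<Sum>J=1..k. \<Sum>j<J. (\<Sum>(s, t)\<in>top_pairs H J (Suc j). weight s * weight t) * (common_bound k J (Suc j))\<^sup>2)"
    using energy_le_ratio_pairs ratio_pairs_le_top_pairs by (rule order.trans)
  also have "\<dots> \<le> 2 * (\<Sum>J=1..k. \<Sum>j<J. K / 4 ^ J / mu * (a J (Suc j))\<^sup>2)"
    using summand by (intro mult_left_mono sum_mono) auto
  also have "\<dots> \<le> 2 * (\<Sum>J=1..k. 4 * K / mu * (full_mass mu k)\<^sup>2)"
  proof (intro mult_left_mono sum_mono)
    fix J assume J: "J \<in> {1..k}"
    have "(\<Sum>j<J. K / 4 ^ J / mu * (a J (Suc j))\<^sup>2) = K / 4 ^ J / mu * (\<Sum>j<J. (a J (Suc j))\<^sup>2)"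
      by (simp add: sum_distrib_left)
    also have "\<dots> \<le> K / 4 ^ J / mu * (2 * 2 ^ J * full_mass mu k)\<^sup>2"
    proof (intro mult_left_mono)
      have "(\<Sum>j<J. (a J (Suc j))\<^sup>2) \<le> (\<Sum>j<J. a J (Suc j))\<^sup>2"
        by (rule sum_squares_le_square_sum) (use a0 in auto)
      also have "(\<Sum>j<J. a J (Suc j)) = (\<Sum>j\<in>Suc ` {..<J}. a J j)"
        by (simp add: sum.reindex)
      also have "(\<dots>)\<^sup>2 \<le> (\<Sum>j\<le>J. a J j)\<^sup>2"
        using a0 by (intro power_mono sum_mono2 sum_nonneg) auto
      also have "\<dots> \<le> (2 * 2 ^ J * full_mass mu k)\<^sup>2"
        unfolding a_def by (intro power_mono esum_common_bound_sum_le J sum_nonneg)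
          (use mu_pos common_bound_nonneg in auto)
      finally show "(\<Sum>j<J. (a J (Suc j))\<^sup>2) \<le> (2 * 2 ^ J * full_mass mu k)\<^sup>2" .
    qed (use K mu_pos in auto)
    also have "\<dots> = 4 * K / mu * (full_mass mu k)\<^sup>2"
    proof -
      have "(2 ^ J :: real)\<^sup>2 = (2\<^sup>2) ^ J" by (simp only: power_mult[symmetric] mult.commute)
      hence "(2 ^ J :: real)\<^sup>2 = 4 ^ J" by simp
      thus ?thesis by (simp add: power_mult_distrib)
    qed
    finally show "(\<Sum>j<J. K / 4 ^ J / mu * (a J (Suc j))\<^sup>2) \<le> 4 * K / mu * (full_mass mu k)\<^sup>2" .
  qed auto
  also have "\<dots> = 8 * K / mu * real k * (full_mass mu k)\<^sup>2" by simp
  finally show ?thesis .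
qed

end

section \<open>Thinning, and collisions in product sets\<close>

text \<open>
  Delete one element at a time, always one that lies in at least the average number of sets \<open>V q\<close>. If \<open>n\<close>
  elements are left, this multiplies the number of surviving sets by at most
  \<open>1 - r / n \<le> ((n - 1) / n) ^ r\<close>, and these factors telescope. It serves as a substitute for a random
  subset.
\<close>

lemma thin_subset:
  fixes V :: "'q \<Rightarrow> 'a set"
  assumes "finite B" "finite Q" "\<And>q. q \<in> Q \<Longrightarrow> V q \<subseteq> B \<and> card (V q) = r"
    and "1 \<le> a" "a \<le> card B"
  shows "\<exists>A\<subseteq>B. card A = a \<and> real (card {q \<in> Q. V q \<subseteq> A}) * real (card B) ^ r \<le> real (card Q) * real a ^ r"
  using assms
proof (induction "card B" arbitrary: B Q rule: less_induct)
  case less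
  show ?case
  proof (cases "a = card B")
    case True
    have "{q \<in> Q. V q \<subseteq> B} = Q" using less.prems by auto
    thus ?thesis using True by (intro exI[of _ B]) auto
  next
    case False
    define n where "n = card B"
    have n: "a < n" "n > 1" using False less.prems by (auto simp: n_def)
    define d where "d = (\<lambda>x. card {q \<in> Q. x \<in> V q})"
    have "(\<Sum>x\<in>B. real (d x)) = (\<Sum>x\<in>B. \<Sum>q\<in>Q. if x \<in> V q then 1 else 0)"
      unfolding d_def using less.prems by (intro sum.cong refl) (simp add: sum.If_cases Int_def)
    also have "\<dots> = (\<Sum>q\<in>Q. \<Sum>x\<in>B. if x \<in> V q then 1 else 0)" by (rule sum.swap)
    also have "\<dots> = (\<Sum>q\<in>Q. real r)"
    proof (rule sum.cong[OF refl])
      fix q assume "q \<in> Q"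
      hence "B \<inter> V q = V q" "card (V q) = r" using less.prems(3) by auto
      thus "(\<Sum>x\<in>B. if x \<in> V q then 1 else 0) = real r"
        using less.prems by (simp add: sum.If_cases)
    qed
    finally have total: "(\<Sum>x\<in>B. real (d x)) = real (card Q) * real r" by simp
    obtain x where x: "x \<in> B" "real (d x) \<ge> real (card Q) * real r / real n"
    proof -
      have "\<exists>x\<in>B. real (d x) \<ge> real (card Q) * real r / real n"
      proof (rule ccontr)
        assume "\<not> ?thesis"
        hence "(\<Sum>x\<in>B. real (d x)) < (\<Sum>x\<in>B. real (card Q) * real r / real n)"
          using n less.prems by (intro sum_strict_mono) (auto simp: n_def)
        thus False using total n by (simp add: n_def)
      qed
      thus ?thesis using that by blast
    qed
    define B' Q' where "B' = B - {x}" and "Q' = {q \<in> Q. V q \<subseteq> B'}"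
    have cB': "card B' = n - 1" using x less.prems by (simp add: B'_def n_def)
    have "Q' = Q - {q \<in> Q. x \<in> V q}" using less.prems by (auto simp: Q'_def B'_def)
    hence "card Q' = card Q - d x" unfolding d_def using less.prems by (subst card_Diff_subset[symmetric]) auto
    moreover have "d x \<le> card Q" unfolding d_def using less.prems by (intro card_mono) auto
    ultimately have "real (card Q') = real (card Q) - real (d x)" by simp
    also have "\<dots> \<le> real (card Q) * (1 + real r * (- (1 / real n)))" using x by (simp add: algebra_simps)
    also have "\<dots> \<le> real (card Q) * (1 + (- (1 / real n))) ^ r"
      using n by (intro mult_left_mono Bernoulli_inequality) auto
    also have "1 + (- (1 / real n)) = real (n - 1) / real n" using n by (simp add: field_simps)
    finally have Q': "real (card Q') \<le> real (card Q) * (real (n - 1) / real n) ^ r" .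
    have "\<exists>A\<subseteq>B'. card A = a \<and> real (card {q \<in> Q'. V q \<subseteq> A}) * real (card B') ^ r \<le> real (card Q') * real a ^ r"
    proof (rule less.hyps)
      show "card B' < card B" using cB' n by (simp add: n_def)
      show "finite B'" "finite Q'" using less.prems by (auto simp: B'_def Q'_def)
      show "V q \<subseteq> B' \<and> card (V q) = r" if "q \<in> Q'" for q using that less.prems(3) by (auto simp: Q'_def)
      show "1 \<le> a" "a \<le> card B'" using less.prems n cB' by auto
    qed
    then obtain A where A: "A \<subseteq> B'" "card A = a"
      "real (card {q \<in> Q'. V q \<subseteq> A}) * real (n - 1) ^ r \<le> real (card Q') * real a ^ r" using cB' by auto
    have eq: "{q \<in> Q'. V q \<subseteq> A} = {q \<in> Q. V q \<subseteq> A}" using A by (auto simp: Q'_def)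
    have "real (card {q \<in> Q. V q \<subseteq> A}) * real (n - 1) ^ r \<le> real (card Q') * real a ^ r" using A(3) eq by simp
    also have "\<dots> \<le> real (card Q) * (real (n - 1) / real n) ^ r * real a ^ r"
      using Q' by (intro mult_right_mono) auto
    finally have "real (card {q \<in> Q. V q \<subseteq> A}) \<le> real (card Q) / real n ^ r * real a ^ r"
      using n by (simp add: power_divide field_simps)
    hence "real (card {q \<in> Q. V q \<subseteq> A}) * real n ^ r \<le> real (card Q) * real a ^ r"
      using n by (simp add: field_simps)
    thus ?thesis using A(1,2) by (intro exI[of _ A]) (auto simp: B'_def n_def)
  qed
qed

lemma card_le_image_plus_collisions:
  assumes "finite T"
  shows "card T \<le> card (f ` T) + card {(u, v). u \<in> T \<and> v \<in> T \<and> u \<noteq> v \<and> f u = f v}"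
proof -
  define rep where "rep u = inv_into T f (f u)" for u
  define C where "C = {(u, v). u \<in> T \<and> v \<in> T \<and> u \<noteq> v \<and> f u = f v}"
  have rep: "rep u \<in> T" "f (rep u) = f u" if "u \<in> T" for u
    using that by (auto simp: rep_def inv_into_into f_inv_into_f)
  have fC: "finite C" by (rule finite_subset[of _ "T \<times> T"]) (use assms in \<open>auto simp: C_def\<close>)
  have "T \<subseteq> {u \<in> T. rep u = u} \<union> {u \<in> T. rep u \<noteq> u}" by auto
  hence "card T \<le> card ({u \<in> T. rep u = u} \<union> {u \<in> T. rep u \<noteq> u})"
    using assms by (intro card_mono) auto
  also have "\<dots> \<le> card {u \<in> T. rep u = u} + card {u \<in> T. rep u \<noteq> u}" by (rule card_Un_le)
  also have "card {u \<in> T. rep u = u} \<le> card (f ` T)"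
  proof (rule card_inj_on_le)
    show "inj_on f {u \<in> T. rep u = u}" by (auto simp: inj_on_def) (metis rep_def)
  qed (use assms in auto)
  also have "card {u \<in> T. rep u \<noteq> u} \<le> card C"
  proof (rule card_inj_on_le)
    show "inj_on (\<lambda>u. (rep u, u)) {u \<in> T. rep u \<noteq> u}" by (auto simp: inj_on_def)
    show "(\<lambda>u. (rep u, u)) ` {u \<in> T. rep u \<noteq> u} \<subseteq> C" using rep by (auto simp: C_def)
  qed (rule fC)
  finally show ?thesis by (simp add: C_def)
qed

text \<open>
  The coincidences between products, apart from the trivial ones with \<open>{a, b} = {c, d}\<close>.
\<close>

definition quads :: "nat set \<Rightarrow> (nat \<times> nat \<times> nat \<times> nat) set" where
  "quads A = {(a, b, c, d). a \<in> A \<and> b \<in> A \<and> c \<in> A \<and> d \<in> A \<and> a * b = c * d \<and> a \<noteq> c \<and> a \<noteq> d}"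

lemma finite_quads [simp]: "finite A \<Longrightarrow> finite (quads A)"
  by (rule finite_subset[of _ "A \<times> A \<times> A \<times> A"]) (auto simp: quads_def)

text \<open>
  The products of unordered pairs exhaust \<open>A * A\<close>, and two different unordered pairs with the same product
  give rise to an element of \<open>quads A\<close>.
\<close>

lemma card_product_set_bounds:
  fixes A :: "nat set"
  assumes "finite A" "0 \<notin> A"
  shows "real (card (A * A)) \<le> ((real (card A))\<^sup>2 + real (card A)) / 2"
    and "real (card (A * A)) \<ge> ((real (card A))\<^sup>2 + real (card A)) / 2 - real (card (quads A))"
proof -
  define T where "T = {(x, y). x \<in> A \<and> y \<in> A \<and> x \<le> y}"
  define f where "f = (\<lambda>(x :: nat, y). x * y)"
  have fT: "finite T" by (rule finite_subset[of _ "A \<times> A"]) (use assms in \<open>auto simp: T_def\<close>)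
  have AA: "A * A = f ` T"
  proof
    show "A * A \<subseteq> f ` T"
    proof
      fix z assume "z \<in> A * A"
      then obtain x y where xy: "x \<in> A" "y \<in> A" "z = x * y" by (elim set_times_elim) auto
      show "z \<in> f ` T"
      proof (cases "x \<le> y")
        case True
        thus ?thesis using xy by (intro image_eqI[of _ _ "(x, y)"]) (auto simp: f_def T_def)
      next
        case False
        thus ?thesis using xy by (intro image_eqI[of _ _ "(y, x)"]) (auto simp: f_def T_def)
      qed
    qed
    show "f ` T \<subseteq> A * A" by (auto simp: f_def T_def intro: set_times_intro)
  qed
  have "card (A \<times> A) = card (T \<union> prod.swap ` T)"
    by (intro arg_cong[of _ _ card]) (auto simp: T_def image_iff)
  moreover have "card (T \<union> prod.swap ` T) + card (T \<inter> prod.swap ` T) = card T + card (prod.swap ` T)"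
    using fT by (intro card_Un_Int[symmetric]) auto
  moreover have "T \<inter> prod.swap ` T = (\<lambda>x. (x, x)) ` A" by (auto simp: T_def)
  moreover have "card ((\<lambda>x. (x, x)) ` A) = card A" by (intro card_image) (auto simp: inj_on_def)
  moreover have "card (prod.swap ` T) = card T" by (intro card_image) (auto simp: inj_on_def)
  ultimately have "card A * card A + card A = 2 * card T" by (simp add: card_cartesian_product)
  hence "real (card A * card A + card A) = real (2 * card T)" by (simp only:)
  hence cT: "real (card T) = ((real (card A))\<^sup>2 + real (card A)) / 2" by (simp add: power2_eq_square)
  show "real (card (A * A)) \<le> ((real (card A))\<^sup>2 + real (card A)) / 2"
    using card_image_le[OF fT, of f] unfolding AA cT[symmetric] by simp
  define C where "C = {(u, v). u \<in> T \<and> v \<in> T \<and> u \<noteq> v \<and> f u = f v}"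
  have "card C \<le> card (quads A)"
  proof (rule card_inj_on_le)
    show "inj_on (\<lambda>((a, b), (c, d)). (a, b, c, d)) C" by (auto simp: inj_on_def)
    show "(\<lambda>((a, b), (c, d)). (a, b, c, d)) ` C \<subseteq> quads A"
    proof (rule image_subsetI)
      fix x assume "x \<in> C"
      then obtain a b c d where x: "x = ((a, b), (c, d))" "a \<in> A" "b \<in> A" "c \<in> A" "d \<in> A" "a \<le> b" "c \<le> d"
        "a * b = c * d" "(a, b) \<noteq> (c, d)" by (auto simp: C_def T_def f_def)
      have pos: "a > 0" "b > 0" "c > 0" "d > 0" using x assms by (auto intro!: Nat.gr0I)
      have "a \<noteq> c" using x pos by auto
      moreover have "a \<noteq> d"
      proof
        assume "a = d"
        hence "b = c" using x(8) pos by (simp add: mult.commute)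
        thus False using x \<open>a = d\<close> by auto
      qed
      ultimately show "(\<lambda>((a, b), (c, d)). (a, b, c, d)) x \<in> quads A" using x by (auto simp: quads_def)
    qed
  qed (use assms in auto)
  moreover have "card T \<le> card (f ` T) + card C" unfolding C_def by (rule card_le_image_plus_collisions[OF fT])
  ultimately show "real (card (A * A)) \<ge> ((real (card A))\<^sup>2 + real (card A)) / 2 - real (card (quads A))"
    unfolding AA cT[symmetric] by linarith
qed

lemma mset_set_add_eq_imp:
  assumes "finite S1" "finite S2" "finite S3" "finite S4"
    and "mset_set S1 + mset_set S2 = mset_set S3 + mset_set S4"
  shows "S1 \<union> S2 = S3 \<union> S4" "S1 \<inter> S2 = S3 \<inter> S4"
proof -
  have c: "count (mset_set S) x = (if x \<in> S then 1 else 0)" if "finite S" for S :: "'a set" and x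
    using that by (simp add: count_mset_set')
  have iff: "(if x \<in> S1 then 1 else 0) + (if x \<in> S2 then 1 else 0)
      = (if x \<in> S3 then 1 else 0) + (if x \<in> S4 then 1 else 0 :: nat)" for x
    using arg_cong[OF assms(5), of "\<lambda>M. count M x"] assms(1-4) by (simp only: count_union c)
  show "S1 \<union> S2 = S3 \<union> S4"
  proof (rule set_eqI)
    fix x show "x \<in> S1 \<union> S2 \<longleftrightarrow> x \<in> S3 \<union> S4" using iff[of x] by (auto split: if_splits)
  qed
  show "S1 \<inter> S2 = S3 \<inter> S4"
  proof (rule set_eqI)
    fix x show "x \<in> S1 \<inter> S2 \<longleftrightarrow> x \<in> S3 \<inter> S4" using iff[of x] by (auto split: if_splits)
  qed
qed

text \<open>
  The primes \<open>p\<close> that put \<open>m * p\<close> between \<open>N / H\<close> and \<open>N\<close>.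
\<close>

definition window :: "real \<Rightarrow> nat \<Rightarrow> nat \<Rightarrow> nat set" where
  "window H N m = {p. prime p \<and> real N / (H * real m) < real p \<and> real p \<le> real N / real m}"

lemma finite_window [simp]: "finite (window H N m)"
proof (rule finite_subset)
  show "window H N m \<subseteq> {..nat \<lfloor>real N / real m\<rfloor>}" by (auto simp: window_def le_nat_floor)
qed auto

section \<open>Integers with exactly one large prime factor\<close>

text \<open>
  If \<open>m \<le> sqrt N\<close>, the primes of the window of \<open>m\<close> exceed \<open>sqrt N / H\<close>. So \<open>U_small\<close> says that they
  can be told apart from the primes in the blocks.
\<close>

locale large_prime_family = block_family +
  fixes H :: real and N k :: nat
  assumes H: "H \<ge> 1" and N: "real N > H\<^sup>2" "N \<ge> 16"
    and U_small: "p \<in> U k \<Longrightarrow> real p \<le> sqrt (real N) / H"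
begin

definition small :: "nat set set" where
  "small = {S \<in> tame k k. real (\<Prod>S) \<le> sqrt (real N)}"

definition pairs :: "(nat set \<times> nat) set" where
  "pairs = Sigma small (\<lambda>S. window H N (\<Prod>S))"

definition val :: "nat set \<times> nat \<Rightarrow> nat" where
  "val = (\<lambda>(S, p). \<Prod>S * p)"

definition B :: "nat set" where "B = val ` pairs"

lemma finite_small [simp]: "finite small" by (simp add: small_def)

lemma finite_pairs [simp]: "finite pairs" unfolding pairs_def by (intro finite_SigmaI) auto

lemma smallD:
  assumes "S \<in> small"
  shows "finite S" "S \<subseteq> U k" "\<Prod>S > 0" "real (\<Prod>S) \<le> sqrt (real N)"
proof -
  have S: "S \<in> tame k k" "real (\<Prod>S) \<le> sqrt (real N)" using assms unfolding small_def by blast+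
  show "finite S" using S(1) by (rule tame_finite)
  show "S \<subseteq> U k" using S(1) unfolding tame_def by blast
  thus "\<Prod>S > 0" by (rule prod_pos_U)
  show "real (\<Prod>S) \<le> sqrt (real N)" by (rule S(2))
qed

lemma big_prime:
  assumes "(S, p) \<in> pairs"
  shows "prime p" "real p > sqrt (real N) / H" "real p \<le> real N / real (\<Prod>S)" "S \<in> small"
proof -
  have S: "S \<in> small" and p: "p \<in> window H N (\<Prod>S)" using assms by (auto simp: pairs_def)
  note s = smallD[OF S]
  have N0: "real N > 0" using N by simp
  have S0: "real (\<Prod>S) > 0" using s(3) by (simp only: of_nat_0_less_iff)
  have "sqrt (real N) / H = real N / (H * sqrt (real N))" using N0 H by (simp add: field_simps)
  also have "\<dots> \<le> real N / (H * real (\<Prod>S))"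
    using s(4) S0 N0 H by (intro divide_left_mono mult_left_mono mult_pos_pos) (auto simp del: of_nat_prod)
  also have "\<dots> < real p" using p by (simp add: window_def del: of_nat_prod)
  finally show "real p > sqrt (real N) / H" .
  show "prime p" "real p \<le> real N / real (\<Prod>S)" "S \<in> small"
    using p S unfolding window_def by blast+
qed

lemma factorization_val:
  assumes "(S, p) \<in> pairs"
  shows "prime_factorization (val (S, p)) = mset_set S + {#p#}"
proof -
  note b = big_prime[OF assms]
  note s = smallD[OF b(4)]
  have "prime_factorization (\<Prod>S) = mset_set S"
  proof -
    have "prime_factorization (prod_mset (mset_set S)) = mset_set S"
      using s by (intro prime_factorization_prod_mset_primes) (auto intro: prime_U)
    moreover have "prod_mset (mset_set S) = \<Prod>S" by (simp add: prod_unfold_prod_mset)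
    ultimately show ?thesis by simp
  qed
  moreover have "prime_factorization (\<Prod>S * p) = prime_factorization (\<Prod>S) + prime_factorization p"
    using s b by (intro prime_factorization_mult) auto
  moreover have "prime_factorization p = {#p#}" using b(1) by (rule prime_factorization_prime)
  ultimately show ?thesis by (simp only: val_def case_prod_conv)
qed

lemma filter_factorization:
  assumes "(S, p) \<in> pairs"
  shows "filter_mset (\<lambda>q. real q > sqrt (real N) / H) (mset_set S + {#p#}) = {#p#}"
proof -
  note b = big_prime[OF assms]
  have "filter_mset (\<lambda>q. real q > sqrt (real N) / H) (mset_set S) = {#}"
    unfolding filter_mset_eq_mempty_iff
  proof (intro allI impI)
    fix q assume "q \<in># mset_set S"
    hence "q \<in> U k" using smallD(1,2)[OF b(4)] by auto
    thus "\<not> real q > sqrt (real N) / H" using U_small by (simp add: not_less)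
  qed
  thus ?thesis using b by simp
qed

lemma val_pos: "x \<in> pairs \<Longrightarrow> val x > 0"
proof -
  assume x: "x \<in> pairs"
  obtain S p where Sp: "x = (S, p)" by (cases x)
  have "\<Prod>S > 0" "p > 0" using big_prime(1,4)[of S p] x smallD(3)[of S] prime_gt_0_nat unfolding Sp by blast+
  thus ?thesis by (simp add: Sp val_def)
qed

text \<open>
  Unique factorisation: the primes above \<open>sqrt N / H\<close> are the two large primes on either side.
\<close>

lemma val_mult_eqD:
  assumes "(S1, p1) \<in> pairs" "(S2, p2) \<in> pairs" "(S3, p3) \<in> pairs" "(S4, p4) \<in> pairs"
    and eq: "val (S1, p1) * val (S2, p2) = val (S3, p3) * val (S4, p4)"
  shows "{#p1, p2#} = {#p3, p4#}" "S1 \<union> S2 = S3 \<union> S4" "S1 \<inter> S2 = S3 \<inter> S4"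
proof -
  have pos: "val (S1, p1) \<noteq> 0" "val (S2, p2) \<noteq> 0" "val (S3, p3) \<noteq> 0" "val (S4, p4) \<noteq> 0"
    using assms val_pos by (metis less_not_refl)+
  have pf: "(mset_set S1 + {#p1#}) + (mset_set S2 + {#p2#}) = (mset_set S3 + {#p3#}) + (mset_set S4 + {#p4#})"
    using arg_cong[OF eq, of prime_factorization]
    unfolding prime_factorization_mult[OF pos(1,2)] prime_factorization_mult[OF pos(3,4)]
      factorization_val[OF assms(1)] factorization_val[OF assms(2)]
      factorization_val[OF assms(3)] factorization_val[OF assms(4)] .
  have "filter_mset (\<lambda>q. real q > sqrt (real N) / H) ((mset_set S1 + {#p1#}) + (mset_set S2 + {#p2#}))
      = filter_mset (\<lambda>q. real q > sqrt (real N) / H) ((mset_set S3 + {#p3#}) + (mset_set S4 + {#p4#}))"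
    by (simp only: pf)
  hence "{#p1#} + {#p2#} = {#p3#} + {#p4#}"
    unfolding filter_union_mset[of _ "mset_set S1 + {#p1#}"] filter_union_mset[of _ "mset_set S3 + {#p3#}"]
      filter_factorization[OF assms(1)] filter_factorization[OF assms(2)]
      filter_factorization[OF assms(3)] filter_factorization[OF assms(4)] .
  thus ps: "{#p1, p2#} = {#p3, p4#}" by (simp add: add_mset_commute)
  have "(mset_set S1 + mset_set S2) + {#p1, p2#} = (mset_set S3 + mset_set S4) + {#p3, p4#}"
    using pf by (simp add: union_ac add_mset_commute)
  hence "mset_set S1 + mset_set S2 = mset_set S3 + mset_set S4" using ps by simp
  from mset_set_add_eq_imp[OF _ _ _ _ this]
  show "S1 \<union> S2 = S3 \<union> S4" "S1 \<inter> S2 = S3 \<inter> S4"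
    using smallD(1) big_prime(4) assms(1-4) by blast+
qed

lemma inj_on_val: "inj_on val pairs"
proof (rule inj_onI)
  fix x y assume xy: "x \<in> pairs" "y \<in> pairs" "val x = val y"
  obtain S1 p1 S2 p2 where e: "x = (S1, p1)" "y = (S2, p2)" by (cases x, cases y) auto
  have eq: "val (S1, p1) * val (S1, p1) = val (S2, p2) * val (S2, p2)" using xy e by simp
  note v = val_mult_eqD[OF _ _ _ _ eq]
  have "{#p1, p1#} = {#p2, p2#}" "S1 = S2" using v xy e by auto
  thus "x = y" using e by (auto simp: add_mset_eq_single add_eq_conv_ex)
qed

lemma B_subset: "B \<subseteq> {1..N}"
proof
  fix b assume "b \<in> B"
  then obtain S p where Sp: "(S, p) \<in> pairs" "b = val (S, p)" by (auto simp: B_def)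
  note g = big_prime[OF Sp(1)]
  have "\<Prod>S > 0" using smallD g by blast
  hence "real p * real (\<Prod>S) \<le> real N" using g(3) by (simp add: field_simps del: of_nat_prod)
  hence "real (val (S, p)) \<le> real N" unfolding val_def by (simp only: case_prod_conv of_nat_mult mult.commute)
  moreover have "val (S, p) > 0" using Sp val_pos by blast
  ultimately show "b \<in> {1..N}" using Sp by auto
qed

lemma B_cases: "b \<in> B \<Longrightarrow> \<exists>S p. b = val (S, p) \<and> (S, p) \<in> pairs"
  unfolding B_def by (metis imageE surj_pair)

lemma card_B: "real (card B) = (\<Sum>S\<in>small. real (card (window H N (\<Prod>S))))"
proof -
  have "card B = card pairs" unfolding B_def by (rule card_image[OF inj_on_val])
  also have "\<dots> = (\<Sum>S\<in>small. card (window H N (\<Prod>S)))"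
    unfolding pairs_def by (subst card_SigmaI) auto
  finally show ?thesis by simp
qed

text \<open>
  The large primes of \<open>a\<close>, \<open>b\<close> are those of \<open>c\<close>, \<open>d\<close>, possibly in the other order. Two elements \<open>m * p\<close>
  and \<open>m' * p\<close> of the family lie between \<open>N / H\<close> and \<open>N\<close>, so \<open>m\<close> and \<open>m'\<close> differ by a factor less than
  \<open>H\<close>.
\<close>

lemma quads_B_cases:
  assumes "(a, b, c, d) \<in> quads B"
  obtains S1 S2 S3 S4 p1 p2 where
    "(S1, S2, S3, S4) \<in> energy_config H k" "S1 \<in> small" "S2 \<in> small" "p1 \<in> window H N (\<Prod>S1)" "p2 \<in> window H N (\<Prod>S2)"
    "a = val (S1, p1)" "b = val (S2, p2)" "(c, d) = (val (S3, p1), val (S4, p2)) \<or> (c, d) = (val (S4, p2), val (S3, p1))"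
proof -
  note result = that
  have *: thesis if pr: "(S1, p1) \<in> pairs" "(S2, p2) \<in> pairs" "(S3, p1) \<in> pairs" "(S4, p2) \<in> pairs"
     and eq: "val (S1, p1) * val (S2, p2) = val (S3, p1) * val (S4, p2)" and ne: "S1 \<noteq> S3"
     and ab: "a = val (S1, p1)" "b = val (S2, p2)" "(c, d) = (val (S3, p1), val (S4, p2)) \<or> (c, d) = (val (S4, p2), val (S3, p1))"
     for S1 S2 S3 S4 p1 p2
  proof -
    have sm: "S1 \<in> small" "S2 \<in> small" "S3 \<in> small" "S4 \<in> small" using pr big_prime(4) by blast+
    have w: "p1 \<in> window H N (\<Prod>S1)" "p2 \<in> window H N (\<Prod>S2)" "p1 \<in> window H N (\<Prod>S3)"
      using pr by (auto simp: pairs_def)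
    have pos: "real (\<Prod>S1) > 0" "real (\<Prod>S3) > 0" using smallD(3) sm by (auto simp del: of_nat_prod)
    have r: "real m < H * real m'" if "real N / (H * real m') < real p" "real p \<le> real N / real m" "real m > 0" "real m' > 0" for m m' p :: nat
    proof -
      have "real N / (H * real m') < real N / real m" using that by simp
      thus ?thesis using N that H by (simp add: field_simps)
    qed
    have "real (\<Prod>S1) < H * real (\<Prod>S3)" "real (\<Prod>S3) < H * real (\<Prod>S1)"
      using w pos by (auto simp: window_def simp del: of_nat_prod intro!: r)
    moreover note val_mult_eqD(2,3)[OF pr eq]
    ultimately have "(S1, S2, S3, S4) \<in> energy_config H k"
      using sm ne by (auto simp: energy_config_def small_def)
    thus thesis using sm(1,2) w(1,2) ab by (rule result)
  qed
  have q: "a \<in> B" "b \<in> B" "c \<in> B" "d \<in> B" "a * b = c * d" "a \<noteq> c" "a \<noteq> d"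
    using assms by (auto simp: quads_def)
  obtain S1 p1 S2 p2 S3 p3 S4 p4 where e: "a = val (S1, p1)" "b = val (S2, p2)" "c = val (S3, p3)" "d = val (S4, p4)"
    and pr: "(S1, p1) \<in> pairs" "(S2, p2) \<in> pairs" "(S3, p3) \<in> pairs" "(S4, p4) \<in> pairs"
    using B_cases[OF q(1)] B_cases[OF q(2)] B_cases[OF q(3)] B_cases[OF q(4)] by (elim exE conjE)
  have eq: "val (S1, p1) * val (S2, p2) = val (S3, p3) * val (S4, p4)" using q e by simp
  have "{#p1, p2#} = {#p3, p4#}" using val_mult_eqD(1)[OF pr eq] .
  hence "p1 = p3 \<and> p2 = p4 \<or> p1 = p4 \<and> p2 = p3" by (auto simp: add_eq_conv_ex)
  thus thesis
  proof
    assume "p1 = p3 \<and> p2 = p4"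
    thus thesis using *[of S1 p1 S2 p2 S3 S4] pr eq e q by auto
  next
    assume p: "p1 = p4 \<and> p2 = p3"
    have "val (S1, p1) * val (S2, p2) = val (S4, p1) * val (S3, p2)" using eq p by (simp add: mult.commute)
    thus thesis using *[of S1 p1 S2 p2 S4 S3] pr p e q by auto
  qed
qed

lemma card_quads_B:
  assumes W: "\<And>S. S \<in> small \<Longrightarrow> real (card (window H N (\<Prod>S))) \<le> W * weight S" and W0: "W \<ge> 0"
  shows "real (card (quads B)) \<le> 2 * W\<^sup>2 * (\<Sum>(S1, S2, S3, S4)\<in>energy_config H k. weight S1 * weight S2)"
proof -
  define E where "E = {(S1, S2, S3, S4) \<in> energy_config H k. S1 \<in> small \<and> S2 \<in> small}"
  define Z where "Z = Sigma E (\<lambda>(S1, S2, S3, S4). window H N (\<Prod>S1) \<times> window H N (\<Prod>S2))"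
  define f1 where "f1 = (\<lambda>((S1, S2, S3, S4), (p1, p2)). (val (S1, p1), val (S2, p2), val (S3, p1), val (S4, p2)))"
  define f2 where "f2 = (\<lambda>((S1, S2, S3, S4), (p1, p2)). (val (S1, p1), val (S2, p2), val (S4, p2), val (S3, p1)))"
  have fEc: "finite (energy_config H k)"
    by (rule finite_subset[of _ "tame k k \<times> tame k k \<times> tame k k \<times> tame k k"]) (auto simp: energy_config_def)
  have fE: "finite E" by (rule finite_subset[OF _ fEc]) (auto simp: E_def)
  have fZ: "finite Z" unfolding Z_def by (intro finite_SigmaI fE) auto
  have "quads B \<subseteq> f1 ` Z \<union> f2 ` Z"
  proof
    fix x assume x: "x \<in> quads B"
    obtain a b c d where xe: "x = (a, b, c, d)" by (cases x)
    from x[unfolded xe] show "x \<in> f1 ` Z \<union> f2 ` Z"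
    proof (cases rule: quads_B_cases)
      case (1 S1 S2 S3 S4 p1 p2)
      have z: "((S1, S2, S3, S4), (p1, p2)) \<in> Z" using 1 by (auto simp: Z_def E_def)
      have "x = f1 ((S1, S2, S3, S4), (p1, p2)) \<or> x = f2 ((S1, S2, S3, S4), (p1, p2))"
        using 1 by (auto simp: f1_def f2_def xe)
      thus ?thesis using z by blast
    qed
  qed
  hence "card (quads B) \<le> card (f1 ` Z \<union> f2 ` Z)" using fZ by (intro card_mono) auto
  also have "\<dots> \<le> card (f1 ` Z) + card (f2 ` Z)" by (rule card_Un_le)
  also have "\<dots> \<le> 2 * card Z" using card_image_le[OF fZ, of f1] card_image_le[OF fZ, of f2] by simp
  finally have "real (card (quads B)) \<le> 2 * real (card Z)" by linarith
  also have "real (card Z) = (\<Sum>(S1, S2, S3, S4)\<in>E. real (card (window H N (\<Prod>S1))) * real (card (window H N (\<Prod>S2))))"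
    unfolding Z_def using fE by (subst card_SigmaI) (auto simp: case_prod_unfold card_cartesian_product)
  also have "\<dots> \<le> (\<Sum>(S1, S2, S3, S4)\<in>E. W\<^sup>2 * (weight S1 * weight S2))"
  proof (rule sum_mono)
    fix x assume "x \<in> E"
    then obtain S1 S2 S3 S4 where x: "x = (S1, S2, S3, S4)" "S1 \<in> small" "S2 \<in> small" by (auto simp: E_def)
    have "real (card (window H N (\<Prod>S1))) * real (card (window H N (\<Prod>S2))) \<le> (W * weight S1) * (W * weight S2)"
      using x W0 by (intro mult_mono W) auto
    thus "(case x of (S1, S2, S3, S4) \<Rightarrow> real (card (window H N (\<Prod>S1))) * real (card (window H N (\<Prod>S2))))
       \<le> (case x of (S1, S2, S3, S4) \<Rightarrow> W\<^sup>2 * (weight S1 * weight S2))"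
      by (simp add: x power2_eq_square mult_ac)
  qed
  also have "\<dots> \<le> (\<Sum>(S1, S2, S3, S4)\<in>energy_config H k. W\<^sup>2 * (weight S1 * weight S2))"
    using fEc by (intro sum_mono2) (auto simp: E_def)
  also have "\<dots> = W\<^sup>2 * (\<Sum>(S1, S2, S3, S4)\<in>energy_config H k. weight S1 * weight S2)"
    by (simp add: sum_distrib_left case_prod_unfold)
  finally show ?thesis by (simp add: mult_ac)
qed

text \<open>
  All elements of the family are squarefree, so \<open>a * a = c * d\<close> has only the trivial solution.
\<close>

lemma quads_B_distinct:
  assumes "(a, b, c, d) \<in> quads B"
  shows "card {a, b, c, d} = 4"
proof -
  have sq: "c = d" if acd: "a \<in> B" "c \<in> B" "d \<in> B" "a * a = c * d" for a c d
  proof -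
    obtain S p T q R r where e: "a = val (S, p)" "c = val (T, q)" "d = val (R, r)"
      and pr: "(S, p) \<in> pairs" "(T, q) \<in> pairs" "(R, r) \<in> pairs"
      using B_cases[OF acd(1)] B_cases[OF acd(2)] B_cases[OF acd(3)] by (elim exE conjE)
    note v = val_mult_eqD[OF pr(1) pr(1) pr(2) pr(3) acd(4)[unfolded e]]
    have "T = R" using v(2,3) by blast
    moreover have "q = r" using v(1) by (auto simp: add_eq_conv_ex)
    ultimately show ?thesis using e by simp
  qed
  have q: "a \<in> B" "b \<in> B" "c \<in> B" "d \<in> B" "a * b = c * d" "a \<noteq> c" "a \<noteq> d"
    using assms by (auto simp: quads_def)
  have pos: "a > 0" "b > 0" "c > 0" "d > 0" using q B_subset by fastforce+
  have "b \<noteq> c" "b \<noteq> d" using q pos by (auto simp: mult.commute)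
  moreover have "a \<noteq> b"
  proof
    assume ab: "a = b"
    hence cd: "c = d" using sq[of a c d] q by auto
    hence "a\<^sup>2 = c\<^sup>2" using q ab by (simp add: power2_eq_square)
    thus False using q by simp
  qed
  moreover have "c \<noteq> d"
  proof
    assume cd: "c = d"
    hence ab: "a = b" using sq[of c a b] q by auto
    thus False using \<open>a \<noteq> b\<close> by simp
  qed
  ultimately show ?thesis using q by simp
qed

end

section \<open>Construction of the prime blocks\<close>

text \<open>
  Adding the elements one by one, the sum enters the interval from \<open>M - e\<close> to \<open>M\<close> before it can exceed
  \<open>M\<close>.
\<close>

lemma trim_sum:
  fixes f :: "'a \<Rightarrow> real"
  assumes "finite S" "M \<ge> 0" "\<And>x. x \<in> S \<Longrightarrow> 0 \<le> f x \<and> f x \<le> e"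
  shows "\<exists>T\<subseteq>S. sum f T \<le> M \<and> (T = S \<or> sum f T \<ge> M - e)"
  using assms(1,3)
proof (induction S rule: finite_induct)
  case (insert x S)
  obtain T where T: "T \<subseteq> S" "sum f T \<le> M" "T = S \<or> sum f T \<ge> M - e"
    using insert by force
  show ?case
  proof (cases "sum f T \<ge> M - e")
    case True
    thus ?thesis using T by (intro exI[of _ T]) auto
  next
    case False
    hence TS: "T = S" using T by blast
    have "sum f (insert x S) = f x + sum f T" using insert TS by simp
    also have "\<dots> \<le> M" using False insert.prems[of x] by auto
    finally show ?thesis by (intro exI[of _ "insert x S"]) auto
  qed
qed (use assms in auto)

text \<open>
  End points of blocks. They are integers whose logarithms grow by a factor of exactly 4.
\<close>

definition tower :: "nat \<Rightarrow> nat" where "tower j = 2 ^ (4 ^ j)"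

lemma ln_tower: "ln (real (tower j)) = 4 ^ j * ln 2"
  by (simp add: tower_def ln_realpow)

lemma tower_mono: "i \<le> j \<Longrightarrow> tower i \<le> tower j"
  by (simp add: tower_def)

lemma tower_ge_2: "tower j \<ge> 2"
proof -
  have "(2::nat) ^ 1 \<le> 2 ^ (4 ^ j)" by (rule power_increasing) auto
  thus ?thesis by (simp add: tower_def)
qed

lemma tower_ge: "tower j \<ge> 4 ^ j"
  unfolding tower_def using less_exp[of "4 ^ j"] by (intro less_imp_le) auto

lemma square_le_two_power: "J\<^sup>2 \<le> 2 * 2 ^ J" for J :: nat
proof (induction J)
  case (Suc J)
  show ?case
  proof (cases "J \<le> 2")
    case True
    hence "J = 0 \<or> J = 1 \<or> J = 2" by auto
    thus ?thesis by (auto simp: power2_eq_square)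
  next
    case False
    hence "3 * J \<le> J * J" by (intro mult_right_mono) auto
    moreover have "(Suc J)\<^sup>2 = J * J + 2 * J + 1" "J\<^sup>2 = J * J" by (simp_all add: power2_eq_square)
    ultimately have "(Suc J)\<^sup>2 \<le> 2 * J\<^sup>2" using False by linarith
    thus ?thesis using Suc by simp
  qed
qed auto

lemma prod_half_lower: "(\<Prod>j=1..k. 1 - (1/2) ^ Suc j :: real) \<ge> 1/2 + (1/2) ^ Suc k"
proof (induction k)
  case (Suc k)
  define u where "u = (1/2 :: real) ^ Suc (Suc k)"
  have u: "0 \<le> u" "u \<le> 1/4" "(1/2) ^ Suc k = 2 * u"
    using power_decreasing[of 2 "Suc (Suc k)" "1/2 :: real"] by (auto simp: u_def power2_eq_square)
  have "1/2 + u \<le> (1/2 + 2 * u) * (1 - u)"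
  proof -
    have "u * u \<le> u * (1/4)" using u by (intro mult_left_mono) auto
    moreover have "(1/2 + 2 * u) * (1 - u) = 1/2 + 2 * u - u / 2 - 2 * (u * u)" by (simp add: field_simps)
    ultimately show ?thesis by linarith
  qed
  also have "\<dots> \<le> (\<Prod>j=1..k. 1 - (1/2) ^ Suc j) * (1 - u)"
    using Suc u by (intro mult_right_mono) auto
  also have "\<dots> = (\<Prod>j=1..Suc k. 1 - (1/2) ^ Suc j)" by (simp add: u_def)
  finally show ?case by (simp add: u_def)
qed auto

text \<open>
  The primes between two neighbouring end points have mass at least \<open>ln 4 - C / 4 ^ j\<close>, by
  \<open>mertens_second_lower\<close>; an excess is trimmed off.
\<close>

lemma trimmed_block_exists:
  obtains C where "C \<ge> 0"
    "\<And>j. \<exists>T\<subseteq>primes_in (tower j) (tower (Suc j)). (\<Sum>p\<in>T. 1 / real p) \<le> ln 4 \<and> (\<Sum>p\<in>T. 1 / real p) \<ge> ln 4 - C / 4 ^ j"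
proof -
  obtain C where C: "C \<ge> 0"
    "\<And>x y. 2 \<le> x \<Longrightarrow> x \<le> y \<Longrightarrow>
       (\<Sum>p\<in>primes_in x y. 1 / real p) \<ge> ln (ln (real y) / ln (real x)) - C / ln (real x)"
    using mertens_second_lower by blast
  show ?thesis
  proof (rule that[of "C / ln 2 + 1"])
    show "C / ln 2 + 1 \<ge> 0" using C by simp
    fix j
    define S where "S = primes_in (tower j) (tower (Suc j))"
    have "\<exists>T\<subseteq>S. (\<Sum>p\<in>T. 1 / real p) \<le> ln 4 \<and> (T = S \<or> (\<Sum>p\<in>T. 1 / real p) \<ge> ln 4 - 1 / 4 ^ j)"
    proof (rule trim_sum)
      fix p assume "p \<in> S"
      hence "p > tower j" by (auto simp: S_def primes_in_def)
      hence "p \<ge> 4 ^ j" using tower_ge[of j] by linarith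
      hence "real p \<ge> real (4 ^ j)" by (simp only: of_nat_le_iff)
      thus "0 \<le> 1 / real p \<and> 1 / real p \<le> 1 / 4 ^ j" using \<open>p > tower j\<close> by (auto intro!: divide_left_mono mult_pos_pos)
    qed (auto simp: S_def)
    then obtain T where T: "T \<subseteq> S" "(\<Sum>p\<in>T. 1 / real p) \<le> ln 4" "T = S \<or> (\<Sum>p\<in>T. 1 / real p) \<ge> ln 4 - 1 / 4 ^ j"
      by blast
    have "(\<Sum>p\<in>S. 1 / real p) \<ge> ln (ln (real (tower (Suc j))) / ln (real (tower j))) - C / ln (real (tower j))"
      unfolding S_def using tower_ge_2 tower_mono by (intro C) auto
    also have "ln (real (tower (Suc j))) / ln (real (tower j)) = 4" by (simp add: ln_tower)
    also have "C / ln (real (tower j)) = C / ln 2 / 4 ^ j" by (simp add: ln_tower mult.commute)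
    finally have S: "(\<Sum>p\<in>S. 1 / real p) \<ge> ln 4 - C / ln 2 / 4 ^ j" .
    have e: "(C / ln 2 + 1) / 4 ^ j = C / ln 2 / 4 ^ j + 1 / 4 ^ j" by (simp add: add_divide_distrib)
    have n: "C / ln 2 / 4 ^ j \<ge> 0" "(1::real) / 4 ^ j \<ge> 0" using C by auto
    have "(\<Sum>p\<in>T. 1 / real p) \<ge> ln 4 - (C / ln 2 + 1) / 4 ^ j"
    proof (cases "T = S")
      case True
      show ?thesis unfolding True e using S n by linarith
    next
      case False
      thus ?thesis unfolding e using T(3) n by linarith
    qed
    thus "\<exists>T\<subseteq>primes_in (tower j) (tower (Suc j)). (\<Sum>p\<in>T. 1 / real p) \<le> ln 4 \<and> (\<Sum>p\<in>T. 1 / real p) \<ge> ln 4 - (C / ln 2 + 1) / 4 ^ j"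
      using T by (auto simp: S_def)
  qed
qed

lemma ln_4_ge_1: "ln 4 \<ge> (1 :: real)"
proof -
  have "exp (1::real) \<le> 4" using exp_le by linarith
  thus ?thesis by (simp add: ln_ge_iff)
qed

text \<open>
  In block \<open>j\<close>, up to \<open>j\<close> primes are chosen. By \<open>esum_ge\<close>, restricting to distinct primes lowers the
  effective mass by at most \<open>j / 4 ^ (r + j)\<close>, and raising to a power \<open>i \<le> j\<close> multiplies the relative
  error by \<open>j\<close>. If the first \<open>r\<close> blocks are discarded, for large \<open>r\<close>, the total relative error in block
  \<open>j\<close> is at most \<open>(1/2) ^ Suc j\<close>, so that the product of all losses stays above \<open>1 / 2\<close>.
\<close>

lemma blocks_exist:
  obtains r :: nat and P :: "nat \<Rightarrow> nat set" where
    "block_family P (ln 4)"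
    "\<And>j p. p \<in> P j \<Longrightarrow> tower (r + j) < p \<and> p \<le> tower (Suc (r + j))"
    "\<And>i j. 1 \<le> j \<Longrightarrow> i \<le> j \<Longrightarrow> esum i (P j) \<ge> (1 - (1/2) ^ Suc j) * (ln 4 ^ i / fact i)"
proof -
  obtain C where C: "C \<ge> 0"
    "\<And>j. \<exists>T\<subseteq>primes_in (tower j) (tower (Suc j)). (\<Sum>p\<in>T. 1 / real p) \<le> ln 4 \<and> (\<Sum>p\<in>T. 1 / real p) \<ge> ln 4 - C / 4 ^ j"
    using trimmed_block_exists by blast
  from C(2) obtain Q where Q: "\<And>j. Q j \<subseteq> primes_in (tower j) (tower (Suc j))"
      "\<And>j. (\<Sum>p\<in>Q j. 1 / real p) \<le> ln 4" "\<And>j. (\<Sum>p\<in>Q j. 1 / real p) \<ge> ln 4 - C / 4 ^ j"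
    by metis
  obtain r :: nat where r: "4 * (C + 1) \<le> 4 ^ r"
    using real_arch_pow[of 4 "4 * (C + 1)"] by (auto intro: less_imp_le)
  define P where "P j = Q (r + j)" for j
  have P: "tower (r + j) < p \<and> p \<le> tower (Suc (r + j)) \<and> prime p" if "p \<in> P j" for p j
    using Q(1)[of "r + j"] that by (auto simp: P_def primes_in_def)
  have fin: "finite (P j)" for j unfolding P_def by (rule finite_subset[OF Q(1)]) simp
  have disj: "P i \<inter> P j = {}" if "i < j" for i j
  proof -
    have "tower (Suc (r + i)) \<le> tower (r + j)" using that by (intro tower_mono) auto
    thus ?thesis using P[of _ i] P[of _ j] by fastforce
  qed
  show ?thesis
  proof (rule that[of P r])
    show "block_family P (ln 4)"
    proof
      show "P i \<inter> P j = {}" if "i \<noteq> j" for i j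
        using that disj[of i j] disj[of j i] by (cases i j rule: linorder_cases) auto
      show "(\<Sum>p\<in>P j. 1 / real p) \<le> ln 4" for j unfolding P_def by (rule Q)
    qed (use fin P in auto)
    show "tower (r + j) < p \<and> p \<le> tower (Suc (r + j))" if "p \<in> P j" for j p using P[OF that] by blast
    fix i j :: nat assume ij: "1 \<le> j" "i \<le> j"
    define e where "e = 1 / (4 :: real) ^ (r + j)"
    define d where "d = C / 4 ^ (r + j) + real j * e"
    have e0: "e \<ge> 0" by (simp add: e_def)
    have d0: "d \<ge> 0" using C e0 by (simp add: d_def)
    have jd: "real j * d \<le> (1/2) ^ Suc j"
    proof -
      have "real j * d = real j * (C + real j) / 4 ^ (r + j)"
        by (simp add: d_def e_def add_divide_distrib distrib_left)
      also have "\<dots> \<le> (C + 1) * (real j)\<^sup>2 / 4 ^ (r + j)"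
      proof (rule divide_right_mono)
        have "C * real j \<le> C * (real j * real j)" using ij C by (intro mult_left_mono) auto
        thus "real j * (C + real j) \<le> (C + 1) * (real j)\<^sup>2" by (simp add: power2_eq_square algebra_simps)
      qed auto
      also have "\<dots> \<le> (C + 1) * (2 * 2 ^ j) / 4 ^ (r + j)"
      proof (intro divide_right_mono mult_left_mono)
        have "real (j\<^sup>2) \<le> real (2 * 2 ^ j)" using square_le_two_power[of j] by (simp only: of_nat_le_iff)
        thus "(real j)\<^sup>2 \<le> 2 * 2 ^ j" by simp
      qed (use C in auto)
      also have "\<dots> = (4 * (C + 1)) / 4 ^ r * (2 ^ j / (2 * 4 ^ j))" by (simp add: power_add field_simps)
      also have "\<dots> \<le> 1 * (2 ^ j / (2 * 4 ^ j))" using r by (intro mult_right_mono) auto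
      also have "\<dots> = (1/2) ^ Suc j"
      proof -
        have "(4::real) ^ j = 2 ^ j * 2 ^ j" by (simp flip: power_mult_distrib)
        thus ?thesis by (simp add: field_simps power_one_over)
      qed
      finally show ?thesis .
    qed
    have dj: "d \<le> real j * d" using ij d0 mult_right_mono[of 1 "real j" d] by simp
    have "(1/2 :: real) ^ Suc j \<le> 1" by (intro power_le_one) auto
    hence d1: "d \<le> 1" using jd dj by linarith
    define M where "M = ln 4 - C / 4 ^ (r + j)"
    have "M - real j * e = ln 4 - d" by (simp add: M_def d_def)
    have "(M - real j * e) ^ i / fact i \<le> esum i (P j)"
    proof (rule esum_ge[OF fin])
      show "M \<le> (\<Sum>p\<in>P j. 1 / real p)" unfolding M_def P_def by (rule Q)
      show "real j * e \<le> M" using d1 ln_4_ge_1 by (simp add: M_def d_def)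
      fix p assume "p \<in> P j"
      hence "p > tower (r + j)" using P by blast
      hence "p \<ge> 4 ^ (r + j)" using tower_ge[of "r + j"] by linarith
      hence "real p \<ge> real (4 ^ (r + j))" by (simp only: of_nat_le_iff)
      thus "1 / real p \<le> e" unfolding e_def using \<open>p > tower (r + j)\<close> by (intro divide_left_mono) (auto intro!: mult_pos_pos)
    qed (use e0 ij in auto)
    also have "M - real j * e = ln 4 - d" by (simp add: M_def d_def)
    also have "(1 - (1/2) ^ Suc j) * (ln 4 ^ i / fact i) \<le> (ln 4 - d) ^ i / fact i"
    proof -
      have dl: "d / ln 4 \<le> d" using d0 ln_4_ge_1 divide_left_mono[of 1 "ln 4" d] by simp
      have "(1 - (1/2) ^ Suc j) \<le> 1 - real j * d" using jd by simp
      also have "\<dots> \<le> 1 + real i * (- (d / ln 4))"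
      proof -
        have "real i * (d / ln 4) \<le> real j * d" using ij dl d0 by (intro mult_mono) auto
        thus ?thesis by simp
      qed
      also have "\<dots> \<le> (1 + (- (d / ln 4))) ^ i" using dl d1 by (intro Bernoulli_inequality) linarith
      also have "1 + (- (d / ln 4)) = (ln 4 - d) / ln 4" using ln_4_ge_1 by (simp add: field_simps)
      finally have "(1 - (1/2) ^ Suc j) * ln 4 ^ i \<le> (ln 4 - d) ^ i"
        using ln_4_ge_1 by (simp add: power_divide pos_le_divide_eq)
      thus ?thesis by (simp add: divide_right_mono)
    qed
    finally show "esum i (P j) \<ge> (1 - (1/2) ^ Suc j) * (ln 4 ^ i / fact i)" by simp
  qed
qed


text \<open>
  Up to any integer beyond the lower end point of the block, the density of the primes is at most
  \<open>C / (4 ^ j * ln 2)\<close>, by the bound of Chebyshev.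
\<close>

lemma (in block_family) sum_short_interval_le:
  assumes tower: "\<And>p. p \<in> P j \<Longrightarrow> tower (r + j) < p"
    and C: "C \<ge> 0" "\<And>n. n \<ge> 2 \<Longrightarrow> real (card (primes_in 0 n)) \<le> C * real n / ln (real n)"
    and z: "z > 0" "h \<ge> 0"
  shows "(\<Sum>q\<in>{q \<in> P j. z < real q \<and> real q < h * z}. 1 / real q) \<le> (C * h / ln 2) / 4 ^ j"
proof -
  define R where "R = {q \<in> P j. z < real q \<and> real q < h * z}"
  show ?thesis
  proof (cases "R = {}")
    case True
    show ?thesis unfolding R_def[symmetric] True using z C by simp
  next
    case False
    then obtain q where q: "q \<in> P j" "z < real q" "real q < h * z" by (auto simp: R_def)
    define n where "n = nat \<lfloor>h * z\<rfloor>"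
    have hz: "h * z > 0" using q z by linarith
    have n: "real n \<le> h * z" unfolding n_def using hz by simp
    have "q \<le> n" unfolding n_def using q by (simp add: le_nat_floor)
    hence tn: "tower (r + j) \<le> n" using tower[OF q(1)] by linarith
    hence n2: "n \<ge> 2" using tower_ge_2[of "r + j"] by linarith
    have "4 ^ j * ln 2 \<le> 4 ^ (r + j) * ln (2::real)" by (intro mult_right_mono power_increasing) auto
    also have "\<dots> = ln (real (tower (r + j)))" by (simp add: ln_tower)
    also have "\<dots> \<le> ln (real n)" using tn tower_ge_2[of "r + j"] by (subst ln_le_cancel_iff) auto
    finally have ln: "4 ^ j * ln 2 \<le> ln (real n)" .
    have "card R \<le> card (primes_in 0 n)"
    proof (rule card_mono)
      show "R \<subseteq> primes_in 0 n"
        by (auto simp: R_def primes_in_def n_def prime_gt_0_nat le_nat_floor dest: prime_P)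
    qed simp
    hence "real (card R) \<le> C * real n / ln (real n)" using C(2)[OF n2] by linarith
    also have "\<dots> \<le> C * (h * z) / (4 ^ j * ln 2)"
      using ln n C by (intro frac_le mult_left_mono mult_nonneg_nonneg) (use hz z in auto)
    finally have cR: "real (card R) \<le> C * (h * z) / (4 ^ j * ln 2)" .
    have "(\<Sum>q\<in>R. 1 / real q) \<le> (\<Sum>q\<in>R. 1 / z)"
      using z by (intro sum_mono divide_left_mono) (auto simp: R_def intro!: mult_pos_pos)
    also have "\<dots> = real (card R) * (1 / z)" by simp
    also have "\<dots> \<le> C * (h * z) / (4 ^ j * ln 2) * (1 / z)" using cR z by (intro mult_right_mono) auto
    also have "\<dots> = (C * h / ln 2) / 4 ^ j" using z by (simp add: field_simps)
    finally show ?thesis by (simp add: R_def)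
  qed
qed

lemma sum_ln_tower_le: "(\<Sum>j=1..k. ln (real (tower (Suc (r + j))))) \<le> 2 * ln (real (tower (Suc (r + k))))"
proof (induction k)
  case (Suc k)
  have "ln (real (tower (Suc (r + Suc k)))) = 4 * ln (real (tower (Suc (r + k))))"
    by (simp add: ln_tower)
  moreover have "ln (real (tower (Suc (r + k)))) \<ge> 0" by (simp add: ln_tower)
  ultimately show ?case using Suc by simp
qed (simp add: ln_tower)

context block_family
begin

lemma tame_weight_diag_ge:
  assumes c: "\<And>j i. 1 \<le> j \<Longrightarrow> i \<le> j \<Longrightarrow> esum i (P j) \<ge> (1 - (1/2) ^ Suc j) * (mu ^ i / fact i)"
    and k: "k \<ge> 1"
  shows "tame_weight k k \<ge> mu ^ k * (real k + 1) ^ (k - 1) / fact k / 2"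
proof -
  have nn: "mu ^ k * (real k + 1) ^ (k - 1) / fact k \<ge> 0" using mu_pos by simp
  have "(1/2 :: real) \<le> (\<Prod>j=1..k. 1 - (1/2) ^ Suc j)"
    using prod_half_lower[of k] by (smt (verit) zero_le_power half_gt_zero_iff zero_less_power)
  hence "1/2 * (mu ^ k * (real k + 1) ^ (k - 1) / fact k) \<le> (\<Prod>j=1..k. 1 - (1/2) ^ Suc j) * (mu ^ k * (real k + 1) ^ (k - 1) / fact k)"
    using nn by (rule mult_right_mono)
  also have "mu ^ k * (real k + 1) ^ (k - 1) / fact k = mu ^ k * ballot (real k + 1) k"
    using k by (simp add: ballot_eq)
  also have "(\<Prod>j=1..k. 1 - (1/2) ^ Suc j) * (mu ^ k * ballot (real k + 1) k) \<le> tame_weight k k"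
  proof (rule tame_weight_ge)
    show "1 - (1/2 :: real) ^ Suc j \<ge> 0" for j using power_le_one[of "1/2 :: real" "Suc j"] by simp
  qed (use c in auto)
  finally show ?thesis using k by (simp add: ballot_eq)
qed

lemma full_mass_le_tame_weight_diag:
  assumes c: "\<And>j i. 1 \<le> j \<Longrightarrow> i \<le> j \<Longrightarrow> esum i (P j) \<ge> (1 - (1/2) ^ Suc j) * (mu ^ i / fact i)"
    and k: "k \<ge> 1"
  shows "full_mass mu k / (2 * real k) \<le> tame_weight k k"
proof -
  have "full_mass mu k / (2 * real k) = mu ^ k * real k ^ (k - 1) / fact k / 2"
  proof -
    have "real k ^ k = real k ^ (k - 1) * real k" using k by (cases k) (auto simp: mult.commute)
    thus ?thesis using k by (simp add: full_mass_def)
  qed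
  also have "\<dots> \<le> mu ^ k * (real k + 1) ^ (k - 1) / fact k / 2"
    using mu_pos by (intro divide_right_mono mult_left_mono power_mono) auto
  also have "\<dots> \<le> tame_weight k k" using c k by (rule tame_weight_diag_ge)
  finally show ?thesis .
qed

text \<open>
  The ballot numbers with \<open>x = n + 2\<close> at \<open>n\<close> and at \<open>n + 1\<close> have a bounded ratio. With
  \<open>sum_weight_card_inter\<close>, a tame set has on average at most 4 primes in each block.
\<close>

lemma tame_weight_subdiag_le:
  assumes c: "\<And>j i. 1 \<le> j \<Longrightarrow> i \<le> j \<Longrightarrow> esum i (P j) \<ge> (1 - (1/2) ^ Suc j) * (mu ^ i / fact i)"
    and n: "n \<ge> 1"
  shows "mu * tame_weight (Suc n) n \<le> 4 * tame_weight (Suc n) (Suc n)"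
proof -
  obtain m where m: "n = Suc m" using n by (cases n) auto
  define x where "x = real n + 2"
  have x: "x > 0" by (simp add: x_def)
  have "mu * tame_weight (Suc n) n \<le> mu * (mu ^ n * ballot (real (Suc n) + 1) n)"
    using mu_pos tame_weight_le[of n "Suc n"] by (intro mult_left_mono) auto
  also have "ballot (real (Suc n) + 1) n = 2 * x ^ m / fact n"
    using n m by (simp add: ballot_eq x_def add_ac)
  also have "mu * (mu ^ n * (2 * x ^ m / fact n)) = mu ^ Suc n / fact n * (2 * x ^ m)" by simp
  also have "\<dots> \<le> mu ^ Suc n / fact n * (2 * (x ^ n / real (Suc n)))"
  proof (intro mult_left_mono)
    have "x ^ m * real (Suc n) \<le> x ^ m * x" using x by (intro mult_left_mono) (auto simp: x_def)
    thus "x ^ m \<le> x ^ n / real (Suc n)" by (simp add: m pos_le_divide_eq mult.commute del: of_nat_Suc)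
  qed (use mu_pos in auto)
  also have "\<dots> = 4 * (mu ^ Suc n * (real (Suc n) + 1) ^ (Suc n - 1) / fact (Suc n) / 2)"
  proof -
    have "real (Suc n) + 1 = x" by (simp add: x_def)
    thus ?thesis by (simp add: field_simps del: of_nat_Suc)
  qed
  also have "\<dots> \<le> 4 * tame_weight (Suc n) (Suc n)"
    using c by (intro mult_left_mono tame_weight_diag_ge) auto
  finally show ?thesis .
qed

end

section \<open>Large sets of integers with small energy\<close>

text \<open>
  The family of all \<open>m * p\<close> with \<open>m \<le> sqrt N\<close> the product of a tame set and \<open>p\<close> in the window of \<open>m\<close>.
  The parameter \<open>k\<close> must leave \<open>4 ^ k\<close> smaller than \<open>ln N\<close> by a constant factor \<open>M\<close>. Then the primes in the
  blocks are small, and by the inequality of Markov at least half of the tame weight belongs to products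
  not exceeding \<open>sqrt N\<close>.
\<close>

lemma good_sets:
  obtains c C M N0 :: real where "c > 0" "C \<ge> 0" "M \<ge> 1"
    "\<And>N k. k \<ge> 2 \<Longrightarrow> real N \<ge> N0 \<Longrightarrow> M * 4 ^ k \<le> ln (real N) \<Longrightarrow>
       \<exists>B\<subseteq>{1..N}. real (card B) \<ge> c * (real N / ln (real N)) * full_mass (ln 4) k / real k \<and>
         real (card (quads B)) \<le> C * (real N / ln (real N))\<^sup>2 * real k * (full_mass (ln 4) k)\<^sup>2 \<and>
         (\<forall>(a, b, c, d)\<in>quads B. card {a, b, c, d} = 4)"
proof -
  obtain H :: real where H2: "H \<ge> 2"
    and low: "\<And>z. z \<ge> 1 \<Longrightarrow> real (card {p. prime p \<and> z < real p \<and> real p \<le> H * z}) \<ge> z / ln (H * z)"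
    using chebyshev_lower by blast
  note H = H2
  obtain CU where CU: "CU \<ge> 1" and up: "\<And>n. n \<ge> 2 \<Longrightarrow> real (card (primes_in 0 n)) \<le> CU * real n / ln (real n)"
    using chebyshev_upper by blast
  obtain P r where bf: "block_family P (ln 4)"
    and P: "\<And>j p. p \<in> P j \<Longrightarrow> tower (r + j) < p \<and> p \<le> tower (Suc (r + j))"
    and es: "\<And>i j. 1 \<le> j \<Longrightarrow> i \<le> j \<Longrightarrow> esum i (P j) \<ge> (1 - (1/2) ^ Suc j) * (ln 4 ^ i / fact i)"
    by (rule blocks_exist) (rule that)
  interpret block_family P "ln 4" by (rule bf)
  define K where "K = CU * H\<^sup>2 / ln 2"
  have K0: "K \<ge> 0" using CU by (simp add: K_def)
  \<comment> \<open>The mean of \<open>ln (\<Prod>S)\<close> is at most 8 times the logarithm of the last end point, hence at most \<open>ln N / 4\<close>.\<close>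
  define M where "M = 32 * ln (real (tower (Suc r)))"
  show ?thesis
  proof (rule that)
    show "1 / (4 * H) > 0" using H by simp
    show "2 * (4 * CU)\<^sup>2 * (8 * K / ln 4) \<ge> 0" using K0 by simp
    show "M \<ge> 1"
    proof -
      have "ln (2::real) \<ge> 1/2" using ln_4_ge_1 ln_realpow[of "2 :: real" 2] by simp
      moreover have "(4::real) ^ Suc r \<ge> 1" by (rule one_le_power) simp
      ultimately have "1 * (1/2) \<le> 4 ^ Suc r * ln (2::real)" by (intro mult_mono) auto
      thus ?thesis unfolding M_def ln_tower by simp
    qed
    fix N k :: nat
    assume k: "k \<ge> 2" and N: "real N \<ge> max 16 (H ^ 4)" and Mk: "M * 4 ^ k \<le> ln (real N)"
    define T where "T = ln (real (tower (Suc (r + k))))"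
    have "T * 32 = M * 4 ^ k" by (simp add: T_def M_def ln_tower power_add)
    hence T: "32 * T \<le> ln (real N)" using Mk by simp
    have T0: "T > 0" by (simp add: T_def ln_tower)
    have N16: "N \<ge> 16" "real N \<ge> H ^ 4" using N by auto
    have lnN: "ln (real N) > 0" using N16 by simp
    \<comment> \<open>The fourth root of \<open>N\<close> separates the primes of the blocks from \<open>sqrt N / H\<close>.\<close>
    define R where "R = exp (ln (real N) / 4)"
    have R0: "R > 0" by (simp add: R_def)
    have R4: "R ^ 4 = real N" unfolding R_def using N16 by (simp flip: exp_of_nat_mult)
    have lnR: "ln R = ln (real N) / 4" by (simp add: R_def)
    have R2: "R\<^sup>2 = sqrt (real N)"
      using R4 R0 by (intro real_sqrt_unique[symmetric]) (auto simp flip: power_mult)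
    have HR: "H \<le> R"
    proof (rule ccontr)
      assume "\<not> H \<le> R"
      hence "R ^ 4 < H ^ 4" using R0 by (intro power_strict_mono) auto
      thus False using N16 R4 by simp
    qed
    have R2': "R \<ge> 2" using H HR by simp
    interpret large_prime_family P "ln 4" H N k
    proof
      show "H \<ge> 1" using H by simp
      have "H\<^sup>2 < H ^ 4" using H by (intro power_strict_increasing) auto
      thus "H\<^sup>2 < real N" using N16 by simp
      fix p assume "p \<in> U k"
      then obtain j where j: "j \<le> k" "p \<in> P j" by (auto simp: U_def)
      have "p \<le> tower (Suc (r + j))" using P[OF j(2)] by blast
      also have "\<dots> \<le> tower (Suc (r + k))" using j by (intro tower_mono) auto
      finally have "real p \<le> exp T" using tower_ge_2[of "Suc (r + k)"] by (simp add: T_def)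
      also have "\<dots> \<le> R" unfolding R_def using T T0 by simp
      also have "\<dots> \<le> R\<^sup>2 / H" using HR R0 H by (simp add: pos_le_divide_eq power2_eq_square)
      finally show "real p \<le> sqrt (real N) / H" by (simp add: R2)
    qed (use N16 in auto)
    define Gk where "Gk = tame_weight k k"
    have Gk0: "Gk \<ge> 0" by (simp add: Gk_def tame_weight_nonneg)
    have mass: "Gk / 2 \<le> (\<Sum>S\<in>small. weight S)"
    proof -
      obtain n where n: "k = Suc n" "n \<ge> 1" using k by (cases k) auto
      have prodS: "\<Prod>S > 0" if "S \<in> tame k k" for S
        using that by (intro prod_pos_U[of S k]) (auto simp: tame_def)
      have "(ln (real N) / 2) * (\<Sum>S\<in>tame k k - small. weight S) = (\<Sum>S\<in>tame k k - small. weight S * (ln (real N) / 2))"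
        by (simp add: sum_distrib_left mult.commute)
      also have "\<dots> \<le> (\<Sum>S\<in>tame k k - small. weight S * ln (real (\<Prod>S)))"
      proof (intro sum_mono mult_left_mono)
        fix S assume S: "S \<in> tame k k - small"
        hence "real (\<Prod>S) > sqrt (real N)" by (auto simp: small_def simp del: of_nat_prod)
        moreover have "real (\<Prod>S) > 0" using prodS[of S] S by (simp only: of_nat_0_less_iff DiffD1)
        ultimately have "ln (sqrt (real N)) \<le> ln (real (\<Prod>S))"
          using N16 by (subst ln_le_cancel_iff) (auto simp del: of_nat_prod)
        thus "ln (real N) / 2 \<le> ln (real (\<Prod>S))" using N16 by (simp add: ln_sqrt del: of_nat_prod)
      qed auto
      also have "\<dots> \<le> (\<Sum>S\<in>tame k k. weight S * ln (real (\<Prod>S)))"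
      proof (rule sum_mono2)
        fix S assume "S \<in> tame k k - (tame k k - small)"
        hence "real (\<Prod>S) \<ge> 1" using prodS[of S] by (auto simp del: of_nat_prod)
        thus "weight S * ln (real (\<Prod>S)) \<ge> 0" by (intro mult_nonneg_nonneg) (auto simp del: of_nat_prod)
      qed auto
      also have "\<dots> = (\<Sum>S\<in>tame k (Suc n). weight S * ln (real (\<Prod>S)))" by (simp only: n(1))
      also have "\<dots> \<le> (\<Sum>j=1..k. ln (real (tower (Suc (r + j))))) * (ln 4 * tame_weight k n)"
      proof (rule sum_weight_ln_prod)
        fix j p assume "p \<in> P j"
        hence "real p \<le> real (tower (Suc (r + j)))" "p > 0" using P[of p j] by auto
        thus "ln (real p) \<le> ln (real (tower (Suc (r + j))))" by (subst ln_le_cancel_iff) auto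
      qed (simp add: ln_tower)
      also have "\<dots> \<le> (2 * T) * (4 * Gk)"
      proof (rule mult_mono)
        show "(\<Sum>j=1..k. ln (real (tower (Suc (r + j))))) \<le> 2 * T" unfolding T_def by (rule sum_ln_tower_le)
        show "ln 4 * tame_weight k n \<le> 4 * Gk" unfolding Gk_def n(1) using es n(2) by (intro tame_weight_subdiag_le) auto
      qed (use T0 tame_weight_nonneg in auto)
      also have "\<dots> = (8 * T) * Gk" by simp
      also have "\<dots> \<le> (ln (real N) / 4) * Gk" using T Gk0 by (intro mult_right_mono) auto
      finally have "(ln (real N) / 2) * (\<Sum>S\<in>tame k k - small. weight S) \<le> (ln (real N) / 2) * (Gk / 2)" by simp
      hence "(\<Sum>S\<in>tame k k - small. weight S) \<le> Gk / 2" using lnN by (subst (asm) mult_le_cancel_left_pos) auto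
      moreover have "(\<Sum>S\<in>tame k k - small. weight S) = Gk - (\<Sum>S\<in>small. weight S)"
        unfolding Gk_def tame_weight_def by (rule sum_diff) (auto simp: small_def)
      ultimately show ?thesis by linarith
    qed
    have sz: "real N / real (\<Prod>S) \<ge> R\<^sup>2" if S: "S \<in> small" for S
    proof -
      have "real (\<Prod>S) > 0" using smallD(3)[OF S] by (simp only: of_nat_0_less_iff)
      moreover have "R\<^sup>2 * real (\<Prod>S) \<le> R\<^sup>2 * R\<^sup>2" using smallD(4)[OF S] by (intro mult_left_mono) (auto simp: R2)
      moreover have "R\<^sup>2 * R\<^sup>2 = real N" using R4 by (simp flip: power_add)
      ultimately show ?thesis by (simp add: pos_le_divide_eq del: of_nat_prod)
    qed
    show "\<exists>B\<subseteq>{1..N}. real (card B) \<ge> 1 / (4 * H) * (real N / ln (real N)) * full_mass (ln 4) k / real k \<and>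
         real (card (quads B)) \<le> 2 * (4 * CU)\<^sup>2 * (8 * K / ln 4) * (real N / ln (real N))\<^sup>2 * real k * (full_mass (ln 4) k)\<^sup>2 \<and>
         (\<forall>(a, b, c, d)\<in>quads B. card {a, b, c, d} = 4)"
    proof (intro exI[of _ B] conjI)
      show "B \<subseteq> {1..N}" by (rule B_subset)
      show "\<forall>(a, b, c, d)\<in>quads B. card {a, b, c, d} = 4" using quads_B_distinct by blast
      have "1 / (4 * H) * (real N / ln (real N)) * full_mass (ln 4) k / real k
          = real N / (H * ln (real N)) * (full_mass (ln 4) k / (2 * real k) / 2)"
        using k H lnN by (simp add: field_simps)
      also have "\<dots> \<le> real N / (H * ln (real N)) * (Gk / 2)"
        unfolding Gk_def using es k H lnN
        by (intro mult_left_mono divide_right_mono full_mass_le_tame_weight_diag) auto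
      also have "\<dots> \<le> real N / (H * ln (real N)) * (\<Sum>S\<in>small. weight S)"
        using mass H lnN by (intro mult_left_mono) auto
      also have "\<dots> = (\<Sum>S\<in>small. real N / (H * ln (real N)) * weight S)" by (simp add: sum_distrib_left)
      also have "\<dots> \<le> (\<Sum>S\<in>small. real (card (window H N (\<Prod>S))))"
      proof (rule sum_mono)
        fix S assume S: "S \<in> small"
        define m where "m = \<Prod>S"
        have m: "real m \<ge> 1" using smallD(3)[OF S] unfolding m_def by (simp del: of_nat_prod)
        have nm: "real N / real m \<ge> R\<^sup>2" using sz[OF S] unfolding m_def .
        define z where "z = real N / (H * real m)"
        have zH: "H * z = real N / real m" using H by (simp add: z_def)
        have "H * 1 \<le> H * z"
        proof -
          have "H \<le> R * 1" using HR by simp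
          also have "\<dots> \<le> R * R" using R2' by (intro mult_left_mono) auto
          finally show ?thesis unfolding zH using nm by (simp add: power2_eq_square)
        qed
        hence z1: "z \<ge> 1" using H by simp
        have "real N / (H * ln (real N)) * weight S = z / ln (real N)"
          by (simp add: z_def weight_conv_prod m_def mult_ac del: of_nat_prod)
        also have "\<dots> \<le> z / ln (H * z)"
        proof (rule divide_left_mono)
          have "real N / real m \<le> real N" using m by (simp add: divide_le_eq mult_le_cancel_left1)
          thus "ln (H * z) \<le> ln (real N)" unfolding zH using N16 m by (subst ln_le_cancel_iff) auto
          have "H * z > 1" using \<open>H * 1 \<le> H * z\<close> H2 by linarith
          thus "0 < ln (real N) * ln (H * z)" using lnN by simp
        qed (use z1 in auto)
        also have "\<dots> \<le> real (card {p. prime p \<and> z < real p \<and> real p \<le> H * z})" using z1 by (rule low)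
        also have "{p. prime p \<and> z < real p \<and> real p \<le> H * z} = window H N (\<Prod>S)"
          by (simp only: zH window_def) (simp only: z_def m_def)
        finally show "real N / (H * ln (real N)) * weight S \<le> real (card (window H N (\<Prod>S)))" .
      qed
      also have "\<dots> = real (card B)" by (rule card_B[symmetric])
      finally show "real (card B) \<ge> 1 / (4 * H) * (real N / ln (real N)) * full_mass (ln 4) k / real k" .
      define W where "W = 4 * CU * (real N / ln (real N))"
      have W0: "W \<ge> 0" using CU lnN by (simp add: W_def)
      have W: "real (card (window H N (\<Prod>S))) \<le> W * weight S" if S: "S \<in> small" for S
      proof -
        define x where "x = real N / real (\<Prod>S)"
        define n where "n = nat \<lfloor>x\<rfloor>"
        have x: "x \<ge> R\<^sup>2" using sz[OF S] by (simp add: x_def del: of_nat_prod)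
        have RR: "2 * R \<le> R\<^sup>2" using R2' R0 by (simp add: power2_eq_square)
        have n: "real n \<le> x" "x < real n + 1" unfolding n_def using x RR R0 by auto
        have nR: "real n \<ge> R" using n x RR R2' by linarith
        have "window H N (\<Prod>S) \<subseteq> primes_in 0 n"
          by (auto simp: window_def primes_in_def n_def x_def prime_gt_0_nat le_nat_floor simp del: of_nat_prod)
        hence "real (card (window H N (\<Prod>S))) \<le> real (card (primes_in 0 n))"
          by (simp add: card_mono)
        also have "\<dots> \<le> CU * real n / ln (real n)" using nR R2' by (intro up) linarith
        also have "\<dots> \<le> CU * x / (ln (real N) / 4)"
        proof (rule frac_le)
          have "ln R \<le> ln (real n)" using nR R0 by (subst ln_le_cancel_iff) auto
          thus "ln (real N) / 4 \<le> ln (real n)" by (simp add: lnR)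
        qed (use CU n lnN x RR R0 in \<open>auto intro!: mult_left_mono\<close>)
        also have "\<dots> = W * weight S" by (simp add: W_def weight_conv_prod x_def mult_ac del: of_nat_prod)
        finally show ?thesis .
      qed
      have "real (card (quads B)) \<le> 2 * W\<^sup>2 * (\<Sum>(S1, S2, S3, S4)\<in>energy_config H k. weight S1 * weight S2)"
        using W W0 by (rule card_quads_B)
      also have "\<dots> \<le> 2 * W\<^sup>2 * (8 * K / ln 4 * real k * (full_mass (ln 4) k)\<^sup>2)"
      proof (intro mult_left_mono energy_bound)
        fix J and z :: real assume "J \<in> {1..k}" "z > 0"
        show "(\<Sum>q\<in>{q \<in> P J. z < real q \<and> real q < H\<^sup>2 * z}. 1 / real q) \<le> K / 4 ^ J"
          unfolding K_def using P up CU \<open>z > 0\<close> by (intro sum_short_interval_le[of J r]) auto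
      qed (use H K0 in auto)
      also have "\<dots> = 2 * (4 * CU)\<^sup>2 * (8 * K / ln 4) * (real N / ln (real N))\<^sup>2 * real k * (full_mass (ln 4) k)\<^sup>2"
        by (simp only: W_def power_mult_distrib mult_ac)
      finally show "real (card (quads B)) \<le> 2 * (4 * CU)\<^sup>2 * (8 * K / ln 4) * (real N / ln (real N))\<^sup>2 * real k * (full_mass (ln 4) k)\<^sup>2" .
    qed
  qed
qed

section \<open>Choice of parameters\<close>

text \<open>
  The induction step amounts to \<open>exp 1 \<le> (1 + 1 / k) ^ (k + 1)\<close>.
\<close>

lemma fact_le_crude:
  assumes "k \<ge> 1"
  shows "fact k * exp 1 ^ k \<le> exp 1 * real k * real k ^ k"
  using assms
proof (induction k rule: dec_induct)
  case (step k)
  have k: "real k > 0" using step by simp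
  have "exp 1 * real k ^ Suc k \<le> (real k + 1) ^ Suc k"
  proof -
    have "ln (real k / (real k + 1)) \<le> real k / (real k + 1) - 1" using k by (intro ln_le_minus_one) auto
    hence "1 / (real k + 1) \<le> ln ((real k + 1) / real k)" using k by (simp add: ln_div field_simps)
    hence "1 \<le> real (Suc k) * ln ((real k + 1) / real k)" using k by (simp add: field_simps)
    hence "exp 1 \<le> exp (real (Suc k) * ln ((real k + 1) / real k))" by simp
    also have "\<dots> = ((real k + 1) / real k) ^ Suc k" using k by (simp only: exp_of_nat_mult) simp
    finally show ?thesis using k by (simp add: power_divide field_simps)
  qed
  hence "(real k + 1) * (exp 1 * (exp 1 * real k * real k ^ k)) \<le> (real k + 1) * (exp 1 * (real k + 1) ^ Suc k)"
    using k by (intro mult_left_mono) (auto simp: mult_ac)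
  moreover have "(real k + 1) * (exp 1 * (fact k * exp 1 ^ k)) \<le> (real k + 1) * (exp 1 * (exp 1 * real k * real k ^ k))"
    using step by (intro mult_left_mono) auto
  ultimately show ?case by (simp add: algebra_simps)
qed auto

lemma theta_bounds: "0 \<le> theta" "theta \<le> 1"
proof -
  have l: "ln 4 \<ge> (1::real)" by (rule ln_4_ge_1)
  have "ln (ln 4) \<le> ln 4 - (1::real)" using l by (intro ln_le_minus_one) auto
  thus "0 \<le> theta" unfolding theta_altdef using l by (simp add: divide_le_eq)
  have "ln (ln 4) \<ge> (0::real)" using l by simp
  thus "theta \<le> 1" unfolding theta_altdef using l by (simp add: add_nonneg_nonneg)
qed

text \<open>
  This is where \<open>theta\<close> originates: \<open>(1 - theta) * ln 4 = 1 + ln (ln 4)\<close>, in other words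
  \<open>4 powr (1 - theta) = exp 1 * ln 4\<close>.
\<close>

lemma full_mass_ge:
  assumes "k \<ge> 1"
  shows "full_mass (ln 4) k \<ge> (4 ^ k) powr (1 - theta) / (exp 1 * real k)"
proof -
  have l: "ln 4 > (0::real)" using ln_4_ge_1 by linarith
  have "(1 - theta) * ln 4 = 1 + ln (ln 4)" unfolding theta_altdef using l by simp
  hence "(4 ^ k) powr (1 - theta) = exp (real k * (1 + ln (ln 4)))"
    by (simp add: powr_def ln_realpow mult.left_commute mult.commute)
  also have "\<dots> = (exp 1 * ln 4) ^ k" using l by (simp only: exp_of_nat_mult exp_add) simp
  finally have p: "(4 ^ k) powr (1 - theta) = ln 4 ^ k * exp 1 ^ k" by (simp add: power_mult_distrib mult.commute)
  have "fact k * (ln 4 ^ k * exp 1 ^ k) \<le> ln 4 ^ k * (exp 1 * real k * real k ^ k)"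
    using mult_left_mono[OF fact_le_crude[OF assms], of "ln 4 ^ k"] l by (simp add: mult_ac)
  thus ?thesis unfolding p full_mass_def using assms by (simp add: field_simps)
qed

definition target :: "real \<Rightarrow> nat \<Rightarrow> real" where
  "target D N = real N / (ln (real N) powr theta * ln (ln (real N)) powr D)"

text \<open>
  In other words \<open>exp (exp 1) \<le> 16\<close>, which follows from \<open>exp 1 < 2.72 = 68 / 25\<close> and
  \<open>2.72 ^ 68 \<le> 16 ^ 25\<close>.
\<close>

lemma ln_ln_ge_1:
  assumes "N \<ge> (16::nat)"
  shows "ln (ln (real N)) \<ge> 1" "ln (real N) \<ge> 1"
proof -
  have "exp (68 / 25 :: real) ^ 25 = exp 1 ^ 68" by (simp flip: exp_of_nat_mult)
  also have "\<dots> \<le> (272 / 100) ^ 68" using e_less_272 by (intro power_mono) auto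
  also have "\<dots> \<le> (16::real) ^ 25" by (simp add: power_divide divide_le_eq)
  finally have "exp (68 / 25 :: real) \<le> 16" by (rule power_le_imp_le_base[of _ 24, simplified]) simp
  hence "exp (68 / 25) \<le> real N" using assms by linarith
  hence l: "ln (real N) \<ge> 68 / 25" using assms by (subst ln_ge_iff) auto
  thus "ln (real N) \<ge> 1" by linarith
  have "exp 1 \<le> ln (real N)" using l e_less_272 by linarith
  thus "ln (ln (real N)) \<ge> 1" using l by (subst ln_ge_iff) auto
qed

lemma scale_exists:
  fixes x :: real
  assumes "M \<ge> 1" "x \<ge> 16 * M"
  obtains k :: nat where "k \<ge> 2" "M * 4 ^ k \<le> x" "x \<le> 4 * M * 4 ^ k"
proof -
  define y where "y = log 4 (x / M)"
  have xM: "x / M \<ge> 16" using assms by (simp add: pos_le_divide_eq)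
  have "log 4 16 \<le> y" unfolding y_def using xM by (subst log_le_cancel_iff) auto
  moreover have "log 4 16 = (2::real)" using log_pow_cancel[of 4 2] by simp
  ultimately have y2: "y \<ge> 2" by simp
  define k where "k = nat \<lfloor>y\<rfloor>"
  have k: "real k \<le> y" "y < real k + 1" using y2 by (auto simp: k_def)
  have py: "4 powr y = x / M" unfolding y_def using xM by (intro powr_log_cancel) auto
  have pk: "4 powr real k = 4 ^ k" by (simp add: powr_realpow)
  have pk1: "4 powr (real k + 1) = 4 * 4 ^ k" by (simp add: powr_add powr_realpow)
  have "4 powr real k \<le> 4 powr y" using k by (intro powr_mono) auto
  hence 1: "M * 4 ^ k \<le> x" unfolding pk py using assms by (simp add: pos_le_divide_eq mult.commute)
  have "4 powr y \<le> 4 powr (real k + 1)" using k by (intro powr_mono) auto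
  hence 2: "x \<le> 4 * M * 4 ^ k" unfolding pk1 py using assms by (simp add: pos_divide_le_eq mult_ac)
  have "k \<ge> 2" using y2 by (simp add: k_def le_nat_iff le_floor_iff)
  thus ?thesis using 1 2 that by blast
qed

text \<open>
  Let \<open>X = N / ln N * full_mass (ln 4) k\<close>. The family \<open>B\<close> of \<open>good_sets\<close> has at least \<open>c * X / k\<close> elements
  and at most \<open>C * k * X\<^sup>2\<close> nontrivial coincidences. A thin subset with \<open>a\<close> elements, where \<open>a\<close> is the
  target size, keeps at most \<open>a\<^sup>2 * (C / c ^ 4) * k ^ 5 * (a / X)\<^sup>2\<close> of them, and \<open>a / X\<close> is at most a
  constant times \<open>k / L powr D\<close>. With \<open>k \<le> L\<close> this leads to the exponent \<open>7 - 2 * D\<close>.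
\<close>

lemma good_subsets:
  assumes D: "D > 7 / 2"
  obtains C where
    "eventually (\<lambda>N. \<exists>A\<subseteq>{1..N}. real (card A) \<ge> target D N \<and> card A \<ge> 1 \<and>
       \<bar>real (card (A * A)) - (real (card A))\<^sup>2 / 2\<bar>
         \<le> (1 / target D N + C * ln (ln (real N)) powr (7 - 2 * D)) * (real (card A))\<^sup>2) at_top"
proof -
  obtain c C M N0 :: real where c: "c > 0" "C \<ge> 0" "M \<ge> 1"
    and good: "\<And>N k. k \<ge> 2 \<Longrightarrow> real N \<ge> N0 \<Longrightarrow> M * 4 ^ k \<le> ln (real N) \<Longrightarrow>
       \<exists>B\<subseteq>{1..N}. real (card B) \<ge> c * (real N / ln (real N)) * full_mass (ln 4) k / real k \<and>
         real (card (quads B)) \<le> C * (real N / ln (real N))\<^sup>2 * real k * (full_mass (ln 4) k)\<^sup>2 \<and>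
         (\<forall>(a, b, c, d)\<in>quads B. card {a, b, c, d} = 4)"
    by (rule good_sets) (rule that)
  \<comment> \<open>The constant in the bound \<open>X \<ge> Y / k\<close> below, with \<open>Y = c1 * N / (ln N) powr theta\<close>.\<close>
  define c1 where "c1 = 1 / (exp 1 * (4 * M) powr (1 - theta))"
  have c1: "c1 > 0" unfolding c1_def using c by simp
  define C' where "C' = 4 * C / (c ^ 4 * c1\<^sup>2)"
  have C': "C' \<ge> 0" using c by (simp add: C'_def)
  define L where "L = (\<lambda>N::nat. ln (ln (real N)))"
  have Ltop: "filterlim L at_top at_top" unfolding L_def by real_asymp
  have lim: "((\<lambda>N. 2 * L N powr (2 - D)) \<longlongrightarrow> 2 * 0) at_top"
    by (intro tendsto_mult tendsto_const tendsto_neg_powr Ltop) (use D in auto)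
  have ev1: "eventually (\<lambda>N. 2 * L N powr (2 - D) < c * c1) at_top"
    by (rule order_tendstoD(2)[OF lim]) (use c c1 in simp)
  have "filterlim (\<lambda>N. target D N) at_top at_top" unfolding target_def by real_asymp
  hence ev2: "eventually (\<lambda>N. target D N \<ge> 1) at_top" by (simp add: filterlim_at_top)
  have "filterlim (\<lambda>N::nat. ln (real N)) at_top at_top" by real_asymp
  hence ev3: "eventually (\<lambda>N::nat. ln (real N) \<ge> 16 * M) at_top" by (simp add: filterlim_at_top)
  have "filterlim (\<lambda>N::nat. real N) at_top at_top" by real_asymp
  hence ev4: "eventually (\<lambda>N::nat. real N \<ge> N0) at_top" by (simp add: filterlim_at_top)
  show ?thesis
  proof (rule that[of C'])
    show "eventually (\<lambda>N. \<exists>A\<subseteq>{1..N}. real (card A) \<ge> target D N \<and> card A \<ge> 1 \<and>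
       \<bar>real (card (A * A)) - (real (card A))\<^sup>2 / 2\<bar>
         \<le> (1 / target D N + C' * ln (ln (real N)) powr (7 - 2 * D)) * (real (card A))\<^sup>2) at_top"
      using ev1 ev2 ev3 ev4 eventually_ge_at_top[of 16]
    proof eventually_elim
      case (elim N)
      define l where "l = L N"
      have l1: "l \<ge> 1" "ln (real N) \<ge> 1" using ln_ln_ge_1[of N] elim by (auto simp: l_def L_def)
      have N0: "real N > 0" using elim by simp
      have lnN: "ln (real N) > 0" "ln (real N) \<noteq> 0" "l > 0" using l1 by linarith+
      have lnp: "ln (real N) powr s > 0" "l powr s > 0" for s using lnN by (subst powr_gt_zero, linarith)+
      obtain k where k: "k \<ge> 2" "M * 4 ^ k \<le> ln (real N)" "ln (real N) \<le> 4 * M * 4 ^ k"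
        using scale_exists[OF c(3) elim(3)] by blast
      have k0: "real k > 0" using k by simp
      have kl: "real k \<le> l"
      proof -
        have "real k * 1 \<le> real k * ln 4" using ln_4_ge_1 by (intro mult_left_mono) auto
        also have "\<dots> = ln (4 ^ k)" by (simp add: ln_realpow)
        also have "\<dots> \<le> ln (M * 4 ^ k)" using c(3) by (subst ln_le_cancel_iff) auto
        also have "\<dots> \<le> ln (ln (real N))" using k(2) l1 c(3) by (subst ln_le_cancel_iff) auto
        finally show ?thesis by (simp add: l_def L_def)
      qed
      obtain B where B: "B \<subseteq> {1..N}" "real (card B) \<ge> c * (real N / ln (real N)) * full_mass (ln 4) k / real k"
         "real (card (quads B)) \<le> C * (real N / ln (real N))\<^sup>2 * real k * (full_mass (ln 4) k)\<^sup>2"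
         "\<forall>(a, b, c, d)\<in>quads B. card {a, b, c, d} = 4"
        using good[OF k(1) elim(4) k(2)] by blast
      define X where "X = real N / ln (real N) * full_mass (ln 4) k"
      define Y where "Y = c1 * (real N / ln (real N) powr theta)"
      have Y0: "Y > 0" unfolding Y_def using c1 N0 lnp by (intro mult_pos_pos divide_pos_pos)
      have XY: "X \<ge> Y / real k"
      proof -
        have "ln (real N) powr (1 - theta) \<le> (4 * M * 4 ^ k) powr (1 - theta)"
          using k(3) l1 theta_bounds by (intro powr_mono2) auto
        also have "\<dots> = (4 * M) powr (1 - theta) * (4 ^ k) powr (1 - theta)"
          by (rule powr_mult)
        finally have *: "ln (real N) powr (1 - theta) / (4 * M) powr (1 - theta) \<le> (4 ^ k) powr (1 - theta)"
          using c(3) by (simp add: pos_divide_le_eq mult.commute)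
        have "Y / real k = real N / ln (real N) * (ln (real N) powr (1 - theta) / (4 * M) powr (1 - theta) / (exp 1 * real k))"
          using lnN unfolding Y_def c1_def powr_diff by (simp add: mult_ac)
        also have "\<dots> \<le> real N / ln (real N) * ((4 ^ k) powr (1 - theta) / (exp 1 * real k))"
          using * l1 by (intro mult_left_mono divide_right_mono) auto
        also have "\<dots> \<le> X" unfolding X_def using full_mass_ge[of k] k l1 by (intro mult_left_mono) auto
        finally show ?thesis .
      qed
      have X0: "X > 0" using XY Y0 k0 by (meson divide_pos_pos less_le_trans)
      have n: "real (card B) \<ge> c * X / real k" using B(2) by (simp add: X_def)
      have q: "real (card (quads B)) \<le> C * real k * X\<^sup>2" 
      proof -
        have "X\<^sup>2 = (real N / ln (real N))\<^sup>2 * (full_mass (ln 4) k)\<^sup>2" unfolding X_def by (rule power_mult_distrib)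
        thus ?thesis using B(3) by (simp only: mult_ac)
      qed
      define t where "t = target D N"
      have t1: "t \<ge> 1" using elim by (simp add: t_def)
      have "Y / c1 = real N / ln (real N) powr theta" using c1 by (simp add: Y_def)
      hence tY: "t = Y / c1 * l powr (- D)"
        by (simp add: t_def target_def l_def L_def powr_minus divide_inverse)
      define a where "a = nat \<lceil>t\<rceil>"
      have a: "real a \<ge> t" "real a \<le> 2 * t" "a \<ge> 1" using t1 unfolding a_def by (auto, linarith+)
      have fB: "finite B" using B(1) finite_subset by blast
      have "real a \<le> real (card B)"
      proof -
        have "l powr (2 - D) = l\<^sup>2 * l powr (- D)" using powr_add[of l 2 "- D"] lnN(3) by simp
        hence "2 * t = (2 * l powr (2 - D)) * (Y / c1 / l\<^sup>2)" using lnN(3) unfolding tY by simp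
        also have "\<dots> \<le> (c * c1) * (Y / c1 / l\<^sup>2)"
          using elim(1) Y0 c1 by (intro mult_right_mono) (auto simp: l_def)
        also have "\<dots> = c * Y / l\<^sup>2" using c1 by simp
        also have "\<dots> \<le> c * Y / (real k)\<^sup>2"
          using kl k0 c Y0 by (intro divide_left_mono power_mono) auto
        also have "\<dots> = c * (Y / real k) / real k" by (simp add: power2_eq_square)
        also have "\<dots> \<le> c * X / real k" using XY c by (intro divide_right_mono mult_left_mono) auto
        finally show ?thesis using a n by linarith
      qed
      hence an: "a \<le> card B" by simp
      define V where "V = (\<lambda>(a :: nat, b :: nat, c :: nat, d :: nat). {a, b, c, d})"
      have "V q \<subseteq> B \<and> card (V q) = 4" if "q \<in> quads B" for q
        using that B(4) by (auto simp: V_def quads_def)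
      then obtain A where A: "A \<subseteq> B" "card A = a"
        "real (card {q \<in> quads B. V q \<subseteq> A}) * real (card B) ^ 4 \<le> real (card (quads B)) * real a ^ 4"
        using thin_subset[OF fB finite_quads[OF fB], of V 4 a] a(3) an by blast
      have "{q \<in> quads B. V q \<subseteq> A} = quads A" using A(1) by (auto simp: quads_def V_def)
      hence E1: "real (card (quads A)) * real (card B) ^ 4 \<le> real (card (quads B)) * real a ^ 4" using A(3) by simp
      have E2: "real (card (quads A)) \<le> C' * l powr (7 - 2 * D) * (real a)\<^sup>2"
      proof -
        have "real (card (quads A)) * (c * X / real k) ^ 4 \<le> real (card (quads A)) * real (card B) ^ 4"
          using n c X0 k0 by (intro mult_left_mono power_mono) auto
        also have "\<dots> \<le> real (card (quads B)) * real a ^ 4" by (rule E1)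
        also have "\<dots> \<le> (C * real k * X\<^sup>2) * real a ^ 4" using q by (intro mult_right_mono) auto
        finally have "real (card (quads A)) \<le> (C * real k * X\<^sup>2) * real a ^ 4 / (c * X / real k) ^ 4"
          using c X0 k0 by (simp add: pos_le_divide_eq)
        also have "\<dots> = C / c ^ 4 * real k ^ 5 * (real a / X)\<^sup>2 * (real a)\<^sup>2"
        proof -
          have pw: "real a ^ 4 = (real a)\<^sup>2 * (real a)\<^sup>2" "X ^ 4 = X\<^sup>2 * X\<^sup>2" "real k ^ 5 = real k * real k ^ 4"
            by (simp_all flip: power_add power_Suc)
          have frac: "u * x * (v * v) / (w * (x * x) / y) = u / w * y * (v / x) * v"
            if "w \<noteq> 0" "x \<noteq> 0" "y \<noteq> 0" for u v w x y :: real
            using that by (simp add: field_simps)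
          have "C * real k * X\<^sup>2 * ((real a)\<^sup>2 * (real a)\<^sup>2) / (c ^ 4 * (X\<^sup>2 * X\<^sup>2) / real k ^ 4)
              = C * real k / c ^ 4 * real k ^ 4 * ((real a)\<^sup>2 / X\<^sup>2) * (real a)\<^sup>2"
            using c X0 k0 by (intro frac) auto
          thus ?thesis unfolding power_divide power_mult_distrib pw by (simp only: mult.assoc times_divide_eq_left times_divide_eq_right)
        qed
        also have "\<dots> \<le> C / c ^ 4 * real k ^ 5 * (2 * real k / c1 * l powr (- D))\<^sup>2 * (real a)\<^sup>2"
        proof -
          have "real a / X \<le> 2 * t / (Y / real k)" using a XY X0 Y0 k0 t1 by (intro frac_le) auto
          also have "\<dots> = 2 * real k / c1 * l powr (- D)" unfolding tY using Y0 by simp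
          finally have "real a / X \<le> 2 * real k / c1 * l powr (- D)" .
          thus ?thesis using c X0 by (intro mult_right_mono mult_left_mono power_mono) auto
        qed
        also have "\<dots> = C' * (real k ^ 7 * (l powr (- D))\<^sup>2) * (real a)\<^sup>2"
        proof -
          have "real k ^ 7 = real k ^ 5 * (real k)\<^sup>2" by (simp flip: power_add)
          thus ?thesis by (simp add: C'_def power_divide power_mult_distrib mult_ac)
        qed
        also have "\<dots> \<le> C' * (l powr 7 * (l powr (- D))\<^sup>2) * (real a)\<^sup>2"
        proof -
          have "real k ^ 7 \<le> l powr 7" using kl l1 power_mono[of "real k" l 7] by simp
          thus ?thesis using C' by (intro mult_right_mono mult_left_mono) auto
        qed
        also have "(l powr (- D))\<^sup>2 = l powr (- 2 * D)"
        proof -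
          have "(l powr (- D))\<^sup>2 = l powr (- D + - D)" by (simp only: power2_eq_square powr_add)
          also have "- D + - D = - 2 * D" by simp
          finally show ?thesis .
        qed
        also have "l powr 7 * l powr (- 2 * D) = l powr (7 - 2 * D)"
          using powr_add[of l 7 "- 2 * D"] by simp
        finally show ?thesis .
      qed
      have fA: "finite A" "0 \<notin> A" using A(1) B(1) fB finite_subset by auto
      note P = card_product_set_bounds[OF fA, unfolded A(2)]
      have "real a / 2 \<le> 1 / t * (real a)\<^sup>2"
      proof -
        have "t * real a \<le> 2 * (real a)\<^sup>2" using a by (simp add: power2_eq_square)
        thus ?thesis using t1 by (simp add: field_simps)
      qed
      moreover have "C' * l powr (7 - 2 * D) * (real a)\<^sup>2 \<ge> 0" using C' by simp
      ultimately have "\<bar>real (card (A * A)) - (real a)\<^sup>2 / 2\<bar> \<le> (1 / t + C' * l powr (7 - 2 * D)) * (real a)\<^sup>2"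
        using P E2 a(1) unfolding distrib_right add_divide_distrib by linarith
      thus ?case using A B(1) a by (intro exI[of _ A]) (auto simp: t_def l_def L_def)
    qed
  qed
qed

theorem theorem1:
  fixes D :: real
  assumes "D > 7 / 2"
  shows "\<exists>A :: nat \<Rightarrow> nat set.
           (\<forall>N\<ge>10. A N \<subseteq> {1..N}) \<and>
           (\<forall>N\<ge>16. real (card (A N)) \<ge>
              real N / (ln (real N) powr theta * ln (ln (real N)) powr D)) \<and>
           (\<lambda>N. real (card (A N * A N))) \<sim>[at_top] (\<lambda>N. (real (card (A N)))\<^sup>2 / 2)"
proof -
  obtain C where ev: "eventually (\<lambda>N. \<exists>A\<subseteq>{1..N}. real (card A) \<ge> target D N \<and> card A \<ge> 1 \<and>
       \<bar>real (card (A * A)) - (real (card A))\<^sup>2 / 2\<bar>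
         \<le> (1 / target D N + C * ln (ln (real N)) powr (7 - 2 * D)) * (real (card A))\<^sup>2) at_top"
    using good_subsets[OF assms] by blast
  define eta where "eta = (\<lambda>N. 1 / target D N + C * ln (ln (real N)) powr (7 - 2 * D))"
  define good where "good = (\<lambda>N A. A \<subseteq> {1..N} \<and> real (card A) \<ge> target D N \<and> card A \<ge> 1 \<and>
       \<bar>real (card (A * A)) - (real (card A))\<^sup>2 / 2\<bar> \<le> eta N * (real (card A))\<^sup>2)"
  \<comment> \<open>Where no good set exists, \<open>{1..N}\<close> satisfies the size bound; this affects only finitely many \<open>N\<close>.\<close>
  define A where "A = (\<lambda>N. if \<exists>S. good N S then SOME S. good N S else {1..N})"
  have A: "good N (A N)" if "\<exists>S. good N S" for N
    using someI_ex[OF that] that by (simp add: A_def)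
  have A': "A N = {1..N}" if "\<nexists>S. good N S" for N unfolding A_def by (rule if_not_P[OF that])
  have sub: "A N \<subseteq> {1..N}" for N
    using A[of N] A'[of N] by (cases "\<exists>S. good N S") (auto simp: good_def)
  have size: "real (card (A N)) \<ge> target D N" if N: "N \<ge> 16" for N
  proof (cases "\<exists>S. good N S")
    case True
    thus ?thesis using A[of N] by (simp add: good_def)
  next
    case False
    have "1 * 1 \<le> ln (real N) powr theta * ln (ln (real N)) powr D"
      using ln_ln_ge_1[OF N] theta_bounds assms by (intro mult_mono ge_one_powr_ge_zero) auto
    hence "target D N \<le> real N / 1" unfolding target_def by (intro divide_left_mono) auto
    thus ?thesis using A'[OF False] by simp
  qed
  have eta: "eta \<longlonglongrightarrow> 0"
  proof -
    have "filterlim (\<lambda>N. target D N) at_top at_top" unfolding target_def by real_asymp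
    hence 1: "(\<lambda>N. 1 / target D N) \<longlonglongrightarrow> 0"
      by (rule real_tendsto_divide_at_top[OF tendsto_const])
    have "filterlim (\<lambda>N::nat. ln (ln (real N))) at_top at_top" by real_asymp
    hence "(\<lambda>N. C * ln (ln (real N)) powr (7 - 2 * D)) \<longlonglongrightarrow> C * 0"
      using assms by (intro tendsto_mult tendsto_const tendsto_neg_powr) auto
    from tendsto_add[OF 1 this] show ?thesis by (simp add: eta_def)
  qed
  have "((\<lambda>N. real (card (A N * A N)) / ((real (card (A N)))\<^sup>2 / 2) - 1) \<longlongrightarrow> 0) at_top"
  proof (rule Lim_null_comparison)
    show "((\<lambda>N. 2 * eta N) \<longlongrightarrow> 0) at_top" using tendsto_mult[OF tendsto_const[of 2] eta] by simp
    show "eventually (\<lambda>N. norm (real (card (A N * A N)) / ((real (card (A N)))\<^sup>2 / 2) - 1) \<le> 2 * eta N) at_top"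
      using ev
    proof eventually_elim
      case (elim N)
      hence "\<exists>S. good N S" unfolding good_def eta_def by blast
      from A[OF this] have g: "card (A N) \<ge> 1"
        "\<bar>real (card (A N * A N)) - (real (card (A N)))\<^sup>2 / 2\<bar> \<le> eta N * (real (card (A N)))\<^sup>2"
        unfolding good_def by blast+
      define a where "a = real (card (A N))"
      have a: "a\<^sup>2 > 0" using g(1) by (simp add: a_def)
      have "real (card (A N * A N)) / (a\<^sup>2 / 2) - 1 = (real (card (A N * A N)) - a\<^sup>2 / 2) / (a\<^sup>2 / 2)"
        using a by (simp add: diff_divide_distrib)
      moreover have "\<bar>a\<^sup>2 / 2\<bar> = a\<^sup>2 / 2" using a by simp
      ultimately have "norm (real (card (A N * A N)) / (a\<^sup>2 / 2) - 1) = \<bar>real (card (A N * A N)) - a\<^sup>2 / 2\<bar> / (a\<^sup>2 / 2)"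
        by (simp only: real_norm_def abs_divide)
      also have "\<dots> \<le> eta N * a\<^sup>2 / (a\<^sup>2 / 2)" using g(2) a unfolding a_def by (intro divide_right_mono) auto
      also have "\<dots> = 2 * eta N" using a by simp
      finally show ?case by (simp add: a_def)
    qed
  qed
  from tendsto_add[OF this tendsto_const[of 1]]
  have "((\<lambda>N. real (card (A N * A N)) / ((real (card (A N)))\<^sup>2 / 2)) \<longlongrightarrow> 1) at_top" by simp
  hence "(\<lambda>N. real (card (A N * A N))) \<sim>[at_top] (\<lambda>N. (real (card (A N)))\<^sup>2 / 2)"
    by (rule asymp_equivI')
  thus ?thesis using sub size unfolding target_def by blast
qed

end
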